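(* Let $n\ge1$ and $p\ge1$ be integers. The following identity holds in the center $\boldsymbol{\zeta}(n)$ of $\mathbf{U}(gl(n))$: $$\mathbf{K}_n^{p}=(-1)^{n(p-1)}\ \mathbf{C}_n(p-1)\ \mathbf{K}_n^{p-1},$$ where $$\mathbf{C}_n(p-1)=\sum_{j=0}^{n}(-1)^{n-j}(p-1)_{n-j}\ \mathbf{H}_n^{(j)},$$ and $(m)_k=m(m-1)\cdots(m-k+1)$ denotes the falling factorial.
   Context: The Capelli elements are $\mathbf{H}_n^{(0)}=\mathbf{1}$ and, for $1\le k\le n$, $\mathbf{H}_n^{(k)}=\sum_{1\le i_1<\cdots<i_k\le n}\mathbf{cdet}\big[e_{i_r,i_s}+\delta_{rs}(k-r)\big]_{r,s=1,\dots,k}\in\mathbf{U}(gl(n))$, where $\mathbf{cdet}[a_{rs}]=\sum_\sigma(-1)^{|\sigma|}a_{\sigma(1),1}a_{\sigma(2),2}\cdots a_{\sigma(k),k}$ is the column determinant and $e_{i,j}$ are the elementary matrices. Capelli bitableaux. Let $\mathcal{A}_0=\{\alpha_1,\dots,\alpha_{m}\}$ ($m$ sufficiently large) be a set of virtual symbols, with $|\alpha_s|=0\in\mathbb{Z}_2$, and $\mathcal{L}=\{1,\dots,n\}$ the proper symbols, with $|i|=1\in\mathbb{Z}_2$. Let $gl(m|n)$ be the complex Lie superalgebra with basis $e_{a,b}$, $a,b\in\mathcal{A}_0\cup\mathcal{L}$, of parity $|a|+|b|$, and superbracket $[e_{a,b},e_{c,d}]=\delta_{bc}e_{a,d}-(-1)^{(|a|+|b|)(|c|+|d|)}\delta_{ad}e_{c,b}$.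 The enveloping algebra $\mathbf{U}(gl(n))$ is the subalgebra of $\mathbf{U}(gl(m|n))$ generated by the $e_{i,j}$, $i,j\in\mathcal{L}$. A product $e_{a_r,b_r}\cdots e_{a_1,b_1}$ is irregular if there are $i\le r$ and $\gamma\in\mathcal{A}_0$ with $\#\{j\le i: b_j=\gamma\}>\#\{j<i: a_j=\gamma\}$. Let $\mathbf{Irr}$ be the left ideal of $\mathbf{U}(gl(m|n))$ generated by the irregular products. It is known that $\mathbf{U}(gl(n))\cap\mathbf{Irr}=0$, that $Virt(m,n)=\mathbf{U}(gl(n))\oplus\mathbf{Irr}$ is a subalgebra, and that $\mathbf{Irr}$ is a two-sided ideal of it; the Capelli devirtualization epimorphism $\mathfrak{p}:Virt(m,n)\to\mathbf{U}(gl(n))$ is the projection with kernel $\mathbf{Irr}$. For Young tableaux $S=(s_{ij})$, $T=(t_{ij})$ of the same shape $\lambda=(\lambda_1\ge\dots\ge\lambda_p)$ with entries in $\mathcal{L}$, the Capelli bitableau is $$[S|T]=\mathfrak{p}\Big(\prod_{i=1}^{p}\big(e_{s_{i1},\alpha_i}e_{s_{i2},\alpha_i}\cdots e_{s_{i\lambda_i},\alpha_i}\big)\cdot\prod_{i=1}^{p}\big(e_{\alpha_i,t_{i1}}e_{\alpha_i,t_{i2}}\cdots e_{\alpha_i,t_{i\lambda_i}}\big)\Big),$$ with products ordered from left to right by increasing $i$ and $\alpha_1,\dots,\alpha_p$ distinct virtual symbols (the argument lies in $Virt(m,n)$ and the result does not depend on the choice of the $\alpha_i$). $\mathbf{K}_n^p=[S|T]$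 where $S$ and $T$ have $p$ rows, every row of $S$ is $n\ (n-1)\ \cdots\ 2\ 1$ and every row of $T$ is $1\ 2\ \cdots\ n$; $\mathbf{K}_n^0=\mathbf{1}$. *)

theory Defs
  imports
    "HOL-Algebra.Generated_Rings"
    "HOL-Algebra.QuotRing"
    "HOL-Combinatorics.Permutations"
    "HOL-Library.Poly_Mapping"
begin

text \<open>Words are lists wrapped in a datatype so that they form an additively written monoid under
  concatenation; the convolution product of finitely supported functions on words is then the
  product of the free algebra.\<close>

datatype 'a fword = FWord (letters: "'a list")

instantiation fword :: (type) monoid_add
begin

definition zero_fword :: "'a fword"
  where "zero_fword = FWord []"

definition plus_fword :: "'a fword \<Rightarrow> 'a fword \<Rightarrow> 'a fword"
  where "plus_fword v w = FWord (letters v @ letters w)"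

instance
  by standard (simp_all add: zero_fword_def plus_fword_def)

end

type_synonym 'a free_algebra = "'a fword \<Rightarrow>\<^sub>0 complex"

definition gen :: "'a \<Rightarrow> 'a free_algebra"
  where "gen x = Poly_Mapping.single (FWord [x]) 1"

definition const :: "complex \<Rightarrow> 'a free_algebra"
  where "const c = Poly_Mapping.single 0 c"

definition free_alg :: "'a set \<Rightarrow> 'a free_algebra ring"
  where "free_alg X =
    \<lparr>carrier = {f. \<forall>w \<in> Poly_Mapping.keys f. set (letters w) \<subseteq> X},
     monoid.mult = (*), one = 1, zero = 0, add = (+)\<rparr>"

lemma ring_free_alg: "ring (free_alg X)"
proof (rule ringI)
  show "abelian_group (free_alg X)"
  proof (rule abelian_groupI)
    fix f g assume "f \<in> carrier (free_alg X)" "g \<in> carrier (free_alg X)"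
    then show "f \<oplus>\<^bsub>free_alg X\<^esub> g \<in> carrier (free_alg X)"
      using keys_add[of f g] by (auto simp: free_alg_def)
  next
    fix f assume "f \<in> carrier (free_alg X)"
    then show "\<exists>g\<in>carrier (free_alg X). g \<oplus>\<^bsub>free_alg X\<^esub> f = \<zero>\<^bsub>free_alg X\<^esub>"
      by (intro bexI[of _ "- f"]) (auto simp: free_alg_def)
  qed (auto simp: free_alg_def algebra_simps)
  show "monoid (free_alg X)"
  proof (rule monoidI)
    fix f g assume fg: "f \<in> carrier (free_alg X)" "g \<in> carrier (free_alg X)"
    have "set (letters w) \<subseteq> X" if w: "w \<in> Poly_Mapping.keys (f * g)" for w
    proof -
      from w keys_mult[of f g] obtain u v where "w = u + v" "u \<in> Poly_Mapping.keys f" "v \<in> Poly_Mapping.keys g"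
        by blast
      with fg show ?thesis by (simp add: free_alg_def plus_fword_def)
    qed
    then show "f \<otimes>\<^bsub>free_alg X\<^esub> g \<in> carrier (free_alg X)"
      by (simp add: free_alg_def)
  qed (auto simp: free_alg_def algebra_simps zero_fword_def)
qed (auto simp: free_alg_def algebra_simps)

datatype symbol = Virt nat | Proper nat

definition symbols :: "nat \<Rightarrow> nat \<Rightarrow> symbol set"
  where "symbols m n = Virt ` {1..m} \<union> Proper ` {1..n}"

primrec parity :: "symbol \<Rightarrow> nat" where
  "parity (Virt s) = 0"
| "parity (Proper i) = 1"

text \<open>A pair \<open>(a, b)\<close> stands for the basis element \<open>e\<^sub>a\<^sub>b\<close> of \<open>gl(m|n)\<close>.\<close>

definition koszul :: "symbol \<times> symbol \<Rightarrow> symbol \<times> symbol \<Rightarrow> complex"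
  where "koszul x y =
    (- 1) ^ ((parity (fst x) + parity (snd x)) * (parity (fst y) + parity (snd y)))"

definition superbracket ::
    "symbol \<times> symbol \<Rightarrow> symbol \<times> symbol \<Rightarrow> (symbol \<times> symbol) free_algebra"
  where "superbracket x y =
    (if snd x = fst y then gen (fst x, snd y) else 0)
    - const (koszul x y) * (if fst x = snd y then gen (fst y, snd x) else 0)"

text \<open>By bilinearity it suffices to impose the defining relations of the enveloping algebra on
  basis elements.\<close>

definition env_ideal :: "nat \<Rightarrow> nat \<Rightarrow> (symbol \<times> symbol) free_algebra set"
  where "env_ideal m n =
    genideal (free_alg (symbols m n \<times> symbols m n))
      {gen x * gen y - const (koszul x y) * gen y * gen x - superbracket x y | x y.
         x \<in> symbols m n \<times> symbols m n \<and> y \<in> symbols m n \<times> symbols m n}"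

definition env :: "nat \<Rightarrow> nat \<Rightarrow> (symbol \<times> symbol) free_algebra set ring"
  where "env m n = free_alg (symbols m n \<times> symbols m n) Quot env_ideal m n"

definition env_class ::
    "nat \<Rightarrow> nat \<Rightarrow> (symbol \<times> symbol) free_algebra \<Rightarrow> (symbol \<times> symbol) free_algebra set"
  where "env_class m n f = env_ideal m n +>\<^bsub>free_alg (symbols m n \<times> symbols m n)\<^esub> f"

definition e :: "nat \<Rightarrow> nat \<Rightarrow> symbol \<Rightarrow> symbol \<Rightarrow> (symbol \<times> symbol) free_algebra set"
  where "e m n a b = env_class m n (gen (a, b))"

text \<open>\<open>U(gl(n))\<close> as a unital complex subalgebra of \<open>U(gl(m|n))\<close>: adjoining the scalars to the
  generators turns the generated subring into the generated subalgebra.\<close>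

definition env_gl :: "nat \<Rightarrow> nat \<Rightarrow> (symbol \<times> symbol) free_algebra set set"
  where "env_gl m n =
    generate_ring (env m n)
      (range (\<lambda>c. env_class m n (const c))
       \<union> {e m n (Proper i) (Proper j) | i j. i \<in> {1..n} \<and> j \<in> {1..n}})"

definition env_gl_center :: "nat \<Rightarrow> nat \<Rightarrow> (symbol \<times> symbol) free_algebra set set"
  where "env_gl_center m n =
    {z \<in> env_gl m n. \<forall>x \<in> env_gl m n. z \<otimes>\<^bsub>env m n\<^esub> x = x \<otimes>\<^bsub>env m n\<^esub> z}"

definition lprod :: "('a, 'b) ring_scheme \<Rightarrow> 'a list \<Rightarrow> 'a"
  where "lprod R xs = foldr (\<otimes>\<^bsub>R\<^esub>) xs \<one>\<^bsub>R\<^esub>"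

definition cdet :: "('a, 'b) ring_scheme \<Rightarrow> nat \<Rightarrow> (nat \<Rightarrow> nat \<Rightarrow> 'a) \<Rightarrow> 'a"
  where "cdet R k a =
    (\<Oplus>\<^bsub>R\<^esub>\<sigma> \<in> {\<sigma>. \<sigma> permutes {1..k}}.
       [sign \<sigma>] \<cdot>\<^bsub>R\<^esub> lprod R (map (\<lambda>s. a (\<sigma> s) s) [1..<Suc k]))"

text \<open>Lists are indexed from 0, so \<open>i\<^sub>r\<close> is \<open>is ! (r - 1)\<close>.\<close>

definition capelli_H :: "nat \<Rightarrow> nat \<Rightarrow> nat \<Rightarrow> (symbol \<times> symbol) free_algebra set"
  where "capelli_H m n k =
    (if k = 0 then \<one>\<^bsub>env m n\<^esub>
     else (\<Oplus>\<^bsub>env m n\<^esub>is \<in> {is. length is = k \<and> sorted_wrt (<) is \<and> set is \<subseteq> {1..n}}.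
       cdet (env m n) k (\<lambda>r s.
         e m n (Proper (is ! (r - 1))) (Proper (is ! (s - 1)))
         \<oplus>\<^bsub>env m n\<^esub> (if r = s then [(k - r)] \<cdot>\<^bsub>env m n\<^esub> \<one>\<^bsub>env m n\<^esub> else \<zero>\<^bsub>env m n\<^esub>))))"

definition mon :: "nat \<Rightarrow> nat \<Rightarrow> (symbol \<times> symbol) list \<Rightarrow> (symbol \<times> symbol) free_algebra set"
  where "mon m n xs = lprod (env m n) (map (\<lambda>(a, b). e m n a b) xs)"

text \<open>The factors of a product are numbered from right to left, starting with 0 here: for
  \<open>v = rev xs\<close>, the factor number \<open>j\<close> is \<open>v ! j\<close>.\<close>

definition irregular :: "nat \<Rightarrow> (symbol \<times> symbol) list \<Rightarrow> bool"
  where "irregular m xs \<longleftrightarrow>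
    (let v = rev xs in
      \<exists>i < length v. \<exists>\<gamma> \<in> Virt ` {1..m}.
        card {j. j \<le> i \<and> snd (v ! j) = \<gamma>} > card {j. j < i \<and> fst (v ! j) = \<gamma>})"

definition genleftideal :: "('a, 'b) ring_scheme \<Rightarrow> 'a set \<Rightarrow> 'a set"
  where "genleftideal R S =
    \<Inter>{I. additive_subgroup I R \<and> (\<forall>r \<in> carrier R. \<forall>x \<in> I. r \<otimes>\<^bsub>R\<^esub> x \<in> I) \<and> S \<subseteq> I}"

definition Irr :: "nat \<Rightarrow> nat \<Rightarrow> (symbol \<times> symbol) free_algebra set set"
  where "Irr m n =
    genleftideal (env m n)
      {mon m n xs | xs. set xs \<subseteq> symbols m n \<times> symbols m n \<and> irregular m xs}"

text \<open>The projection onto the first summand of \<open>Virt(m,n) = U(gl(n)) \<oplus> Irr\<close>; it is meaningful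
  only on this direct sum.\<close>

definition devirt ::
    "nat \<Rightarrow> nat \<Rightarrow> (symbol \<times> symbol) free_algebra set \<Rightarrow> (symbol \<times> symbol) free_algebra set"
  where "devirt m n x = (THE y. y \<in> env_gl m n \<and> x \<ominus>\<^bsub>env m n\<^esub> y \<in> Irr m n)"

text \<open>A tableau is the list of its rows. The two arguments are meant to have the same shape, with
  at most \<open>m\<close> rows; row number \<open>i\<close> (counted from 0 in the list) uses the virtual symbol
  \<open>Virt (i + 1)\<close>.\<close>

definition capelli_bitableau ::
    "nat \<Rightarrow> nat \<Rightarrow> nat list list \<Rightarrow> nat list list \<Rightarrow> (symbol \<times> symbol) free_algebra set"
  where "capelli_bitableau m n S T =
    devirt m n
      (mon m n (concat (map (\<lambda>i. map (\<lambda>s. (Proper s, Virt (i + 1))) (S ! i)) [0..<length S]))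
       \<otimes>\<^bsub>env m n\<^esub>
       mon m n (concat (map (\<lambda>i. map (\<lambda>t. (Virt (i + 1), Proper t)) (T ! i)) [0..<length T])))"

definition capelli_K :: "nat \<Rightarrow> nat \<Rightarrow> nat \<Rightarrow> (symbol \<times> symbol) free_algebra set"
  where "capelli_K m n p =
    (if p = 0 then \<one>\<^bsub>env m n\<^esub>
     else capelli_bitableau m n (replicate p (rev [1..<Suc n])) (replicate p [1..<Suc n]))"

definition falling_factorial :: "int \<Rightarrow> nat \<Rightarrow> int"
  where "falling_factorial a k = (\<Prod>i<k. a - int i)"

definition capelli_C :: "nat \<Rightarrow> nat \<Rightarrow> nat \<Rightarrow> (symbol \<times> symbol) free_algebra set"
  where "capelli_C m n q =
    (\<Oplus>\<^bsub>env m n\<^esub>j \<in> {0..n}.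
       [((- 1) ^ (n - j) * falling_factorial (int q) (n - j))] \<cdot>\<^bsub>env m n\<^esub> capelli_H m n j)"

end

theory Submission
  imports Defs "HOL-Library.Function_Algebras" "HOL-Library.Nat_Bijection"
begin

text \<open>Put \<open>D\<^sub>\<alpha> = e\<^sub>n\<^sub>\<alpha> \<cdots> e\<^sub>1\<^sub>\<alpha>\<close> and \<open>A\<^sub>\<alpha> = e\<^sub>\<alpha>\<^sub>1 \<cdots> e\<^sub>\<alpha>\<^sub>n\<close> for a virtual symbol \<open>\<alpha>\<close>, and
\<open>x\<^sub>p = D\<^sub>1 \<cdots> D\<^sub>p A\<^sub>1 \<cdots> A\<^sub>p\<close>, whose projection modulo \<open>Irr\<close> is \<open>K\<^sub>n\<^sup>p\<close>. All factors \<open>e\<^sub>\<alpha>\<^sub>i\<close>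
are odd and anticommute, so moving \<open>A\<^sub>p\<close> to the front of the \<open>A\<close>s costs the sign
\<open>(-1)\<^bsup>n(p-1)\<^esup>\<close> and leaves \<open>D\<^sub>1 \<cdots> D\<^sub>p\<^sub>-\<^sub>1 (D\<^sub>p A\<^sub>p) W\<close> with \<open>W = A\<^sub>1 \<cdots> A\<^sub>p\<^sub>-\<^sub>1\<close>.

Three facts about \<open>D\<^sub>p A\<^sub>p W\<close> give the recursion. First, expanding column by column and discarding
every word that annihilates the symbol \<open>p\<close> too often shows that \<open>D\<^sub>p A\<^sub>p W\<close> is \<open>H\<^sub>n\<^sup>(\<^sup>n\<^sup>) W\<close>
modulo \<open>Irr\<close>; this is Capelli's identity (\<open>annihs_creats_word\<close>). Second, each \<open>A\<^sub>\<alpha>\<close> is a top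
exterior product, on which \<open>gl(n)\<close> acts through the trace, so \<open>e\<^sub>i\<^sub>j\<close> passes \<open>W\<close> at the cost of
\<open>p - 1\<close> on the diagonal (\<open>polar_rows\<close>). Third, the determinant \<open>H\<^sub>n\<^sup>(\<^sup>n\<^sup>)\<close> with its diagonal lowered by
\<open>q\<close> equals \<open>C\<^sub>n(q)\<close> (\<open>capelli_det_neg\<close>); the reason is that raising the diagonal by one changes
such a determinant by the sum of its principal minors. Hence
\<open>x\<^sub>p \<equiv> (-1)\<^bsup>n(p-1)\<^esup> x\<^sub>p\<^sub>-\<^sub>1 C\<^sub>n(p - 1)\<close> modulo \<open>Irr\<close>, which is \<open>capelli_step\<close>.

To read this congruence as an equation for \<open>K\<^sub>n\<^sup>p\<close>, the sum of \<open>U(gl(n))\<close> and \<open>Irr\<close> has to be direct.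
This is proved with the module of \<open>gl(m|n)\<close> induced from \<open>U(gl(n))\<close>: an exterior algebra on
generators \<open>\<xi>\<^sub>\<alpha>\<^sub>i\<close> with coefficients in \<open>U(gl(n))\<close>, on which \<open>e\<^sub>\<alpha>\<^sub>i\<close> multiplies by \<open>\<xi>\<^sub>\<alpha>\<^sub>i\<close>. The
vacuum contains no virtual symbol, so irregular words kill it, whereas \<open>y \<in> U(gl(n))\<close> sends it to
\<open>y\<close> times the vacuum. Applying also \<open>W\<close> yields a stronger statement: \<open>W y \<in> Irr\<close> forces \<open>y = 0\<close>
(\<open>creat_rows_faithful\<close>).

The same statement proves centrality. The products \<open>x\<^sub>p\<close> and \<open>D\<^sub>p A\<^sub>p\<close> commute with \<open>gl(n)\<close>, and so
\<open>[e\<^sub>i\<^sub>j, K\<^sub>n\<^sup>p]\<close> and \<open>W [e\<^sub>i\<^sub>j, C\<^sub>n(p - 1)]\<close> lie in \<open>Irr\<close>; therefore both commutators vanish.\<close>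

section \<open>Determinants with a shifted diagonal\<close>

text \<open>Permuting a set \<open>S\<close> of indices of a fixed matrix, instead of positions \<open>1, \<dots>, k\<close>, makes the principal
minors of a determinant restrictions of it. If \<open>s\<close> is the \<open>r\<close>-th of the \<open>k\<close> elements of \<open>S\<close>, then
\<open>card {t \<in> S. s < t}\<close> is the number \<open>k - r\<close> on the diagonal of the Capelli determinant, and \<open>u\<close> amounts to
replacing \<open>z\<^sub>s\<^sub>s\<close> by \<open>z\<^sub>s\<^sub>s + u\<close>.\<close>

definition capelli_det :: "(nat \<Rightarrow> nat \<Rightarrow> 'a::ring_1) \<Rightarrow> int \<Rightarrow> nat set \<Rightarrow> 'a"
  where "capelli_det z u S =
    (\<Sum>\<sigma> | \<sigma> permutes S. of_int (sign \<sigma>) *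
       prod_list (map (\<lambda>s. z (\<sigma> s) s + (if \<sigma> s = s then of_int (u + int (card {t \<in> S. s < t})) else 0))
         (sorted_list_of_set S)))"

text \<open>The factors \<open>g\<close> are exchanged for \<open>f\<close> one by one, starting from the right; the exchange at \<open>c\<close>
happens when the factors before \<open>c\<close> are still \<open>g\<close> and those after it are already \<open>f\<close>.\<close>

lemma prod_list_telescope:
  fixes f g :: "nat \<Rightarrow> 'a::ring_1"
  assumes "sorted_wrt (<) xs" and "\<And>c. c \<in> set xs \<Longrightarrow> f c - g c = (if P c then 1 else 0)"
  shows "prod_list (map f xs) - prod_list (map g xs)
    = (\<Sum>c | c \<in> set xs \<and> P c. prod_list (map (\<lambda>s. if s < c then g s else f s) (remove1 c xs)))"
  using assms
proof (induction xs)
  case Nil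
  then show ?case by simp
next
  case (Cons x xs)
  let ?h = "\<lambda>c s. if s < c then g s else f s"
  have x: "x < s" if "s \<in> set xs" for s
    using Cons.prems(1) that by simp
  have IH: "prod_list (map f xs) - prod_list (map g xs)
    = (\<Sum>c | c \<in> set xs \<and> P c. prod_list (map (?h c) (remove1 c xs)))"
    using Cons by simp
  have tail: "prod_list (map (?h c) (remove1 c (x # xs))) = g x * prod_list (map (?h c) (remove1 c xs))"
    if "c \<in> set xs" for c
    using x[OF that] by simp
  have head: "map (?h x) (remove1 x (x # xs)) = map f xs"
    by (auto dest: x)
  have split: "{c. c \<in> set (x # xs) \<and> P c} = (if P x then {x} else {}) \<union> {c. c \<in> set xs \<and> P c}"
    by auto
  have "x \<notin> set xs"
    using x by auto
  then have "(\<Sum>c | c \<in> set (x # xs) \<and> P c. prod_list (map (?h c) (remove1 c (x # xs))))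
     = (\<Sum>c \<in> (if P x then {x} else {}). prod_list (map (?h c) (remove1 c (x # xs))))
     + (\<Sum>c | c \<in> set xs \<and> P c. prod_list (map (?h c) (remove1 c (x # xs))))"
    unfolding split by (intro sum.union_disjoint) auto
  also have "(\<Sum>c \<in> (if P x then {x} else {}). prod_list (map (?h c) (remove1 c (x # xs))))
     = (f x - g x) * prod_list (map f xs)"
    using Cons.prems(2)[of x] head by (auto simp del: remove1.simps)
  also have "(\<Sum>c | c \<in> set xs \<and> P c. prod_list (map (?h c) (remove1 c (x # xs))))
     = g x * (prod_list (map f xs) - prod_list (map g xs))"
    unfolding IH sum_distrib_left by (intro sum.cong refl tail) auto
  finally show ?case
    by (simp add: algebra_simps)
qed

lemma permutes_fixing:
  "c \<in> S \<Longrightarrow> {\<sigma>. \<sigma> permutes S \<and> \<sigma> c = c} = {\<sigma>. \<sigma> permutes (S - {c})}"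
  by (auto simp: permutes_def)

text \<open>A permutation contributes to the difference once for each of its fixed points \<open>c\<close>, and then permutes
\<open>S - {c}\<close>. Deleting \<open>c\<close> lowers the number of later indices by one exactly at the indices before \<open>c\<close>,
and those are the ones where telescoping has left the shift \<open>u\<close>. So all remaining factors belong to the
minor with shift \<open>u + 1\<close>.\<close>

lemma capelli_det_diff:
  fixes z :: "nat \<Rightarrow> nat \<Rightarrow> 'a::ring_1"
  assumes "finite S"
  shows "capelli_det z (u + 1) S - capelli_det z u S = (\<Sum>c\<in>S. capelli_det z (u + 1) (S - {c}))"
proof -
  let ?xs = "sorted_list_of_set S"
  define f where "f v T \<sigma> s = z (\<sigma> s) s + (if \<sigma> s = s then of_int (v + int (card {t \<in> T. s < t})) else 0)"
    for v T \<sigma> s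
  have fin: "finite {\<sigma>. \<sigma> permutes S}"
    using assms by (rule finite_permutations)
  have minor: "map (\<lambda>s. if s < c then f u S \<sigma> s else f (u + 1) S \<sigma> s) (remove1 c ?xs)
      = map (f (u + 1) (S - {c}) \<sigma>) (sorted_list_of_set (S - {c}))" if c: "c \<in> S" for c \<sigma>
  proof -
    have "(if s < c then f u S \<sigma> s else f (u + 1) S \<sigma> s) = f (u + 1) (S - {c}) \<sigma> s"
      if s: "s \<in> S - {c}" for s
    proof (cases "s < c")
      case True
      have "{t \<in> S. s < t} = insert c {t \<in> S - {c}. s < t}"
        using True c by auto
      then have "card {t \<in> S. s < t} = Suc (card {t \<in> S - {c}. s < t})"
        using assms by (simp add: card_insert_if)
      with True show ?thesis by (simp add: f_def)
    next
      case False
      then have "{t \<in> S - {c}. s < t} = {t \<in> S. s < t}"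
        by auto
      with False show ?thesis by (simp add: f_def)
    qed
    then show ?thesis
      using assms c by (simp add: sorted_list_of_set_remove[symmetric])
  qed
  have "capelli_det z (u + 1) S - capelli_det z u S
    = (\<Sum>\<sigma> | \<sigma> permutes S. of_int (sign \<sigma>) *
        (prod_list (map (f (u + 1) S \<sigma>) ?xs) - prod_list (map (f u S \<sigma>) ?xs)))"
    by (simp add: capelli_det_def f_def[abs_def] sum_subtractf right_diff_distrib)
  also have "\<dots> = (\<Sum>\<sigma> | \<sigma> permutes S. \<Sum>c | c \<in> S \<and> \<sigma> c = c. of_int (sign \<sigma>) *
        prod_list (map (f (u + 1) (S - {c}) \<sigma>) (sorted_list_of_set (S - {c}))))"
  proof (intro sum.cong refl)
    fix \<sigma>
    have "prod_list (map (f (u + 1) S \<sigma>) ?xs) - prod_list (map (f u S \<sigma>) ?xs)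
      = (\<Sum>c | c \<in> set ?xs \<and> \<sigma> c = c.
          prod_list (map (\<lambda>s. if s < c then f u S \<sigma> s else f (u + 1) S \<sigma> s) (remove1 c ?xs)))"
      by (rule prod_list_telescope) (auto simp: f_def strict_sorted_list_of_set)
    also have "\<dots> = (\<Sum>c | c \<in> S \<and> \<sigma> c = c.
        prod_list (map (f (u + 1) (S - {c}) \<sigma>) (sorted_list_of_set (S - {c}))))"
      using assms by (intro sum.cong arg_cong[where f = prod_list] minor) auto
    finally show "of_int (sign \<sigma>) *
        (prod_list (map (f (u + 1) S \<sigma>) ?xs) - prod_list (map (f u S \<sigma>) ?xs))
      = (\<Sum>c | c \<in> S \<and> \<sigma> c = c. of_int (sign \<sigma>) *
        prod_list (map (f (u + 1) (S - {c}) \<sigma>) (sorted_list_of_set (S - {c}))))"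
      by (simp add: sum_distrib_left)
  qed
  also have "\<dots> = (\<Sum>c\<in>S. \<Sum>\<sigma> | \<sigma> permutes S \<and> \<sigma> c = c. of_int (sign \<sigma>) *
        prod_list (map (f (u + 1) (S - {c}) \<sigma>) (sorted_list_of_set (S - {c}))))"
    using sum.swap_restrict[OF fin assms, of _ "\<lambda>\<sigma> c. \<sigma> c = c"] by simp
  also have "\<dots> = (\<Sum>c\<in>S. capelli_det z (u + 1) (S - {c}))"
    by (intro sum.cong refl) (simp add: permutes_fixing capelli_det_def f_def[abs_def])
  finally show ?thesis .
qed

lemma falling_factorial_Suc:
  "falling_factorial (int (Suc q)) (Suc d)
    = falling_factorial (int q) (Suc d) + int (Suc d) * falling_factorial (int q) d"
proof -
  have "falling_factorial (int (Suc q)) (Suc d) = int (Suc q) * falling_factorial (int q) d"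
    by (simp add: falling_factorial_def prod.lessThan_Suc_shift del: prod.lessThan_Suc)
  then show ?thesis
    by (simp add: falling_factorial_def algebra_simps)
qed

text \<open>Induction on \<open>q\<close> through \<open>capelli_det_diff\<close>. A minor \<open>J\<close> with \<open>d = card (S - J)\<close> is reached by deleting
any one of \<open>d\<close> indices first, so its coefficient obeys \<open>k(q + 1, d) = k(q, d) - d k(q, d - 1)\<close>; this is
Pascal's rule for \<open>(-1)\<^sup>d (q)\<^sub>d\<close>.\<close>

lemma capelli_det_neg:
  fixes z :: "nat \<Rightarrow> nat \<Rightarrow> 'a::ring_1"
  assumes "finite S"
  shows "capelli_det z (- int q) S = (\<Sum>J \<in> Pow S.
    of_int ((- 1) ^ (card S - card J) * falling_factorial (int q) (card S - card J)) * capelli_det z 0 J)"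
  using assms
proof (induction q arbitrary: S)
  case 0
  have zero: "falling_factorial (int 0) d = (if d = 0 then 1 else 0)" for d
    by (cases d) (auto simp: falling_factorial_def prod.lessThan_Suc_shift simp del: prod.lessThan_Suc)
  have "(\<Sum>J \<in> Pow S. of_int ((- 1) ^ (card S - card J) * falling_factorial (int 0) (card S - card J))
      * capelli_det z 0 J) = (\<Sum>J \<in> {S}. capelli_det z 0 J)"
  proof (rule sum.mono_neutral_cong_right)
    show "\<forall>J\<in>Pow S - {S}. of_int ((- 1) ^ (card S - card J) * falling_factorial (int 0) (card S - card J))
      * capelli_det z 0 J = 0"
    proof
      fix J assume "J \<in> Pow S - {S}"
      then have "card J < card S"
        using 0 by (intro psubset_card_mono) auto
      then show "of_int ((- 1) ^ (card S - card J) * falling_factorial (int 0) (card S - card J))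
        * capelli_det z 0 J = 0"
        unfolding zero by simp
    qed
  qed (use 0 in \<open>auto simp: zero[simplified]\<close>)
  then show ?case by simp
next
  case (Suc q)
  define k where "k q d = (- 1) ^ d * falling_factorial (int q) d" for q d
  have pascal: "k (Suc q) d = k q d - int d * k q (d - 1)" for d
  proof (cases d)
    case 0
    then show ?thesis by (simp add: k_def falling_factorial_def)
  next
    case (Suc d')
    show ?thesis
      unfolding Suc k_def falling_factorial_Suc by (simp add: algebra_simps)
  qed
  have fin: "finite (Pow S)" using Suc.prems by simp
  have "capelli_det z (- int (Suc q)) S
    = capelli_det z (- int q) S - (\<Sum>c\<in>S. capelli_det z (- int q) (S - {c}))"
    using capelli_det_diff[OF Suc.prems, of z "- int (Suc q)"] by (simp add: algebra_simps)
  also have "(\<Sum>c\<in>S. capelli_det z (- int q) (S - {c}))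
    = (\<Sum>c\<in>S. \<Sum>J | J \<in> Pow S \<and> c \<notin> J. of_int (k q (card S - card J - 1)) * capelli_det z 0 J)"
  proof (intro sum.cong refl)
    fix c assume c: "c \<in> S"
    have "capelli_det z (- int q) (S - {c})
      = (\<Sum>J \<in> Pow (S - {c}). of_int (k q (card (S - {c}) - card J)) * capelli_det z 0 J)"
      unfolding k_def by (rule Suc.IH) (use Suc.prems in simp)
    also have "\<dots> = (\<Sum>J | J \<in> Pow S \<and> c \<notin> J. of_int (k q (card S - card J - 1)) * capelli_det z 0 J)"
      using c Suc.prems by (intro sum.cong) (auto simp: card_Diff_singleton)
    finally show "capelli_det z (- int q) (S - {c})
      = (\<Sum>J | J \<in> Pow S \<and> c \<notin> J. of_int (k q (card S - card J - 1)) * capelli_det z 0 J)" .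
  qed
  also have "\<dots> = (\<Sum>J\<in>Pow S. \<Sum>c | c \<in> S \<and> c \<notin> J. of_int (k q (card S - card J - 1)) * capelli_det z 0 J)"
    by (rule sum.swap_restrict[OF Suc.prems fin, of _ "\<lambda>c J. c \<notin> J"])
  also have "\<dots> = (\<Sum>J\<in>Pow S. of_int (int (card S - card J) * k q (card S - card J - 1)) * capelli_det z 0 J)"
  proof (intro sum.cong refl)
    fix J assume J: "J \<in> Pow S"
    have "{c. c \<in> S \<and> c \<notin> J} = S - J" by auto
    moreover have "card (S - J) = card S - card J"
      using J Suc.prems by (intro card_Diff_subset) (auto intro: finite_subset)
    ultimately show "(\<Sum>c | c \<in> S \<and> c \<notin> J. of_int (k q (card S - card J - 1)) * capelli_det z 0 J)
      = of_int (int (card S - card J) * k q (card S - card J - 1)) * capelli_det z 0 J"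
      by (simp add: mult.assoc)
  qed
  also have "capelli_det z (- int q) S = (\<Sum>J\<in>Pow S. of_int (k q (card S - card J)) * capelli_det z 0 J)"
    unfolding k_def by (rule Suc.IH[OF Suc.prems])
  also have "(\<Sum>J\<in>Pow S. of_int (k q (card S - card J)) * capelli_det z 0 J)
     - (\<Sum>J\<in>Pow S. of_int (int (card S - card J) * k q (card S - card J - 1)) * capelli_det z 0 J)
     = (\<Sum>J\<in>Pow S. of_int (k (Suc q) (card S - card J)) * capelli_det z 0 J)"
    unfolding pascal by (simp add: sum_subtractf left_diff_distrib)
  finally show ?case
    by (simp only: k_def)
qed

section \<open>Irregular words\<close>

lemma length_filter_take_conv_card:
  "i \<le> length xs \<Longrightarrow> card {j. j < i \<and> P (xs ! j)} = length (filter P (take i xs))"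
  by (auto simp: length_filter_conv_card intro!: arg_cong[where f = card])

text \<open>At the first place where the count of annihilated \<open>\<gamma>\<close> exceeds the count of created \<open>\<gamma>\<close>, the current
factor must itself annihilate \<open>\<gamma>\<close>. Splitting the word there replaces the counts over index sets by
counts over the tail.\<close>

lemma irregular_iff:
  "irregular m xs \<longleftrightarrow> (\<exists>us a g vs. xs = us @ (a, Virt g) # vs \<and> g \<in> {1..m} \<and>
     length (filter (\<lambda>p. fst p = Virt g) vs) \<le> length (filter (\<lambda>p. snd p = Virt g) vs))"
proof
  let ?v = "rev xs"
  let ?B = "\<lambda>\<gamma> i. card {j. j < i \<and> snd (?v ! j) = \<gamma>}"
  let ?A = "\<lambda>\<gamma> i. card {j. j < i \<and> fst (?v ! j) = \<gamma>}"
  assume "irregular m xs"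
  then obtain i0 g where "i0 < length xs" "g \<in> {1..m}" "?B (Virt g) (Suc i0) > ?A (Virt g) i0"
    by (auto simp: irregular_def Let_def less_Suc_eq_le)
  then have ex: "\<exists>i. i < length xs \<and> ?B (Virt g) (Suc i) > ?A (Virt g) i" by blast
  define i where "i = (LEAST i. i < length xs \<and> ?B (Virt g) (Suc i) > ?A (Virt g) i)"
  have i: "i < length xs" "?B (Virt g) (Suc i) > ?A (Virt g) i"
    using LeastI_ex[OF ex] unfolding i_def by blast+
  have least: "\<not> (?B (Virt g) (Suc k) > ?A (Virt g) k)" if "k < i" for k
    using not_less_Least[of k "\<lambda>i. i < length xs \<and> ?B (Virt g) (Suc i) > ?A (Virt g) i"] that i(1)
    unfolding i_def by linarith
  have snd_i: "snd (?v ! i) = Virt g"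
  proof (rule ccontr)
    assume ne: "snd (?v ! i) \<noteq> Virt g"
    then have "{j. j < Suc i \<and> snd (?v ! j) = Virt g} = {j. j < i \<and> snd (?v ! j) = Virt g}"
      using less_Suc_eq by auto
    with i(2) have gt: "?B (Virt g) i > ?A (Virt g) i" by simp
    then obtain k where k: "i = Suc k"
      by (cases i) auto
    have "?A (Virt g) k \<le> ?A (Virt g) i"
      unfolding k by (intro card_mono) auto
    with gt least[of k] k show False by simp
  qed
  define vs where "vs = rev (take i ?v)"
  have xs: "xs = rev (drop (Suc i) ?v) @ (fst (?v ! i), Virt g) # vs"
  proof -
    have "?v = take i ?v @ ?v ! i # drop (Suc i) ?v"
      using i(1) by (intro id_take_nth_drop) simp
    then have "xs = rev (take i ?v @ ?v ! i # drop (Suc i) ?v)"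
      using rev_rev_ident by metis
    then show ?thesis
      by (metis snd_i vs_def rev.simps(2) rev_append append.assoc append_Cons append_Nil prod.collapse)
  qed
  have "{j. j < Suc i \<and> snd (?v ! j) = Virt g} = insert i {j. j < i \<and> snd (?v ! j) = Virt g}"
    using snd_i less_Suc_eq by auto
  then have "?B (Virt g) (Suc i) = Suc (?B (Virt g) i)"
    by simp
  with i(2) have "?A (Virt g) i \<le> ?B (Virt g) i" by simp
  then have "length (filter (\<lambda>p. fst p = Virt g) vs) \<le> length (filter (\<lambda>p. snd p = Virt g) vs)"
    using i(1) length_filter_take_conv_card[of i ?v "\<lambda>p. fst p = Virt g"]
      length_filter_take_conv_card[of i ?v "\<lambda>p. snd p = Virt g"]
    by (simp add: vs_def rev_filter[symmetric])
  with xs \<open>g \<in> {1..m}\<close> show "\<exists>us a g vs. xs = us @ (a, Virt g) # vs \<and> g \<in> {1..m} \<and>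
     length (filter (\<lambda>p. fst p = Virt g) vs) \<le> length (filter (\<lambda>p. snd p = Virt g) vs)"
    by blast
next
  assume "\<exists>us a g vs. xs = us @ (a, Virt g) # vs \<and> g \<in> {1..m} \<and>
     length (filter (\<lambda>p. fst p = Virt g) vs) \<le> length (filter (\<lambda>p. snd p = Virt g) vs)"
  then obtain us a g vs where xs: "xs = us @ (a, Virt g) # vs" and g: "g \<in> {1..m}" and
     le: "length (filter (\<lambda>p. fst p = Virt g) vs) \<le> length (filter (\<lambda>p. snd p = Virt g) vs)"
    by blast
  let ?v = "rev xs" and ?i = "length vs"
  have v: "?v = rev vs @ (a, Virt g) # rev us"
    by (simp add: xs)
  have "card {j. j < ?i \<and> fst (?v ! j) = Virt g} = length (filter (\<lambda>p. fst p = Virt g) (take ?i ?v))"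
    by (rule length_filter_take_conv_card) (simp add: v)
  moreover have "card {j. j < Suc ?i \<and> snd (?v ! j) = Virt g} = length (filter (\<lambda>p. snd p = Virt g) (take (Suc ?i) ?v))"
    by (rule length_filter_take_conv_card) (simp add: v)
  ultimately have "card {j. j < ?i \<and> fst (?v ! j) = Virt g} < card {j. j \<le> ?i \<and> snd (?v ! j) = Virt g}"
    using le by (simp add: v rev_filter[symmetric] less_Suc_eq_le)
  moreover have "?i < length ?v" by (simp add: v)
  ultimately show "irregular m xs"
    using g unfolding irregular_def Let_def by blast
qed

section \<open>Products of anticommuting elements\<close>

lemma neg_one_power_left_commute: "a * ((- 1) ^ k * b) = (- 1 :: 'a::ring_1) ^ k * (a * b)"
  by (cases "even k") auto

lemma of_int_left_commute: "a * (of_int k * b) = of_int k * (a * b)" for a b :: "'a::ring_1"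
  by (metis mult.assoc mult_of_int_commute)

lemma prod_list_anticommute:
  fixes us vs :: "'a::ring_1 list"
  assumes "\<And>u v. u \<in> set us \<Longrightarrow> v \<in> set vs \<Longrightarrow> u * v = - (v * u)"
  shows "prod_list us * prod_list vs = (- 1) ^ (length us * length vs) * (prod_list vs * prod_list us)"
  using assms
proof (induction us)
  case (Cons u us)
  have 1: "u * prod_list vs = (- 1) ^ length vs * (prod_list vs * u)"
    using Cons.prems
  proof (induction vs)
    case (Cons v vs)
    have "u * prod_list (v # vs) = - (v * (u * prod_list vs))"
      using Cons.prems[of u v] by (simp add: mult.assoc[symmetric])
    also have "u * prod_list vs = (- 1) ^ length vs * (prod_list vs * u)"
      using Cons.prems by (intro Cons.IH) auto
    finally show ?case
      by (cases "even (length vs)") (auto simp: mult.assoc)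
  qed simp
  have "prod_list (u # us) * prod_list vs = u * (prod_list us * prod_list vs)"
    by (simp add: mult.assoc)
  also have "prod_list us * prod_list vs = (- 1) ^ (length us * length vs) * (prod_list vs * prod_list us)"
    using Cons.prems by (intro Cons.IH) auto
  also have "u * ((- 1) ^ (length us * length vs) * (prod_list vs * prod_list us))
    = (- 1) ^ (length us * length vs) * ((u * prod_list vs) * prod_list us)"
    by (simp only: neg_one_power_left_commute mult.assoc)
  finally show ?case
    by (simp only: 1 mult.assoc[symmetric] power_add[symmetric] prod_list.Cons length_Cons mult_Suc
        add_0_right add_Suc_right add.commute One_nat_def)
qed simp

text \<open>A repeated factor can be brought next to its copy, and \<open>g\<^sub>y\<^sup>2 = -g\<^sub>y\<^sup>2\<close> vanishes in the absence of
2-torsion.\<close>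

lemma prod_list_anticommute_not_distinct:
  fixes g :: "'b \<Rightarrow> 'a::ring_1"
  assumes torsion_free: "\<And>a :: 'a. a + a = 0 \<Longrightarrow> a = 0"
    and anti: "\<And>k l. k \<in> set ks \<Longrightarrow> l \<in> set ks \<Longrightarrow> g k * g l = - (g l * g k)"
    and "\<not> distinct ks"
  shows "prod_list (map g ks) = 0"
proof -
  obtain xs ys zs y where ks: "ks = xs @ [y] @ ys @ [y] @ zs"
    using not_distinct_decomp[OF \<open>\<not> distinct ks\<close>] by blast
  have "y \<in> set ks"
    using ks by simp
  then have "g y * g y = - (g y * g y)"
    using anti by blast
  then have "g y * g y + g y * g y = 0"
    unfolding eq_neg_iff_add_eq_0 .
  then have sq: "g y * g y = 0"
    by (rule torsion_free)
  have "prod_list [g y] * prod_list (map g ys)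
      = (- 1) ^ (length [g y] * length (map g ys)) * (prod_list (map g ys) * prod_list [g y])"
  proof (rule prod_list_anticommute)
    fix u v assume "u \<in> set [g y]" "v \<in> set (map g ys)"
    then obtain k where "u = g y" "v = g k" "k \<in> set ks" "y \<in> set ks"
      by (auto simp: ks)
    then show "u * v = - (v * u)"
      using anti by blast
  qed
  then have "g y * prod_list (map g ys) = (- 1) ^ length ys * (prod_list (map g ys) * g y)"
    by simp
  then have "g y * prod_list (map g ys) * g y = (- 1) ^ length ys * (prod_list (map g ys) * (g y * g y))"
    by (simp only: mult.assoc)
  then have "g y * prod_list (map g ys) * g y = 0"
    unfolding sq by simp
  moreover have "prod_list (map g ks)
      = prod_list (map g xs) * (g y * prod_list (map g ys) * g y) * prod_list (map g zs)"
    by (simp add: ks mult.assoc)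
  ultimately show ?thesis by simp
qed

text \<open>\<open>Z\<close> acts on the \<open>g\<close>s as the matrix unit \<open>e\<^sub>p\<^sub>q\<close>, and so it acts on their top exterior product by the
trace of that matrix unit: replacing the factor \<open>q\<close> by a different factor \<open>p\<close> creates a repetition.\<close>

lemma commute_top_product:
  fixes g :: "'b \<Rightarrow> 'a::ring_1"
  assumes torsion_free: "\<And>a :: 'a. a + a = 0 \<Longrightarrow> a = 0"
    and anti: "\<And>k l. k \<in> set ks \<Longrightarrow> l \<in> set ks \<Longrightarrow> g k * g l = - (g l * g k)"
    and Z: "\<And>k. k \<in> set ks \<Longrightarrow> Z * g k = g k * Z + (if k = q then g p else 0)"
    and ks: "distinct ks" "p \<in> set ks" "q \<in> set ks"
  shows "Z * prod_list (map g ks) = prod_list (map g ks) * Z + (if p = q then prod_list (map g ks) else 0)"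
proof -
  have "Z * prod_list (map g ls) = prod_list (map g ls) * Z
    + (if q \<in> set ls then prod_list (map g (map (\<lambda>k. if k = q then p else k) ls)) else 0)"
    if "distinct ls" "set ls \<subseteq> set ks" for ls
    using that
  proof (induction ls)
    case (Cons l ls)
    have "Z * prod_list (map g (l # ls)) = g l * (Z * prod_list (map g ls))
        + (if l = q then g p else 0) * prod_list (map g ls)"
      using Z[of l] Cons.prems by (simp add: mult.assoc[symmetric] distrib_right)
    moreover have "map (g \<circ> (\<lambda>k. if k = q then p else k)) ls = map g ls" if "q \<notin> set ls"
      using that by (intro map_cong refl) auto
    ultimately show ?case
      using Cons by (auto simp: distrib_left mult.assoc simp del: map_eq_conv)
  qed simp
  from this[of ks] ks(1,3) have *: "Z * prod_list (map g ks) = prod_list (map g ks) * Z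
    + prod_list (map g (map (\<lambda>k. if k = q then p else k) ks))"
    by simp
  show ?thesis
  proof (cases "p = q")
    case True
    then have "map (\<lambda>k. if k = q then p else k) ks = ks"
      by (simp add: map_idI)
    with * True show ?thesis by simp
  next
    case False
    have "\<not> distinct (map (\<lambda>k. if k = q then p else k) ks)"
      using False ks(2,3) by (auto simp: distinct_map inj_on_def)
    moreover have "set (map (\<lambda>k. if k = q then p else k) ks) \<subseteq> set ks"
      using ks(2) by auto
    ultimately have "prod_list (map g (map (\<lambda>k. if k = q then p else k) ks)) = 0"
      using anti by (intro prod_list_anticommute_not_distinct[OF torsion_free]) blast+
    with * False show ?thesis by simp
  qed
qed

section \<open>Creation and annihilation of virtual symbols\<close>

text \<open>A representation of \<open>gl(m|n)\<close> in a ring. Torsion-freeness replaces the division by 2 that makes odd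
elements square to zero.\<close>

locale gl_super =
  fixes m n :: nat and E :: "symbol \<Rightarrow> symbol \<Rightarrow> 'a::ring_1"
  assumes super_commute: "\<lbrakk>a \<in> symbols m n; b \<in> symbols m n; c \<in> symbols m n; d \<in> symbols m n\<rbrakk> \<Longrightarrow>
      E a b * E c d = (- 1) ^ ((parity a + parity b) * (parity c + parity d)) * (E c d * E a b)
        + (if b = c then E a d else 0)
        - (- 1) ^ ((parity a + parity b) * (parity c + parity d)) * (if a = d then E c b else 0)"
    and torsion_free: "(w :: 'a) + w = 0 \<Longrightarrow> w = 0"
begin

abbreviation annih :: "nat \<Rightarrow> nat \<Rightarrow> 'a"
  where "annih \<alpha> i \<equiv> E (Proper i) (Virt \<alpha>)"

abbreviation creat :: "nat \<Rightarrow> nat \<Rightarrow> 'a"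
  where "creat \<alpha> i \<equiv> E (Virt \<alpha>) (Proper i)"

abbreviation polar :: "nat \<Rightarrow> nat \<Rightarrow> 'a"
  where "polar i j \<equiv> E (Proper i) (Proper j)"

abbreviation "vnum \<alpha> \<equiv> E (Virt \<alpha>) (Virt \<alpha>)"

definition word :: "(symbol \<times> symbol) list \<Rightarrow> 'a"
  where "word ws = prod_list (map (\<lambda>(a, b). E a b) ws)"

lemma word_simps [simp]:
  "word [] = 1" "word (p # ws) = E (fst p) (snd p) * word ws" "word (vs @ ws) = word vs * word ws"
  by (simp_all add: word_def split_beta)

lemma symbols_simps [simp]:
  "Virt \<alpha> \<in> symbols m n \<longleftrightarrow> \<alpha> \<in> {1..m}" "Proper i \<in> symbols m n \<longleftrightarrow> i \<in> {1..n}"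
  by (auto simp: symbols_def)

lemma basic_relations:
  assumes "\<alpha> \<in> {1..m}" "\<beta> \<in> {1..m}" "i \<in> {1..n}" "j \<in> {1..n}" "k \<in> {1..n}"
  shows "annih \<alpha> i * annih \<beta> j = - (annih \<beta> j * annih \<alpha> i)"
    and "creat \<alpha> i * creat \<beta> j = - (creat \<beta> j * creat \<alpha> i)"
    and "annih \<alpha> i * creat \<alpha> j = - (creat \<alpha> j * annih \<alpha> i) + polar i j + (if i = j then vnum \<alpha> else 0)"
    and "annih \<alpha> k * polar i j = polar i j * annih \<alpha> k - (if k = j then annih \<alpha> i else 0)"
    and "annih \<alpha> k * vnum \<alpha> = vnum \<alpha> * annih \<alpha> k + annih \<alpha> k"
    and "polar i j * creat \<alpha> k = creat \<alpha> k * polar i j - (if k = i then creat \<alpha> j else 0)"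
  using assms by (subst super_commute; auto)+

abbreviation annihs :: "nat \<Rightarrow> nat list \<Rightarrow> 'a"
  where "annihs \<alpha> rs \<equiv> prod_list (map (annih \<alpha>) rs)"

abbreviation creats :: "nat \<Rightarrow> nat list \<Rightarrow> 'a"
  where "creats \<alpha> cs \<equiv> prod_list (map (creat \<alpha>) cs)"

lemma annih_annihs:
  assumes "\<alpha> \<in> {1..m}" "r \<in> {1..n}" "set rs \<subseteq> {1..n}"
  shows "annih \<alpha> r * annihs \<alpha> rs = (- 1) ^ length rs * (annihs \<alpha> rs * annih \<alpha> r)"
proof -
  have "annih \<alpha> r * v = - (v * annih \<alpha> r)" if "v \<in> set (map (annih \<alpha>) rs)" for v
    using that assms(3) basic_relations(1)[OF assms(1,1,2) _ assms(2)] by auto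
  then show ?thesis
    using prod_list_anticommute[of "[annih \<alpha> r]" "map (annih \<alpha>) rs"] by simp
qed

lemma annihs_Cons_remove:
  assumes "\<alpha> \<in> {1..m}" "set rs \<subseteq> {1..n}" "i < length rs"
  shows "annih \<alpha> (rs ! i) * annihs \<alpha> (take i rs @ drop (Suc i) rs) = (- 1) ^ i * annihs \<alpha> rs"
proof -
  have rs: "rs = take i rs @ rs ! i # drop (Suc i) rs"
    using assms(3) by (rule id_take_nth_drop)
  have "annih \<alpha> (rs ! i) * annihs \<alpha> (take i rs) = (- 1) ^ length (take i rs) * (annihs \<alpha> (take i rs) * annih \<alpha> (rs ! i))"
    using assms nth_mem[of i rs] set_take_subset[of i rs] by (intro annih_annihs) blast+
  then have "annih \<alpha> (rs ! i) * annihs \<alpha> (take i rs @ drop (Suc i) rs)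
      = (- 1) ^ i * annihs \<alpha> (take i rs @ rs ! i # drop (Suc i) rs)"
    using assms(3) by (simp add: mult.assoc[symmetric])
  then show ?thesis
    using rs by metis
qed

text \<open>Moving \<open>e\<^sub>\<alpha>\<^sub>c\<close> to the left through the annihilators produces at each row \<open>r\<close> the bracket
\<open>e\<^sub>r\<^sub>c + \<delta>\<^sub>r\<^sub>c e\<^sub>\<alpha>\<^sub>\<alpha>\<close>. Carrying the brackets to the left end as well costs one unit on the diagonal for
every annihilator: those to the left of the bracket are passed by \<open>e\<^sub>\<alpha>\<^sub>\<alpha>\<close>, while those to its right
are recovered from the rows \<open>r' \<noteq> r\<close>, where moving \<open>e\<^sub>r\<^sub>'\<^sub>c\<close> past \<open>e\<^sub>c\<^sub>\<alpha>\<close> leaves \<open>e\<^sub>r\<^sub>'\<^sub>\<alpha>\<close>. Together this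
is the entry \<open>k - 1\<close> of the first column of a Capelli determinant of size \<open>k\<close>.\<close>

lemma annihs_creat:
  assumes "\<alpha> \<in> {1..m}" "set rs \<subseteq> {1..n}" "c \<in> {1..n}"
  shows "annihs \<alpha> rs * creat \<alpha> c = (- 1) ^ length rs * (creat \<alpha> c * annihs \<alpha> rs)
    + (\<Sum>i<length rs. (- 1) ^ (length rs - 1 - i) *
        ((polar (rs ! i) c + (if rs ! i = c then vnum \<alpha> + of_nat (length rs - 1) else 0))
          * annihs \<alpha> (take i rs @ drop (Suc i) rs)))"
  using assms(2)
proof (induction rs)
  case Nil
  then show ?case by simp
next
  case (Cons r rs)
  let ?k = "length rs"
  let ?D = "annihs \<alpha> rs"
  let ?Di = "\<lambda>i. annihs \<alpha> (take i rs @ drop (Suc i) rs)"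
  let ?f = "\<lambda>t i. polar (rs ! i) c + (if rs ! i = c then vnum \<alpha> + of_nat t else 0)"
  have r: "r \<in> {1..n}" and rs: "set rs \<subseteq> {1..n}"
    using Cons.prems by auto
  have IH: "?D * creat \<alpha> c = (- 1) ^ ?k * (creat \<alpha> c * ?D) + (\<Sum>i<?k. (- 1) ^ (?k - 1 - i) * (?f (?k - 1) i * ?Di i))"
    using Cons.IH rs by blast
  \<comment> \<open>The old diagonal terms gain one unit from passing the new annihilator; the row \<open>c\<close> collects the rest.\<close>
  have step: "annih \<alpha> r * (?f (?k - 1) i * ?Di i)
      = ?f ?k i * (annih \<alpha> r * ?Di i) - (if r = c then (- 1) ^ i * ?D else 0)" if i: "i < ?k" for i
  proof -
    have ri: "rs ! i \<in> {1..n}"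
      using rs i nth_mem by blast
    have k: "of_nat ?k = of_nat (?k - 1) + (1::'a)"
      using i by (cases rs) auto
    have "annih \<alpha> r * ?f (?k - 1) i = ?f ?k i * annih \<alpha> r - (if r = c then annih \<alpha> (rs ! i) else 0)"
      unfolding k using basic_relations(4)[OF assms(1,1) ri assms(3) r] basic_relations(5)[OF assms(1,1) ri ri r]
      by (auto simp: algebra_simps mult_of_nat_commute)
    then have "annih \<alpha> r * (?f (?k - 1) i * ?Di i)
      = ?f ?k i * (annih \<alpha> r * ?Di i) - (if r = c then annih \<alpha> (rs ! i) * ?Di i else 0)"
      by (simp add: mult.assoc[symmetric] left_diff_distrib)
    then show ?thesis
      using annihs_Cons_remove[OF assms(1) rs i] by simp
  qed
  have sgn: "(- 1) ^ (?k - 1 - i) * ((- 1) ^ i * ?D) = - ((- 1) ^ ?k * ?D)" if "i < ?k" for i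
  proof -
    have "?k = Suc ((?k - 1 - i) + i)" using that by simp
    then have "(- 1 :: 'a) ^ ?k = - ((- 1) ^ (?k - 1 - i) * (- 1) ^ i)"
      by (metis mult_minus_left power_Suc power_add mult_1)
    then show ?thesis by (simp add: mult.assoc)
  qed
  have "annihs \<alpha> (r # rs) * creat \<alpha> c = annih \<alpha> r * (?D * creat \<alpha> c)"
    by (simp add: mult.assoc)
  also have "\<dots> = (- 1) ^ ?k * ((annih \<alpha> r * creat \<alpha> c) * ?D)
      + (\<Sum>i<?k. (- 1) ^ (?k - 1 - i) * (annih \<alpha> r * (?f (?k - 1) i * ?Di i)))"
    unfolding IH distrib_left sum_distrib_left
    by (simp only: mult.assoc neg_one_power_left_commute)
  also have "(\<Sum>i<?k. (- 1) ^ (?k - 1 - i) * (annih \<alpha> r * (?f (?k - 1) i * ?Di i)))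
      = (\<Sum>i<?k. (- 1) ^ (?k - 1 - i) * (?f ?k i * (annih \<alpha> r * ?Di i)) + (if r = c then (- 1) ^ ?k * ?D else 0))"
  proof (intro sum.cong refl)
    fix i assume "i \<in> {..<?k}"
    then have i: "i < ?k" by simp
    show "(- 1) ^ (?k - 1 - i) * (annih \<alpha> r * (?f (?k - 1) i * ?Di i))
      = (- 1) ^ (?k - 1 - i) * (?f ?k i * (annih \<alpha> r * ?Di i)) + (if r = c then (- 1) ^ ?k * ?D else 0)"
      unfolding step[OF i] right_diff_distrib using sgn[OF i] by (cases "r = c") simp_all
  qed
  also have "\<dots> = (\<Sum>i<?k. (- 1) ^ (?k - 1 - i) * (?f ?k i * (annih \<alpha> r * ?Di i)))
      + (if r = c then (- 1) ^ ?k * (of_nat ?k * ?D) else 0)"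
    by (simp add: sum.distrib neg_one_power_left_commute)
  also have "annih \<alpha> r * creat \<alpha> c = - (creat \<alpha> c * annih \<alpha> r) + polar r c + (if r = c then vnum \<alpha> else 0)"
    by (rule basic_relations(3)[OF assms(1,1) r assms(3) r])
  finally have "annihs \<alpha> (r # rs) * creat \<alpha> c = - ((- 1) ^ ?k * (creat \<alpha> c * (annih \<alpha> r * ?D)))
      + ((- 1) ^ ?k * ((polar r c + (if r = c then vnum \<alpha> + of_nat ?k else 0)) * ?D)
      + (\<Sum>i<?k. (- 1) ^ (?k - 1 - i) * (?f ?k i * (annih \<alpha> r * ?Di i))))"
    by (auto simp: algebra_simps)
  then show ?case
    by (simp add: sum.lessThan_Suc_shift mult.assoc cong: if_cong del: sum.lessThan_Suc)
qed

lemma annihs_move: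
  assumes "\<alpha> \<in> {1..m}" "set vs \<subseteq> {1..n}" "r \<in> {1..n}"
  shows "annihs \<alpha> (us @ vs @ [r]) = (- 1) ^ length vs * annihs \<alpha> (us @ r # vs)"
proof -
  have "annihs \<alpha> vs * annih \<alpha> r = (- 1) ^ length vs * (annih \<alpha> r * annihs \<alpha> vs)"
    using annih_annihs[OF assms(1,3,2)] by (cases "even (length vs)") auto
  then show ?thesis
    by (simp only: map_append list.map prod_list.append prod_list.Cons prod_list.Nil mult_1_right
        neg_one_power_left_commute)
qed

text \<open>Deleting the row in position \<open>j\<close> agrees up to sign with overwriting it by the first row. The second form
is the one that matches the enumeration of the permutations of \<open>{c..n}\<close> as
\<open>transpose c j \<circ> q\<close> with \<open>q\<close> fixing \<open>c\<close>.\<close>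

lemma annihs_remove_transpose:
  assumes "\<alpha> \<in> {1..m}" "\<rho> ` {c..n} \<subseteq> {1..n}" "c \<le> j" "j \<le> n"
    and rs: "rs = rev (map \<rho> [c..<Suc n])"
  shows "(- 1) ^ (n - c - (n - j)) * annihs \<alpha> (take (n - j) rs @ drop (Suc (n - j)) rs)
    = of_int (sign (transpose c j)) * annihs \<alpha> (rev (map (\<rho> \<circ> transpose c j) [Suc c..<Suc n]))"
proof -
  have cut: "[c..<Suc n] = [c..<j] @ j # [Suc j..<Suc n]"
    using assms(3,4) by (metis le_Suc_eq le_add_diff_inverse less_Suc_eq_le upt_add_eq_append upt_conv_Cons)
  have rs': "rs = rev (map \<rho> [Suc j..<Suc n]) @ \<rho> j # rev (map \<rho> [c..<j])"
    unfolding rs cut by simp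
  have "take (n - j) rs = rev (map \<rho> [Suc j..<Suc n])" "drop (Suc (n - j)) rs = rev (map \<rho> [c..<j])"
    unfolding rs' using assms(4) by (simp_all add: Suc_diff_le del: upt_Suc)
  then have removed: "take (n - j) rs @ drop (Suc (n - j)) rs
      = rev (map \<rho> [Suc j..<Suc n]) @ rev (map \<rho> [c..<j])"
    by simp
  show ?thesis
  proof (cases "j = c")
    case True
    with removed assms(4) show ?thesis by simp
  next
    case False
    with assms(3) have less: "c < j" by simp
    have "map (\<rho> \<circ> transpose c j) [Suc c..<j] = map \<rho> [Suc c..<j]"
      "map (\<rho> \<circ> transpose c j) [Suc j..<Suc n] = map \<rho> [Suc j..<Suc n]"
      using less by (auto simp: transpose_def)
    moreover have "[Suc c..<Suc n] = [Suc c..<j] @ j # [Suc j..<Suc n]"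
      using less assms(4) by (metis Suc_leI le_Suc_eq le_add_diff_inverse less_Suc_eq_le upt_add_eq_append upt_conv_Cons)
    ultimately have "rev (map (\<rho> \<circ> transpose c j) [Suc c..<Suc n])
        = rev (map \<rho> [Suc j..<Suc n]) @ \<rho> c # rev (map \<rho> [Suc c..<j])"
      by simp
    moreover have "annihs \<alpha> (rev (map \<rho> [Suc j..<Suc n]) @ rev (map \<rho> [Suc c..<j]) @ [\<rho> c])
        = (- 1) ^ length (rev (map \<rho> [Suc c..<j]))
          * annihs \<alpha> (rev (map \<rho> [Suc j..<Suc n]) @ \<rho> c # rev (map \<rho> [Suc c..<j]))"
      using assms less by (intro annihs_move) (auto simp: image_subset_iff)
    moreover have "[c..<j] = c # [Suc c..<j]"
      using less by (rule upt_conv_Cons)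
    ultimately have "annihs \<alpha> (take (n - j) rs @ drop (Suc (n - j)) rs)
        = (- 1) ^ (j - Suc c) * annihs \<alpha> (rev (map (\<rho> \<circ> transpose c j) [Suc c..<Suc n]))"
      unfolding removed by simp
    moreover have "n - c - (n - j) = Suc (j - Suc c)"
      using less assms(4) by simp
    ultimately show ?thesis
      using less by (simp add: sign_swap_id mult.assoc[symmetric] power_add[symmetric])
  qed
qed

text \<open>The products over all of \<open>{1..n}\<close> are top exterior products, of weight \<open>1\<close> and \<open>-1\<close> under the trace.\<close>

lemma polar_top_products:
  assumes "\<alpha> \<in> {1..m}" "i \<in> {1..n}" "j \<in> {1..n}" "distinct ks" "set ks = {1..n}"
  shows "polar i j * annihs \<alpha> ks = annihs \<alpha> ks * (polar i j + of_int (if i = j then 1 else 0))"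
    and "polar i j * creats \<alpha> ks = creats \<alpha> ks * (polar i j - of_int (if i = j then 1 else 0))"
proof -
  have anti: "annih \<alpha> k * annih \<alpha> l = - (annih \<alpha> l * annih \<alpha> k)"
    "creat \<alpha> k * creat \<alpha> l = - (creat \<alpha> l * creat \<alpha> k)" if "k \<in> set ks" "l \<in> set ks" for k l
    using basic_relations(1,2)[OF assms(1,1) _ _ assms(2), of k l] that assms(5) by blast+
  have "polar i j * annih \<alpha> k = annih \<alpha> k * polar i j + (if k = j then annih \<alpha> i else 0)"
    if "k \<in> set ks" for k
    using basic_relations(4)[OF assms(1,1,2,3)] that assms(5) by simp
  then have "polar i j * annihs \<alpha> ks = annihs \<alpha> ks * polar i j + (if i = j then annihs \<alpha> ks else 0)"
    using assms(2-5) anti(1) by (intro commute_top_product[OF torsion_free]) blast+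
  then show "polar i j * annihs \<alpha> ks = annihs \<alpha> ks * (polar i j + of_int (if i = j then 1 else 0))"
    by (simp add: distrib_left)
  have "(- polar i j) * creat \<alpha> k = creat \<alpha> k * (- polar i j) + (if k = i then creat \<alpha> j else 0)"
    if "k \<in> set ks" for k
    using basic_relations(6)[OF assms(1,1,2,3)] that assms(5) by simp
  then have "(- polar i j) * creats \<alpha> ks = creats \<alpha> ks * (- polar i j) + (if j = i then creats \<alpha> ks else 0)"
    using assms(2-5) anti(2) by (intro commute_top_product[OF torsion_free]) blast+
  then have "polar i j * creats \<alpha> ks = creats \<alpha> ks * polar i j - (if j = i then creats \<alpha> ks else 0)"
    by (simp add: algebra_simps split: if_splits)
  then show "polar i j * creats \<alpha> ks = creats \<alpha> ks * (polar i j - of_int (if i = j then 1 else 0))"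
    by (auto simp: right_diff_distrib)
qed

definition creat_rows :: "nat \<Rightarrow> (symbol \<times> symbol) list"
  where "creat_rows q = concat (map (\<lambda>i. map (\<lambda>t. (Virt (i + 1), Proper t)) [1..<Suc n]) [0..<q])"

definition annih_rows :: "nat \<Rightarrow> (symbol \<times> symbol) list"
  where "annih_rows q = concat (map (\<lambda>i. map (\<lambda>t. (Proper t, Virt (i + 1))) (rev [1..<Suc n])) [0..<q])"

lemma word_map:
  "word (map (\<lambda>t. (Virt \<alpha>, Proper t)) ts) = creats \<alpha> ts"
  "word (map (\<lambda>t. (Proper t, Virt \<alpha>)) ts) = annihs \<alpha> ts"
  by (simp_all add: word_def comp_def)

lemma rows_Suc:
  "creat_rows (Suc q) = creat_rows q @ map (\<lambda>t. (Virt (Suc q), Proper t)) [1..<Suc n]"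
  "annih_rows (Suc q) = annih_rows q @ map (\<lambda>t. (Proper t, Virt (Suc q))) (rev [1..<Suc n])"
  by (simp_all add: creat_rows_def annih_rows_def)

text \<open>Each of the \<open>q\<close> rows contributes its trace, so \<open>e\<^sub>i\<^sub>j\<close> passes \<open>q\<close> rows of creators as \<open>e\<^sub>i\<^sub>j - q \<delta>\<^sub>i\<^sub>j\<close>.\<close>

lemma polar_rows:
  assumes "i \<in> {1..n}" "j \<in> {1..n}" "q \<le> m"
  shows "polar i j * word (creat_rows q) = word (creat_rows q) * (polar i j - of_int (if i = j then int q else 0))"
    and "polar i j * word (annih_rows q) = word (annih_rows q) * (polar i j + of_int (if i = j then int q else 0))"
proof -
  let ?t = "\<lambda>q. if i = j then int q else 0"
  have "polar i j * word (creat_rows q) = word (creat_rows q) * (polar i j - of_int (?t q))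
     \<and> polar i j * word (annih_rows q) = word (annih_rows q) * (polar i j + of_int (?t q))"
    using assms(3)
  proof (induction q)
    case 0
    then show ?case by (simp add: creat_rows_def annih_rows_def)
  next
    case (Suc q)
    let ?A = "creats (Suc q) [1..<Suc n]" and ?D = "annihs (Suc q) (rev [1..<Suc n])"
    have c: "polar i j * ?A
        = ?A * (polar i j - of_int (if i = j then 1 else 0))"
      by (rule polar_top_products) (use assms Suc.prems in auto)
    have a: "polar i j * ?D
        = ?D * (polar i j + of_int (if i = j then 1 else 0))"
      by (rule polar_top_products) (use assms Suc.prems in auto)
    have "polar i j * word (creat_rows (Suc q))
        = (polar i j * word (creat_rows q)) * ?A"
      by (simp only: rows_Suc word_simps word_map mult.assoc)
    also have "\<dots> = word (creat_rows q) * ((polar i j - of_int (?t q)) * ?A)"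
      using Suc by (simp add: mult.assoc)
    also have "(polar i j - of_int (?t q)) * ?A
        = ?A * (polar i j - of_int (?t (Suc q)))"
      unfolding left_diff_distrib c by (auto simp: algebra_simps mult_of_nat_commute)
    finally have 1: "polar i j * word (creat_rows (Suc q))
        = word (creat_rows (Suc q)) * (polar i j - of_int (?t (Suc q)))"
      by (simp only: rows_Suc word_simps word_map mult.assoc)
    have "polar i j * word (annih_rows (Suc q))
        = (polar i j * word (annih_rows q)) * ?D"
      by (simp only: rows_Suc word_simps word_map mult.assoc)
    also have "\<dots> = word (annih_rows q) * ((polar i j + of_int (?t q)) * ?D)"
      using Suc by (simp add: mult.assoc)
    also have "(polar i j + of_int (?t q)) * ?D
        = ?D * (polar i j + of_int (?t (Suc q)))"
      unfolding distrib_right a by (auto simp: algebra_simps mult_of_nat_commute)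
    finally have 2: "polar i j * word (annih_rows (Suc q))
        = word (annih_rows (Suc q)) * (polar i j + of_int (?t (Suc q)))"
      by (simp only: rows_Suc word_simps word_map mult.assoc)
    from 1 2 show ?case by blast
  qed
  then show "polar i j * word (creat_rows q) = word (creat_rows q) * (polar i j - of_int (?t q))"
    and "polar i j * word (annih_rows q) = word (annih_rows q) * (polar i j + of_int (?t q))"
    by blast+
qed

text \<open>Every entry of the determinant is shifted by \<open>- q\<close> on the diagonal when it passes the creators.\<close>

lemma capelli_det_creat_rows:
  assumes "q \<le> m"
  shows "capelli_det polar 0 {1..n} * word (creat_rows q) = word (creat_rows q) * capelli_det polar (- int q) {1..n}"
proof -
  define f where "f u \<sigma> s = polar (\<sigma> s) s + (if \<sigma> s = s then of_int (u + int (card {t \<in> {1..n}. s < t})) else 0)"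
    for u \<sigma> s
  have swap: "prod_list (map (f 0 \<sigma>) ss) * word (creat_rows q) = word (creat_rows q) * prod_list (map (f (- int q) \<sigma>) ss)"
    if \<sigma>: "\<sigma> permutes {1..n}" and "set ss \<subseteq> {1..n}" for \<sigma> ss
    using that(2)
  proof (induction ss)
    case (Cons s ss)
    have "\<sigma> s \<in> {1..n}"
      using permutes_in_image[OF \<sigma>] Cons.prems by simp
    then have "polar (\<sigma> s) s * word (creat_rows q)
        = word (creat_rows q) * (polar (\<sigma> s) s - of_int (if \<sigma> s = s then int q else 0))"
      using Cons.prems assms by (intro polar_rows) auto
    then have "f 0 \<sigma> s * word (creat_rows q) = word (creat_rows q) * f (- int q) \<sigma> s"
      by (auto simp: f_def algebra_simps mult_of_nat_commute)
    then have "prod_list (map (f 0 \<sigma>) (s # ss)) * word (creat_rows q)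
        = f 0 \<sigma> s * (prod_list (map (f 0 \<sigma>) ss) * word (creat_rows q))"
      by (simp add: mult.assoc)
    also have "\<dots> = (f 0 \<sigma> s * word (creat_rows q)) * prod_list (map (f (- int q) \<sigma>) ss)"
      using Cons by (simp add: mult.assoc)
    also have "\<dots> = word (creat_rows q) * prod_list (map (f (- int q) \<sigma>) (s # ss))"
      unfolding \<open>f 0 \<sigma> s * word (creat_rows q) = word (creat_rows q) * f (- int q) \<sigma> s\<close>
      by (simp add: mult.assoc)
    finally show ?case .
  qed simp
  have det: "capelli_det polar u {1..n}
      = (\<Sum>\<sigma> | \<sigma> permutes {1..n}. of_int (sign \<sigma>) * prod_list (map (f u \<sigma>) (sorted_list_of_set {1..n})))" for u
    unfolding capelli_det_def f_def ..
  show ?thesis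
    unfolding det sum_distrib_left sum_distrib_right
  proof (intro sum.cong refl)
    fix \<sigma> assume "\<sigma> \<in> {\<sigma>. \<sigma> permutes {1..n}}"
    then have "prod_list (map (f 0 \<sigma>) (sorted_list_of_set {1..n})) * word (creat_rows q)
      = word (creat_rows q) * prod_list (map (f (- int q) \<sigma>) (sorted_list_of_set {1..n}))"
      by (intro swap) auto
    then show "of_int (sign \<sigma>) * prod_list (map (f 0 \<sigma>) (sorted_list_of_set {1..n})) * word (creat_rows q)
      = word (creat_rows q) * (of_int (sign \<sigma>) * prod_list (map (f (- int q) \<sigma>) (sorted_list_of_set {1..n})))"
      by (metis mult.assoc mult_of_int_commute)
  qed
qed

end


section \<open>Capelli determinants modulo irregular words\<close>

text \<open>The left ideal generated by the irregular words is also stable under right multiplication by \<open>gl(n)\<close>,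
since a factor without virtual symbols at the right end of a word does not affect irregularity.\<close>

locale gl_super_ideal = gl_super m n E for m n and E :: "symbol \<Rightarrow> symbol \<Rightarrow> 'a::ring_1" +
  fixes I :: "'a set"
  assumes zero_mem: "0 \<in> I"
    and add_mem: "x \<in> I \<Longrightarrow> y \<in> I \<Longrightarrow> x + y \<in> I"
    and left_mem: "x \<in> I \<Longrightarrow> w * x \<in> I"
    and right_mem: "x \<in> I \<Longrightarrow> i \<in> {1..n} \<Longrightarrow> j \<in> {1..n} \<Longrightarrow> x * polar i j \<in> I"
    and word_mem: "set ws \<subseteq> symbols m n \<times> symbols m n \<Longrightarrow> irregular m ws \<Longrightarrow> word ws \<in> I"
begin

lemma uminus_mem: "x \<in> I \<Longrightarrow> - x \<in> I"
  using left_mem[of x "- 1"] by simp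

lemma diff_mem: "x \<in> I \<Longrightarrow> y \<in> I \<Longrightarrow> x - y \<in> I"
  using add_mem[of x "- y"] uminus_mem by simp

lemma sum_mem: "(\<And>a. a \<in> A \<Longrightarrow> f a \<in> I) \<Longrightarrow> sum f A \<in> I"
  by (induction A rule: infinite_finite_induct) (auto simp: zero_mem add_mem)

text \<open>The annihilators of \<open>\<alpha>\<close> outnumber the creators of \<open>\<alpha>\<close> to their right: there are \<open>length rs + 1\<close> of the
former and \<open>length cs\<close> of the latter.\<close>

lemma overannihilated_mem:
  assumes "x \<in> symbols m n" "\<alpha> \<in> {1..m}" "set rs \<subseteq> {1..n}" "set cs \<subseteq> {1..n}"
    and ws: "set ws \<subseteq> symbols m n \<times> symbols m n" "\<And>p. p \<in> set ws \<Longrightarrow> fst p \<noteq> Virt \<alpha> \<and> snd p \<noteq> Virt \<alpha>"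
    and "length cs \<le> length rs"
  shows "E x (Virt \<alpha>) * (annihs \<alpha> rs * (creats \<alpha> cs * word ws)) \<in> I"
proof -
  let ?vs = "map (\<lambda>t. (Proper t, Virt \<alpha>)) rs @ map (\<lambda>t. (Virt \<alpha>, Proper t)) cs @ ws"
  have "filter (\<lambda>p. fst p = Virt \<alpha>) ws = []" "filter (\<lambda>p. snd p = Virt \<alpha>) ws = []"
    using ws(2) by (simp_all add: filter_empty_conv)
  then have "length (filter (\<lambda>p. fst p = Virt \<alpha>) ?vs) \<le> length (filter (\<lambda>p. snd p = Virt \<alpha>) ?vs)"
    using assms(7) by (simp add: filter_map comp_def)
  then have "irregular m ((x, Virt \<alpha>) # ?vs)"
    unfolding irregular_iff using assms(2) by (intro exI[of _ "[]"]) auto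
  moreover have "set ((x, Virt \<alpha>) # ?vs) \<subseteq> symbols m n \<times> symbols m n"
    using assms(1-5) by auto
  ultimately have "word ((x, Virt \<alpha>) # ?vs) \<in> I"
    by (intro word_mem)
  then show ?thesis
    by (simp add: word_map)
qed

text \<open>What is left of the Capelli determinant after the columns before \<open>c\<close> have been used: \<open>\<rho> c, \<dots>, \<rho> n\<close> are the
remaining rows, and \<open>n - s\<close> on the diagonal refers to the column \<open>s\<close>.\<close>

definition partial_det :: "(nat \<Rightarrow> nat) \<Rightarrow> nat \<Rightarrow> 'a"
  where "partial_det \<rho> c = (\<Sum>\<tau> | \<tau> permutes {c..n}. of_int (sign \<tau>) *
    prod_list (map (\<lambda>s. polar (\<rho> (\<tau> s)) s + (if \<rho> (\<tau> s) = s then of_nat (n - s) else 0)) [c..<Suc n]))"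

lemma partial_det_expand:
  assumes "c \<le> n"
  shows "partial_det \<rho> c = (\<Sum>j\<in>{c..n}. of_int (sign (transpose c j)) *
    ((polar (\<rho> j) c + (if \<rho> j = c then of_nat (n - c) else 0)) * partial_det (\<rho> \<circ> transpose c j) (Suc c)))"
proof -
  define f where "f \<rho> s r = polar (\<rho> r) s + (if \<rho> r = s then of_nat (n - s) else 0)" for \<rho> :: "nat \<Rightarrow> nat" and s r
  have ins: "{c..n} = insert c {Suc c..n}"
    using assms by auto
  have upt: "[c..<Suc n] = c # [Suc c..<Suc n]"
    using assms by (intro upt_conv_Cons) simp
  have "partial_det \<rho> c = (\<Sum>\<tau> | \<tau> permutes insert c {Suc c..n}. of_int (sign \<tau>) *
      (f \<rho> c (\<tau> c) * prod_list (map (\<lambda>s. f \<rho> s (\<tau> s)) [Suc c..<Suc n])))"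
    unfolding partial_det_def upt f_def ins by simp
  also have "\<dots> = (\<Sum>j\<in>insert c {Suc c..n}. \<Sum>q | q permutes {Suc c..n}. of_int (sign (transpose c j \<circ> q)) *
      (f \<rho> c ((transpose c j \<circ> q) c) * prod_list (map (\<lambda>s. f \<rho> s ((transpose c j \<circ> q) s)) [Suc c..<Suc n])))"
    by (rule sum_over_permutations_insert) auto
  also have "\<dots> = (\<Sum>j\<in>{c..n}. of_int (sign (transpose c j)) * (f \<rho> c j * partial_det (\<rho> \<circ> transpose c j) (Suc c)))"
    unfolding ins partial_det_def sum_distrib_left
  proof (intro sum.cong refl)
    fix j q assume "q \<in> {q. q permutes {Suc c..n}}"
    then have q: "q permutes {Suc c..n}" by simp
    have "q c = c"
      using q by (simp add: permutes_def)
    have sgn: "sign (transpose c j \<circ> q) = sign (transpose c j) * sign q"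
      using q by (intro sign_compose permutation_swap_id) (auto simp: permutation_permutes)
    show "of_int (sign (transpose c j \<circ> q)) *
        (f \<rho> c ((transpose c j \<circ> q) c) * prod_list (map (\<lambda>s. f \<rho> s ((transpose c j \<circ> q) s)) [Suc c..<Suc n]))
      = of_int (sign (transpose c j)) * (f \<rho> c j * (of_int (sign q) *
        prod_list (map (\<lambda>s. polar ((\<rho> \<circ> transpose c j) (q s)) s
          + (if (\<rho> \<circ> transpose c j) (q s) = s then of_nat (n - s) else 0)) [Suc c..<Suc n])))"
      unfolding sgn f_def o_apply \<open>q c = c\<close> of_int_mult transpose_apply_first
      by (simp only: mult.assoc of_int_left_commute[of _ "sign q"])
  qed
  finally show ?thesis
    by (simp only: f_def)
qed

text \<open>Capelli's identity, by induction over the columns. After \<open>annihs_creat\<close> is applied to the first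
creator, the term in which the creator has passed all annihilators is in \<open>I\<close>, because one creator is
missing to the right of the annihilators; so are the terms that start with \<open>e\<^sub>\<alpha>\<^sub>\<alpha>\<close>, because \<open>e\<^sub>\<alpha>\<^sub>\<alpha>\<close>
annihilates \<open>\<alpha>\<close> once more. The other terms form the expansion of the determinant along its first
column.\<close>

lemma annihs_creats_word:
  assumes "\<alpha> \<in> {1..m}" "\<rho> ` {c..n} \<subseteq> {1..n}" "1 \<le> c" "c \<le> Suc n"
    and ws: "set ws \<subseteq> symbols m n \<times> symbols m n" "\<And>p. p \<in> set ws \<Longrightarrow> fst p \<noteq> Virt \<alpha> \<and> snd p \<noteq> Virt \<alpha>"
  shows "annihs \<alpha> (rev (map \<rho> [c..<Suc n])) * (creats \<alpha> [c..<Suc n] * word ws) - partial_det \<rho> c * word ws \<in> I"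
  using assms(2-4)
proof (induction "Suc n - c" arbitrary: c \<rho>)
  case 0
  then have "c = Suc n" by simp
  then show ?case
    using zero_mem by (simp add: partial_det_def)
next
  case (Suc d)
  define rs where "rs = rev (map \<rho> [c..<Suc n])"
  define V where "V = creats \<alpha> [Suc c..<Suc n] * word ws"
  let ?Di = "\<lambda>i. annihs \<alpha> (take i rs @ drop (Suc i) rs)"
  let ?Dj = "\<lambda>j. annihs \<alpha> (rev (map (\<rho> \<circ> transpose c j) [Suc c..<Suc n]))"
  let ?P = "\<lambda>j. partial_det (\<rho> \<circ> transpose c j) (Suc c)"
  let ?s = "\<lambda>j. of_int (sign (transpose c j)) :: 'a"
  let ?f = "\<lambda>j. polar (\<rho> j) c + (if \<rho> j = c then of_nat (n - c) else 0)"
  let ?g = "\<lambda>i. polar (rs ! i) c + (if rs ! i = c then vnum \<alpha> + of_nat (length rs - 1) else 0)"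
  have c: "c \<le> n" using Suc.hyps(2) by simp
  have len: "length rs = Suc n - c" by (simp add: rs_def del: upt_Suc)
  have rs: "set rs \<subseteq> {1..n}"
    using Suc.prems(1) by (auto simp: rs_def)
  have upt: "[c..<Suc n] = c # [Suc c..<Suc n]"
    using c by (intro upt_conv_Cons) simp
  \<comment> \<open>The rows are listed in decreasing order, so that the row with index \<open>j\<close> is in position \<open>n - j\<close>.\<close>
  have reindex: "(\<Sum>i<length rs. h i) = (\<Sum>j\<in>{c..n}. h (n - j))" for h :: "nat \<Rightarrow> 'a"
    using c by (intro sum.reindex_bij_witness[of _ "\<lambda>j. n - j" "\<lambda>i. n - i"]) (auto simp: len)
  have entry: "rs ! (n - j) = \<rho> j" if "j \<in> {c..n}" for j
  proof -
    have pos: "length (map \<rho> [c..<Suc n]) - Suc (n - j) = j - c" "j - c < length [c..<Suc n]" "c + (j - c) = j"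
      using that by (auto simp del: upt_Suc)
    have "rs ! (n - j) = map \<rho> [c..<Suc n] ! (length (map \<rho> [c..<Suc n]) - Suc (n - j))"
      unfolding rs_def using that c by (intro rev_nth) (auto simp del: upt_Suc)
    also have "\<dots> = \<rho> j"
      using pos nth_upt[of c "j - c" "Suc n"] unfolding pos(1) by (auto simp del: upt_Suc)
    finally show ?thesis .
  qed
  have "annihs \<alpha> rs * (creats \<alpha> [c..<Suc n] * word ws) = (annihs \<alpha> rs * creat \<alpha> c) * V"
    by (simp only: upt V_def list.map prod_list.Cons mult.assoc)
  also have "\<dots> = (- 1) ^ length rs * (creat \<alpha> c * (annihs \<alpha> rs * V))
     + (\<Sum>i<length rs. (- 1) ^ (length rs - 1 - i) * (?g i * (?Di i * V)))"
    using annihs_creat[OF assms(1) rs, of c] c Suc.prems(2)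
    by (simp only: distrib_right sum_distrib_right mult.assoc atLeastAtMost_iff)
  also have "(\<Sum>i<length rs. (- 1) ^ (length rs - 1 - i) * (?g i * (?Di i * V)))
    = (\<Sum>j\<in>{c..n}. (- 1) ^ (n - c - (n - j)) * (?g (n - j) * (?Di (n - j) * V)))"
    unfolding reindex by (simp add: len Suc_diff_le[OF c])
  also have "\<dots> = (\<Sum>j\<in>{c..n}. ?s j * (?f j * (?Dj j * V))
      + (if \<rho> j = c then ?s j * (vnum \<alpha> * (?Dj j * V)) else 0))"
  proof (intro sum.cong refl)
    fix j assume j: "j \<in> {c..n}"
    have g: "?g (n - j) = ?f j + (if \<rho> j = c then vnum \<alpha> else 0)"
      using c by (simp add: entry[OF j] len)
    have "(- 1) ^ (n - c - (n - j)) * (?g (n - j) * (?Di (n - j) * V))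
        = ?g (n - j) * (((- 1) ^ (n - c - (n - j)) * ?Di (n - j)) * V)"
      by (simp only: neg_one_power_left_commute mult.assoc)
    also have "(- 1) ^ (n - c - (n - j)) * ?Di (n - j) = ?s j * ?Dj j"
      using annihs_remove_transpose[OF assms(1) Suc.prems(1) _ _ rs_def] j by simp
    also have "?g (n - j) * ((?s j * ?Dj j) * V) = ?s j * (?g (n - j) * (?Dj j * V))"
      by (simp only: mult.assoc of_int_left_commute)
    also have "\<dots> = ?s j * (?f j * (?Dj j * V)) + (if \<rho> j = c then ?s j * (vnum \<alpha> * (?Dj j * V)) else 0)"
      unfolding g by (cases "\<rho> j = c") (simp_all only: if_True if_False distrib_left distrib_right add_0_right simp_thms)
    finally show "(- 1) ^ (n - c - (n - j)) * (?g (n - j) * (?Di (n - j) * V))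
      = ?s j * (?f j * (?Dj j * V)) + (if \<rho> j = c then ?s j * (vnum \<alpha> * (?Dj j * V)) else 0)" .
  qed
  finally have expansion: "annihs \<alpha> rs * (creats \<alpha> [c..<Suc n] * word ws)
    = (- 1) ^ length rs * (creat \<alpha> c * (annihs \<alpha> rs * V))
      + (\<Sum>j\<in>{c..n}. ?s j * (?f j * (?Dj j * V))
          + (if \<rho> j = c then ?s j * (vnum \<alpha> * (?Dj j * V)) else 0))" .
  have regroup: "a + (b + b') - b'' = a + b' + (b - b'')" for a b b' b'' :: 'a
    by simp
  have eq: "annihs \<alpha> rs * (creats \<alpha> [c..<Suc n] * word ws) - partial_det \<rho> c * word ws
    = (- 1) ^ length rs * (creat \<alpha> c * (annihs \<alpha> rs * V))
      + (\<Sum>j\<in>{c..n}. if \<rho> j = c then ?s j * (vnum \<alpha> * (?Dj j * V)) else 0)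
      + (\<Sum>j\<in>{c..n}. ?s j * (?f j * (?Dj j * V - ?P j * word ws)))"
    unfolding expansion partial_det_expand[OF c] sum_distrib_right sum.distrib right_diff_distrib sum_subtractf mult.assoc
    by (rule regroup)
  have range: "(\<rho> \<circ> transpose c j) ` {Suc c..n} \<subseteq> {1..n}" if "j \<in> {c..n}" for j
    using that c Suc.prems(1) by (auto simp: transpose_def image_subset_iff)
  have head: "annihs \<alpha> rs * V \<in> I"
  proof -
    obtain r rs' where rs': "rs = r # rs'"
      using len c by (cases rs) auto
    have "E (Proper r) (Virt \<alpha>) * (annihs \<alpha> rs' * V) \<in> I"
      unfolding V_def using assms(1) rs rs' ws len Suc.prems(2)
      by (intro overannihilated_mem) auto
    then show ?thesis
      by (simp add: rs' mult.assoc)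
  qed
  have diag: "vnum \<alpha> * (?Dj j * V) \<in> I" if "j \<in> {c..n}" for j
    unfolding V_def using assms(1) range[OF that] ws Suc.prems(2)
    by (intro overannihilated_mem) (auto simp del: upt_Suc)
  have IH: "?Dj j * V - ?P j * word ws \<in> I" if "j \<in> {c..n}" for j
    unfolding V_def using Suc.hyps(2) range[OF that] c by (intro Suc.hyps(1)) auto
  show ?case
    unfolding rs_def[symmetric] eq
  proof (intro add_mem sum_mem)
    show "(- 1) ^ length rs * (creat \<alpha> c * (annihs \<alpha> rs * V)) \<in> I"
      by (intro left_mem head)
  next
    fix j assume "j \<in> {c..n}"
    then show "(if \<rho> j = c then ?s j * (vnum \<alpha> * (?Dj j * V)) else 0) \<in> I"
      by (cases "\<rho> j = c") (simp_all only: if_True if_False simp_thms left_mem diag zero_mem)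
  next
    fix j assume "j \<in> {c..n}"
    then show "?s j * (?f j * (?Dj j * V - ?P j * word ws)) \<in> I"
      by (intro left_mem IH)
  qed
qed

lemma partial_det_full: "partial_det (\<lambda>i. i) 1 = capelli_det polar 0 {1..n}"
proof -
  have card: "card {t \<in> {1..n}. s < t} = n - s" for s
  proof -
    have "{t \<in> {1..n}. s < t} = {Suc s..n}" by auto
    then show ?thesis by simp
  qed
  have "sorted_list_of_set {1..n} = [1..<Suc n]"
    by (simp add: atLeastLessThanSuc_atLeastAtMost[symmetric] sorted_list_of_set_range del: upt_Suc)
  then show ?thesis
    unfolding partial_det_def capelli_det_def card by (simp del: upt_Suc cong: if_cong)
qed

lemma capelli_row:
  assumes "q < m"
  shows "annihs (Suc q) (rev [1..<Suc n]) * (creats (Suc q) [1..<Suc n] * word (creat_rows q))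
    - word (creat_rows q) * capelli_det polar (- int q) {1..n} \<in> I"
proof -
  have "annihs (Suc q) (rev (map (\<lambda>i. i) [1..<Suc n])) * (creats (Suc q) [1..<Suc n] * word (creat_rows q))
    - partial_det (\<lambda>i. i) 1 * word (creat_rows q) \<in> I"
    using assms by (intro annihs_creats_word) (auto simp: creat_rows_def)
  then show ?thesis
    using assms capelli_det_creat_rows[of q] unfolding partial_det_full by simp
qed

text \<open>There are \<open>n q\<close> creators in the first \<open>q\<close> rows and \<open>n\<close> in the last one, hence the sign
\<open>(-1)\<^bsup>n q n\<^esup> = (-1)\<^bsup>n q\<^esup>\<close> of moving the last row of creators to the front.\<close>

lemma capelli_step:
  assumes "q < m"
  shows "word (annih_rows (Suc q)) * word (creat_rows (Suc q))
    - (- 1) ^ (n * q) * (word (annih_rows q) * (word (creat_rows q) * capelli_det polar (- int q) {1..n})) \<in> I"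
proof -
  let ?D = "annihs (Suc q) (rev [1..<Suc n])" and ?A = "creats (Suc q) [1..<Suc n]"
  let ?W = "word (creat_rows q)"
  have words: "word ws = prod_list (map (\<lambda>p. E (fst p) (snd p)) ws)" for ws
    by (simp only: word_def case_prod_unfold)
  have "word (creat_rows q) * ?A = (- 1) ^ (length (creat_rows q) * n) * (?A * word (creat_rows q))"
  proof -
    have "prod_list (map (\<lambda>p. E (fst p) (snd p)) (creat_rows q)) * prod_list (map (creat (Suc q)) [1..<Suc n])
      = (- 1) ^ (length (map (\<lambda>p. E (fst p) (snd p)) (creat_rows q)) * length (map (creat (Suc q)) [1..<Suc n]))
        * (prod_list (map (creat (Suc q)) [1..<Suc n]) * prod_list (map (\<lambda>p. E (fst p) (snd p)) (creat_rows q)))"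
    proof (rule prod_list_anticommute)
      fix u v assume "u \<in> set (map (\<lambda>p. E (fst p) (snd p)) (creat_rows q))" "v \<in> set (map (creat (Suc q)) [1..<Suc n])"
      then have "u \<in> (\<Union>i<q. creat (Suc i) ` {1..n})" "v \<in> creat (Suc q) ` {1..n}"
        by (force simp: creat_rows_def simp del: upt_Suc)+
      then obtain i s t where "i < q" "s \<in> {1..n}" "t \<in> {1..n}" "u = creat (Suc i) s" "v = creat (Suc q) t"
        by blast
      then show "u * v = - (v * u)"
        using basic_relations(2)[of "Suc i" "Suc q" s t s] assms by simp
    qed
    then show ?thesis
      by (simp add: words del: upt_Suc)
  qed
  moreover have "length (creat_rows q) = q * n"
    by (simp add: creat_rows_def length_concat comp_def sum_list_triv)
  moreover have "(- 1 :: 'a) ^ (q * n * n) = (- 1) ^ (n * q)"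
    by (simp add: minus_one_power_iff)
  ultimately have "word (annih_rows (Suc q)) * word (creat_rows (Suc q))
      = word (annih_rows q) * (?D * ((- 1) ^ (n * q) * (?A * ?W)))"
    by (simp only: rows_Suc word_simps word_map mult.assoc)
  also have "\<dots> = (- 1) ^ (n * q) * (word (annih_rows q) * (?D * (?A * ?W)))"
    by (simp only: neg_one_power_left_commute mult.assoc)
  finally have "word (annih_rows (Suc q)) * word (creat_rows (Suc q))
    - (- 1) ^ (n * q) * (word (annih_rows q) * (?W * capelli_det polar (- int q) {1..n}))
    = (- 1) ^ (n * q) * (word (annih_rows q) * (?D * (?A * ?W) - ?W * capelli_det polar (- int q) {1..n}))"
    by (simp only: right_diff_distrib)
  then show ?thesis
    using capelli_row[OF assms] by (simp add: left_mem)
qed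

lemma polar_rows_commute:
  assumes "i \<in> {1..n}" "j \<in> {1..n}" "q \<le> m"
  shows "polar i j * (word (annih_rows q) * word (creat_rows q)) = word (annih_rows q) * word (creat_rows q) * polar i j"
proof -
  let ?d = "of_int (if i = j then int q else 0) :: 'a"
  have "polar i j * (word (annih_rows q) * word (creat_rows q)) = word (annih_rows q) * ((polar i j + ?d) * word (creat_rows q))"
    unfolding mult.assoc[symmetric] polar_rows(2)[OF assms] ..
  also have "(polar i j + ?d) * word (creat_rows q) = word (creat_rows q) * polar i j"
    unfolding distrib_right polar_rows(1)[OF assms] by (simp add: right_diff_distrib mult_of_int_commute)
  finally show ?thesis
    by (simp only: mult.assoc)
qed

text \<open>\<open>D A\<close> commutes with \<open>e\<^sub>i\<^sub>j\<close>, and \<open>D A W\<close> is \<open>W C\<close> modulo \<open>I\<close> by \<open>capelli_row\<close>. Commuting \<open>e\<^sub>i\<^sub>j\<close> with both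
sides, where \<open>W e\<^sub>i\<^sub>j = (e\<^sub>i\<^sub>j + q \<delta>\<^sub>i\<^sub>j) W\<close>, gives the claim.\<close>

lemma capelli_det_commutator:
  assumes "i \<in> {1..n}" "j \<in> {1..n}" "q < m"
  defines "C \<equiv> capelli_det polar (- int q) {1..n}"
  shows "word (creat_rows q) * (polar i j * C - C * polar i j) \<in> I"
proof -
  let ?d = "of_int (if i = j then int q else 0) :: 'a" and ?e = "of_int (if i = j then 1 else 0) :: 'a"
  let ?D = "annihs (Suc q) (rev [1..<Suc n])" and ?A = "creats (Suc q) [1..<Suc n]"
  let ?W = "word (creat_rows q)"
  have W: "?W * polar i j = (polar i j + ?d) * ?W"
    unfolding distrib_right polar_rows(1)[OF assms(1,2) less_imp_le[OF assms(3)]]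
    by (simp add: right_diff_distrib mult_of_int_commute)
  have D: "polar i j * ?D = ?D * (polar i j + ?e)"
    by (rule polar_top_products) (use assms in auto)
  have A: "polar i j * ?A = ?A * (polar i j - ?e)"
    by (rule polar_top_products) (use assms in auto)
  have "polar i j * (?D * ?A) = ?D * ((polar i j + ?e) * ?A)"
    unfolding mult.assoc[symmetric] D ..
  also have "(polar i j + ?e) * ?A = ?A * polar i j"
    unfolding distrib_right A by (simp add: right_diff_distrib mult_of_int_commute)
  finally have DA: "polar i j * (?D * ?A) = ?D * ?A * polar i j"
    by (simp only: mult.assoc)
  then have DA': "(polar i j + ?d) * (?D * ?A) = ?D * ?A * (polar i j + ?d)"
    by (simp only: distrib_left distrib_right mult_of_int_commute)
  have "(polar i j + ?d) * (?D * (?A * ?W)) = ((polar i j + ?d) * (?D * ?A)) * ?W"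
    by (simp only: mult.assoc)
  also have "\<dots> = ?D * ?A * ((polar i j + ?d) * ?W)"
    unfolding DA' by (simp only: mult.assoc)
  also have "\<dots> = ?D * (?A * ?W) * polar i j"
    unfolding W[symmetric] by (simp only: mult.assoc)
  finally have "(polar i j + ?d) * (?D * (?A * ?W)) = ?D * (?A * ?W) * polar i j" .
  then have "?W * (polar i j * C - C * polar i j)
    = (?D * (?A * ?W) - ?W * C) * polar i j - (polar i j + ?d) * (?D * (?A * ?W) - ?W * C)"
    unfolding right_diff_distrib left_diff_distrib mult.assoc[symmetric] W by simp
  moreover have "?D * (?A * ?W) - ?W * C \<in> I"
    unfolding C_def by (rule capelli_row[OF assms(3)])
  ultimately show ?thesis
    using assms(1,2) by (simp only: diff_mem left_mem right_mem)
qed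

end
section \<open>Additive maps\<close>

text \<open>The additive endomorphisms of an abelian group form a ring; the class \<open>zero_neq_one\<close> keeps the identity
different from zero.\<close>

typedef (overloaded) 'v endo = "{f :: 'v::{ab_group_add, zero_neq_one} \<Rightarrow> 'v. \<forall>x y. f (x + y) = f x + f y}"
  morphisms app Endo
  by (rule exI[of _ "\<lambda>x. 0"]) simp

setup_lifting type_definition_endo

lemma app_add [simp]: "app f (x + y) = app f x + app f y"
  using app[of f] by simp

lemma app_zero [simp]: "app f 0 = 0"
  using app_add[of f 0 0] by simp

lemma app_minus [simp]: "app f (- x) = - app f x"
  using app_add[of f x "- x"] by (simp add: eq_neg_iff_add_eq_0 add.commute)

lemma endo_eqI: "(\<And>x. app f x = app g x) \<Longrightarrow> f = g"
  by (simp add: app_inject[symmetric] fun_eq_iff)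

instantiation endo :: ("{ab_group_add, zero_neq_one}") ring_1
begin

lift_definition zero_endo :: "'a endo" is "\<lambda>x. 0" by simp
lift_definition one_endo :: "'a endo" is "\<lambda>x. x" by simp
lift_definition plus_endo :: "'a endo \<Rightarrow> 'a endo \<Rightarrow> 'a endo" is "\<lambda>f g x. f x + g x"
  by (simp add: algebra_simps)
lift_definition uminus_endo :: "'a endo \<Rightarrow> 'a endo" is "\<lambda>f x. - f x"
  by (simp add: algebra_simps)
lift_definition minus_endo :: "'a endo \<Rightarrow> 'a endo \<Rightarrow> 'a endo" is "\<lambda>f g x. f x - g x"
  by (simp add: algebra_simps)
lift_definition times_endo :: "'a endo \<Rightarrow> 'a endo \<Rightarrow> 'a endo" is "\<lambda>f g x. f (g x)"
  by simp

instance
proof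
  show "0 \<noteq> (1 :: 'a endo)"
    by transfer (metis zero_neq_one)
qed (transfer; simp add: fun_eq_iff algebra_simps; fail)+

end

lemma app_simps [simp]:
  "app 0 x = 0" "app 1 x = x" "app (f + g) x = app f x + app g x" "app (- f) x = - app f x"
  "app (f - g) x = app f x - app g x" "app (f * g) x = app f (app g x)"
  by (transfer; simp)+

lemma app_sum: "app (sum f A) x = (\<Sum>a\<in>A. app (f a) x)"
  by (induction A rule: infinite_finite_induct) auto

section \<open>Creation and annihilation operators on an exterior algebra\<close>

text \<open>\<open>f S\<close> is the coefficient of the exterior product, in increasing order, of the generators with indices in
\<open>S\<close>. Infinite sets are admitted because every sign depends on finitely many indices only.\<close>

type_synonym 'b fock = "nat set \<Rightarrow> 'b"

definition sign_below :: "nat \<Rightarrow> nat set \<Rightarrow> 'b::ring_1"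
  where "sign_below x S = (- 1) ^ card {y \<in> S. y < x}"

lemma sign_below_insert:
  assumes "y \<notin> S"
  shows "sign_below x (insert y S) = (if y < x then - sign_below x S else sign_below x S)"
proof (cases "y < x")
  case True
  then have "{z \<in> insert y S. z < x} = insert y {z \<in> S. z < x}"
    by auto
  with assms True show ?thesis
    by (simp add: sign_below_def)
next
  case False
  then have "{z \<in> insert y S. z < x} = {z \<in> S. z < x}"
    by auto
  with False show ?thesis
    by (simp add: sign_below_def)
qed

lemma sign_below_remove:
  assumes "y \<in> S"
  shows "sign_below x (S - {y}) = (if y < x then - sign_below x S else sign_below x S :: 'b::ring_1)"
  using sign_below_insert[of y "S - {y}" x, where ?'a = 'b] assms by (auto simp: insert_absorb)

lemma sign_below_cases: "sign_below x S = (1 :: 'b::ring_1) \<or> sign_below x S = (- 1 :: 'b)"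
  by (simp add: sign_below_def minus_one_power_iff)

text \<open>Exterior multiplication by a generator, and contraction with it. The sign counts the generators that
have to be passed.\<close>

lift_definition cre :: "nat \<Rightarrow> 'b::ring_1 fock endo"
  is "\<lambda>x f S. if x \<in> S then sign_below x S * f (S - {x}) else 0"
  by (auto simp: fun_eq_iff distrib_left)

lift_definition ann :: "nat \<Rightarrow> 'b::ring_1 fock endo"
  is "\<lambda>x f S. if x \<in> S then 0 else sign_below x S * f (insert x S)"
  by (auto simp: fun_eq_iff distrib_left)

lift_definition lmul :: "'b::ring_1 \<Rightarrow> 'b fock endo"
  is "\<lambda>u f S. u * f S"
  by (auto simp: fun_eq_iff distrib_left)

lemma app_cre: "app (cre x) f S = (if x \<in> S then sign_below x S * f (S - {x}) else 0)"
  by transfer simp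

lemma app_ann: "app (ann x) f S = (if x \<in> S then 0 else sign_below x S * f (insert x S))"
  by transfer simp

lemma app_lmul: "app (lmul u) f S = u * f S"
  by transfer simp

lemma fock_eqI: "(\<And>f S. app F f S = app G f S) \<Longrightarrow> F = G"
  by (rule endo_eqI) (simp add: fun_eq_iff)

lemma cre_cre: "cre x * cre y = - (cre y * cre x :: 'b::ring_1 fock endo)"
proof (rule fock_eqI)
  fix f :: "'b fock" and S
  have remove: "S - {x} - {y} = S - {x, y}" "S - {y} - {x} = S - {x, y}" by auto
  show "app (cre x * cre y) f S = app (- (cre y * cre x)) f S"
  proof (cases "x \<noteq> y \<and> x \<in> S \<and> y \<in> S")
    case True
    then have "app (cre x * cre y) f S = sign_below x S * sign_below y (S - {x}) * f (S - {x, y})"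
      "app (cre y * cre x) f S = sign_below y S * sign_below x (S - {y}) * f (S - {x, y})"
      by (simp_all add: app_cre remove mult.assoc)
    moreover have "sign_below x S * sign_below y (S - {x}) = - (sign_below y S * sign_below x (S - {y}) :: 'b)"
      using True sign_below_cases[of x S, where ?'b = 'b] sign_below_cases[of y S, where ?'b = 'b]
      by (cases x y rule: linorder_cases) (auto simp: sign_below_remove)
    ultimately show ?thesis by simp
  qed (auto simp: app_cre)
qed

lemma ann_ann: "ann x * ann y = - (ann y * ann x :: 'b::ring_1 fock endo)"
proof (rule fock_eqI)
  fix f :: "'b fock" and S
  show "app (ann x * ann y) f S = app (- (ann y * ann x)) f S"
  proof (cases "x \<noteq> y \<and> x \<notin> S \<and> y \<notin> S")
    case True
    then have "app (ann x * ann y) f S = sign_below x S * sign_below y (insert x S) * f (insert y (insert x S))"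
      "app (ann y * ann x) f S = sign_below y S * sign_below x (insert y S) * f (insert y (insert x S))"
      by (simp_all add: app_ann insert_commute[of x y S] mult.assoc)
    moreover have "sign_below x S * sign_below y (insert x S) = - (sign_below y S * sign_below x (insert y S) :: 'b)"
      using True sign_below_cases[of x S, where ?'b = 'b] sign_below_cases[of y S, where ?'b = 'b]
      by (cases x y rule: linorder_cases) (auto simp: sign_below_insert)
    ultimately show ?thesis by simp
  qed (auto simp: app_ann)
qed

lemma ann_cre: "ann x * cre y = - (cre y * ann x) + (if x = y then 1 else 0 :: 'b::ring_1 fock endo)"
proof (rule fock_eqI)
  fix f :: "'b fock" and S
  show "app (ann x * cre y) f S = app (- (cre y * ann x) + (if x = y then 1 else 0)) f S"
  proof (cases "x = y")
    case True
    then show ?thesis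
      using sign_below_cases[of y S, where ?'b = 'b]
      by (cases "y \<in> S") (auto simp: app_cre app_ann sign_below_remove sign_below_insert insert_absorb)
  next
    case neq: False
    show ?thesis
    proof (cases "x \<notin> S \<and> y \<in> S")
      case True
      then have "app (ann x * cre y) f S = sign_below x S * sign_below y (insert x S) * f (insert x (S - {y}))"
        "app (cre y * ann x) f S = sign_below y S * sign_below x (S - {y}) * f (insert x (S - {y}))"
        using neq by (simp_all add: app_cre app_ann insert_Diff_if mult.assoc)
      moreover have "sign_below x S * sign_below y (insert x S) = - (sign_below y S * sign_below x (S - {y}) :: 'b)"
        using True neq sign_below_cases[of x S, where ?'b = 'b] sign_below_cases[of y S, where ?'b = 'b]
        by (cases x y rule: linorder_cases) (auto simp: sign_below_insert sign_below_remove)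
      ultimately show ?thesis
        using neq by simp
    qed (use neq in \<open>auto simp: app_cre app_ann\<close>)
  qed
qed

lemma lmul_cre: "lmul u * cre x = cre x * lmul u" for u :: "'b::ring_1"
proof (rule fock_eqI)
  fix f :: "'b fock" and S
  show "app (lmul u * cre x) f S = app (cre x * lmul u) f S"
    using sign_below_cases[of x S, where ?'b = 'b] by (auto simp: app_cre app_lmul)
qed

lemma lmul_ann: "lmul u * ann x = ann x * lmul u" for u :: "'b::ring_1"
proof (rule fock_eqI)
  fix f :: "'b fock" and S
  show "app (lmul u * ann x) f S = app (ann x * lmul u) f S"
    using sign_below_cases[of x S, where ?'b = 'b] by (auto simp: app_ann app_lmul)
qed

lemma lmul_simps:
  "lmul (u + v) = lmul u + lmul v" "lmul (u - v) = lmul u - lmul v" "lmul (u * v) = lmul u * lmul v"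
  "lmul 0 = 0" "lmul 1 = 1"
  by (rule fock_eqI; simp add: app_lmul algebra_simps)+

section \<open>A free field realization of gl(m|n)\<close>

text \<open>The module induced from \<open>U(gl(n))\<close>, on which \<open>e\<^sub>\<alpha>\<^sub>\<beta>\<close> and \<open>e\<^sub>i\<^sub>\<alpha>\<close> act by zero on the vacuum, is an
exterior algebra with generators \<open>\<xi>\<^sub>\<alpha>\<^sub>i\<close> over \<open>U(gl(n))\<close>. Here \<open>a\<close> is multiplication by \<open>\<xi>\<^sub>\<alpha>\<^sub>i\<close>, \<open>d\<close> is
contraction with it and \<open>l\<close> is left multiplication by \<open>e\<^sub>i\<^sub>j\<close> on coefficients; only the relations among
these operators enter the verification of the relations of \<open>gl(m|n)\<close>.\<close>

locale fock_rep =
  fixes m n :: nat and a d l :: "nat \<Rightarrow> nat \<Rightarrow> 'r::ring_1"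
  assumes a_a: "a \<alpha> i * a \<beta> j = - (a \<beta> j * a \<alpha> i)"
    and d_d: "d \<alpha> i * d \<beta> j = - (d \<beta> j * d \<alpha> i)"
    and d_a: "d \<alpha> i * a \<beta> j = - (a \<beta> j * d \<alpha> i) + (if \<alpha> = \<beta> \<and> i = j then 1 else 0)"
    and l_a: "l i j * a \<beta> k = a \<beta> k * l i j"
    and l_d: "l i j * d \<beta> k = d \<beta> k * l i j"
    and l_l: "\<lbrakk>i \<in> {1..n}; j \<in> {1..n}; k \<in> {1..n}; p \<in> {1..n}\<rbrakk> \<Longrightarrow>
      l i j * l k p - l k p * l i j = (if j = k then l i p else 0) - (if i = p then l k j else 0)"
begin

definition comm :: "'r \<Rightarrow> 'r \<Rightarrow> 'r"
  where "comm x y = x * y - y * x"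

lemma comm_mult: "comm x (y * z) = comm x y * z + y * comm x z"
  by (simp add: comm_def algebra_simps)

lemma comm_diff: "comm x (y - z) = comm x y - comm x z" "comm (x - y) z = comm x z - comm y z"
  by (simp_all add: comm_def algebra_simps)

lemma comm_sum: "comm x (sum f A) = (\<Sum>s\<in>A. comm x (f s))" "comm (sum f A) x = (\<Sum>s\<in>A. comm (f s) x)"
  by (simp_all add: comm_def sum_distrib_left sum_distrib_right sum_subtractf)

lemma comm_ad_a: "comm (a \<alpha> i * d \<beta> j) (a \<gamma> k) = (if \<beta> = \<gamma> \<and> j = k then a \<alpha> i else 0)"
proof -
  have "a \<alpha> i * d \<beta> j * a \<gamma> k = (if \<beta> = \<gamma> \<and> j = k then a \<alpha> i else 0) - (a \<alpha> i * a \<gamma> k) * d \<beta> j"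
    by (auto simp: mult.assoc d_a distrib_left right_diff_distrib)
  then show ?thesis
    unfolding a_a[of \<alpha> i \<gamma> k] by (simp add: comm_def mult.assoc)
qed

lemma comm_ad_d: "comm (a \<alpha> i * d \<beta> j) (d \<gamma> k) = - (if \<alpha> = \<gamma> \<and> i = k then d \<beta> j else 0)"
proof -
  have "d \<gamma> k * (a \<alpha> i * d \<beta> j) = (if \<alpha> = \<gamma> \<and> i = k then d \<beta> j else 0) - a \<alpha> i * (d \<gamma> k * d \<beta> j)"
    by (auto simp: mult.assoc[symmetric] d_a distrib_right left_diff_distrib)
  then show ?thesis
    unfolding d_d[of \<gamma> k \<beta> j] by (simp add: comm_def mult.assoc)
qed

text \<open>The operators of \<open>e\<^sub>\<alpha>\<^sub>\<beta>\<close>, \<open>e\<^sub>i\<^sub>j\<close> and \<open>e\<^sub>i\<^sub>\<alpha>\<close>. The first two act on the generators by derivations. The last one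
is determined by its anticommutators with the generators, and writing it with the full operator
\<open>pp\<close> of \<open>e\<^sub>i\<^sub>k\<close>, instead of \<open>l\<close>, absorbs its cubic part.\<close>

definition vv :: "nat \<Rightarrow> nat \<Rightarrow> 'r"
  where "vv \<alpha> \<beta> = (\<Sum>k\<in>{1..n}. a \<alpha> k * d \<beta> k)"

definition pp :: "nat \<Rightarrow> nat \<Rightarrow> 'r"
  where "pp i j = l i j - (\<Sum>\<gamma>\<in>{1..m}. a \<gamma> j * d \<gamma> i)"

definition pv :: "nat \<Rightarrow> nat \<Rightarrow> 'r"
  where "pv i \<alpha> = (\<Sum>k\<in>{1..n}. pp i k * d \<alpha> k)"

lemma mult_delta_left: "(if P then x else 0) * y = (if P then x * y else 0)"
  and mult_delta_right: "y * (if P then x else 0) = (if P then y * x else 0)" for x y :: 'r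
  by simp_all

lemmas delta_simps = comm_sum comm_diff comm_mult comm_ad_a comm_ad_d mult_delta_left mult_delta_right
  sum.delta sum.delta' sum_negf sum.distrib sum_subtractf

lemma comm_l: "comm (l i j) (a \<beta> k) = 0" "comm (l i j) (d \<beta> k) = 0" "comm (a \<beta> k * d \<gamma> p) (l i j) = 0"
  by (simp_all add: comm_def l_a l_d)
    (metis l_a l_d mult.assoc diff_self)

lemma comm_vv_a: "k \<in> {1..n} \<Longrightarrow> comm (vv \<alpha> \<beta>) (a \<gamma> k) = (if \<beta> = \<gamma> then a \<alpha> k else 0)"
  by (cases "\<beta> = \<gamma>") (simp_all add: vv_def delta_simps)

lemma comm_vv_d: "k \<in> {1..n} \<Longrightarrow> comm (vv \<alpha> \<beta>) (d \<gamma> k) = - (if \<alpha> = \<gamma> then d \<beta> k else 0)"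
  by (cases "\<alpha> = \<gamma>") (simp_all add: vv_def delta_simps)

lemma comm_pp_a: "\<gamma> \<in> {1..m} \<Longrightarrow> comm (pp i j) (a \<gamma> k) = - (if i = k then a \<gamma> j else 0)"
  by (cases "i = k") (simp_all add: pp_def delta_simps comm_l)

lemma comm_pp_d: "\<gamma> \<in> {1..m} \<Longrightarrow> comm (pp i j) (d \<gamma> k) = (if j = k then d \<gamma> i else 0)"
  by (cases "j = k") (simp_all add: pp_def delta_simps comm_l)

lemma comm_vv_vv: "comm (vv \<alpha> \<beta>) (vv \<gamma> \<delta>) = (if \<beta> = \<gamma> then vv \<alpha> \<delta> else 0) - (if \<alpha> = \<delta> then vv \<gamma> \<beta> else 0)"
proof -
  have "comm (vv \<alpha> \<beta>) (vv \<gamma> \<delta>)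
    = (\<Sum>k\<in>{1..n}. (if \<beta> = \<gamma> then a \<alpha> k * d \<delta> k else 0) - (if \<alpha> = \<delta> then a \<gamma> k * d \<beta> k else 0))"
    unfolding vv_def[of \<gamma> \<delta>] comm_sum comm_mult
    by (intro sum.cong refl) (auto simp: comm_vv_a comm_vv_d)
  then show ?thesis
    by (simp add: vv_def sum_subtractf)
qed

lemma comm_vv_pp:
  assumes "\<alpha> \<in> {1..m}" "\<beta> \<in> {1..m}" "i \<in> {1..n}" "j \<in> {1..n}"
  shows "comm (vv \<alpha> \<beta>) (pp i j) = 0"
proof -
  have "comm (vv \<alpha> \<beta>) (\<Sum>\<gamma>\<in>{1..m}. a \<gamma> j * d \<gamma> i)
    = (\<Sum>\<gamma>\<in>{1..m}. (if \<beta> = \<gamma> then a \<alpha> j * d \<beta> i else 0) - (if \<alpha> = \<gamma> then a \<alpha> j * d \<beta> i else 0))"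
    unfolding comm_sum comm_mult
    by (intro sum.cong refl) (use assms in \<open>auto simp: comm_vv_a comm_vv_d\<close>)
  also have "\<dots> = 0"
    using assms by (simp add: sum_subtractf)
  finally show ?thesis
    by (simp add: pp_def comm_diff) (simp add: vv_def comm_sum comm_l)
qed

lemma comm_pp_pp:
  assumes "i \<in> {1..n}" "j \<in> {1..n}" "k \<in> {1..n}" "p \<in> {1..n}"
  shows "comm (pp i j) (pp k p) = (if j = k then pp i p else 0) - (if i = p then pp k j else 0)"
proof -
  have "comm (pp i j) (\<Sum>\<gamma>\<in>{1..m}. a \<gamma> p * d \<gamma> k)
    = (\<Sum>\<gamma>\<in>{1..m}. (if j = k then a \<gamma> p * d \<gamma> i else 0) - (if i = p then a \<gamma> j * d \<gamma> k else 0))"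
    unfolding comm_sum comm_mult
    by (intro sum.cong refl) (auto simp: comm_pp_a comm_pp_d)
  moreover have "comm (pp i j) (l k p) = (if j = k then l i p else 0) - (if i = p then l k j else 0)"
  proof -
    have "comm (pp i j) (l k p) = comm (l i j) (l k p)"
      by (simp add: pp_def comm_diff comm_sum comm_l)
    then show ?thesis
      using l_l[OF assms] by (simp only: comm_def)
  qed
  ultimately show ?thesis
    unfolding pp_def[of k p] comm_diff
    by (auto simp: pp_def sum_subtractf)
qed

lemma comm_vv_pv:
  assumes "\<alpha> \<in> {1..m}" "\<beta> \<in> {1..m}" "i \<in> {1..n}"
  shows "comm (vv \<alpha> \<beta>) (pv i \<gamma>) = - (if \<alpha> = \<gamma> then pv i \<beta> else 0)"
proof -
  have "comm (vv \<alpha> \<beta>) (pv i \<gamma>) = (\<Sum>k\<in>{1..n}. - (if \<alpha> = \<gamma> then pp i k * d \<beta> k else 0))"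
    unfolding pv_def comm_sum comm_mult
    by (intro sum.cong refl) (use assms in \<open>auto simp: comm_vv_pp comm_vv_d\<close>)
  then show ?thesis
    by (simp add: pv_def sum_negf)
qed

lemma comm_pp_pv:
  assumes "\<alpha> \<in> {1..m}" "i \<in> {1..n}" "j \<in> {1..n}" "k \<in> {1..n}"
  shows "comm (pp j k) (pv i \<alpha>) = (if k = i then pv j \<alpha> else 0)"
proof -
  have "comm (pp j k) (pv i \<alpha>)
    = (\<Sum>p\<in>{1..n}. (if k = i then pp j p * d \<alpha> p else 0) - (if j = p then pp i k * d \<alpha> j else 0)
        + (if k = p then pp i k * d \<alpha> j else 0))"
    unfolding pv_def comm_sum comm_mult
    by (intro sum.cong refl) (use assms in \<open>auto simp: comm_pp_pp comm_pp_d algebra_simps\<close>)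
  then show ?thesis
    using assms by (simp add: pv_def sum_subtractf sum.distrib)
qed

lemma pv_a:
  assumes "\<alpha> \<in> {1..m}" "\<beta> \<in> {1..m}" "i \<in> {1..n}" "j \<in> {1..n}"
  shows "pv i \<alpha> * a \<beta> j + a \<beta> j * pv i \<alpha> = (if \<alpha> = \<beta> then pp i j else 0) + (if i = j then vv \<beta> \<alpha> else 0)"
proof -
  have "pv i \<alpha> * a \<beta> j + a \<beta> j * pv i \<alpha>
    = (\<Sum>k\<in>{1..n}. (if k = j then (if \<alpha> = \<beta> then pp i j else 0) else 0) + (if i = j then a \<beta> k * d \<alpha> k else 0))"
    unfolding pv_def sum_distrib_left sum_distrib_right sum.distrib[symmetric]
  proof (intro sum.cong refl)
    fix k
    have "a \<beta> j * pp i k = pp i k * a \<beta> j + (if i = j then a \<beta> k else 0)"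
      using comm_pp_a[OF assms(2), of i k j] by (simp add: comm_def algebra_simps split: if_splits)
    then have "a \<beta> j * (pp i k * d \<alpha> k) = pp i k * (a \<beta> j * d \<alpha> k) + (if i = j then a \<beta> k * d \<alpha> k else 0)"
      by (auto simp: mult.assoc[symmetric] distrib_right)
    moreover have "pp i k * d \<alpha> k * a \<beta> j = - (pp i k * (a \<beta> j * d \<alpha> k)) + (if k = j then (if \<alpha> = \<beta> then pp i j else 0) else 0)"
      by (auto simp: mult.assoc d_a distrib_left right_diff_distrib)
    ultimately show "pp i k * d \<alpha> k * a \<beta> j + a \<beta> j * (pp i k * d \<alpha> k)
      = (if k = j then (if \<alpha> = \<beta> then pp i j else 0) else 0) + (if i = j then a \<beta> k * d \<alpha> k else 0)"
      by simp
  qed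
  then show ?thesis
    using assms by (simp add: vv_def sum.distrib)
qed

text \<open>Both products are brought to the form \<open>pp pp d d\<close>. The commutator of the two \<open>pp\<close> then cancels the terms
that arose from moving \<open>d\<close> past \<open>pp\<close>.\<close>

lemma pv_pv:
  assumes "\<alpha> \<in> {1..m}" "\<beta> \<in> {1..m}" "i \<in> {1..n}" "j \<in> {1..n}"
  shows "pv i \<alpha> * pv j \<beta> + pv j \<beta> * pv i \<alpha> = 0"
proof -
  have swap: "d \<gamma> k * pp x p = pp x p * d \<gamma> k - (if p = k then d \<gamma> x else 0)" if "\<gamma> \<in> {1..m}" for \<gamma> k x p
    using comm_pp_d[OF that, of x p k] by (simp add: comm_def algebra_simps split: if_splits)
  have 1: "pv i \<alpha> * pv j \<beta> = (\<Sum>k\<in>{1..n}. \<Sum>p\<in>{1..n}. pp i k * pp j p * (d \<alpha> k * d \<beta> p)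
      - (if p = k then pp i k * (d \<alpha> j * d \<beta> k) else 0))"
  proof -
    have summand: "pp i k * d \<alpha> k * (pp j p * d \<beta> p) = pp i k * pp j p * (d \<alpha> k * d \<beta> p)
      - (if p = k then pp i k * (d \<alpha> j * d \<beta> k) else 0)" for k p
    proof -
      have "pp i k * d \<alpha> k * (pp j p * d \<beta> p) = pp i k * (d \<alpha> k * pp j p) * d \<beta> p"
        by (simp add: mult.assoc)
      then show ?thesis
        unfolding swap[OF assms(1)] by (auto simp: algebra_simps)
    qed
    show ?thesis
      unfolding pv_def sum_product summand ..
  qed
  have 2: "pv j \<beta> * pv i \<alpha> = (\<Sum>k\<in>{1..n}. \<Sum>p\<in>{1..n}. - (pp j p * pp i k * (d \<alpha> k * d \<beta> p))
      + (if k = p then pp j p * (d \<alpha> p * d \<beta> i) else 0))"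
  proof -
    have summand: "pp j p * d \<beta> p * (pp i k * d \<alpha> k) = - (pp j p * pp i k * (d \<alpha> k * d \<beta> p))
      + (if k = p then pp j p * (d \<alpha> p * d \<beta> i) else 0)" for k p
    proof -
      have "pp j p * d \<beta> p * (pp i k * d \<alpha> k) = pp j p * (d \<beta> p * pp i k) * d \<alpha> k"
        by (simp add: mult.assoc)
      also have "\<dots> = pp j p * pp i k * (d \<beta> p * d \<alpha> k) - (if k = p then pp j p * (d \<beta> i * d \<alpha> p) else 0)"
        unfolding swap[OF assms(2)] by (auto simp: algebra_simps)
      finally show ?thesis
        unfolding d_d[of \<beta> p \<alpha> k] d_d[of \<beta> i \<alpha> p] by auto
    qed
    have "pv j \<beta> * pv i \<alpha> = (\<Sum>p\<in>{1..n}. \<Sum>k\<in>{1..n}. pp j p * d \<beta> p * (pp i k * d \<alpha> k))"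
      by (simp add: pv_def sum_product)
    also have "\<dots> = (\<Sum>k\<in>{1..n}. \<Sum>p\<in>{1..n}. pp j p * d \<beta> p * (pp i k * d \<alpha> k))"
      by (rule sum.swap)
    finally show ?thesis
      unfolding summand .
  qed
  have "pv i \<alpha> * pv j \<beta> + pv j \<beta> * pv i \<alpha>
    = (\<Sum>k\<in>{1..n}. \<Sum>p\<in>{1..n}. comm (pp i k) (pp j p) * (d \<alpha> k * d \<beta> p)
        - (if p = k then pp i k * (d \<alpha> j * d \<beta> k) else 0) + (if k = p then pp j p * (d \<alpha> p * d \<beta> i) else 0))"
    unfolding 1 2 sum.distrib[symmetric] by (intro sum.cong refl) (simp add: comm_def algebra_simps)
  also have "\<dots> = (\<Sum>k\<in>{1..n}. \<Sum>p\<in>{1..n}.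
        (if k = j then pp i p * (d \<alpha> j * d \<beta> p) else 0) - (if i = p then pp j k * (d \<alpha> k * d \<beta> i) else 0)
        - (if p = k then pp i k * (d \<alpha> j * d \<beta> k) else 0) + (if k = p then pp j p * (d \<alpha> p * d \<beta> i) else 0))"
    by (intro sum.cong refl) (use assms in \<open>auto simp: comm_pp_pp algebra_simps\<close>)
  also have "\<dots> = (\<Sum>p\<in>{1..n}. pp i p * (d \<alpha> j * d \<beta> p)) - (\<Sum>k\<in>{1..n}. pp j k * (d \<alpha> k * d \<beta> i))
      - (\<Sum>k\<in>{1..n}. pp i k * (d \<alpha> j * d \<beta> k)) + (\<Sum>k\<in>{1..n}. pp j k * (d \<alpha> k * d \<beta> i))"
  proof -
    have "(\<Sum>k\<in>{1..n}. \<Sum>p\<in>{1..n}. if k = j then pp i p * (d \<alpha> j * d \<beta> p) else 0)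
      = (\<Sum>p\<in>{1..n}. pp i p * (d \<alpha> j * d \<beta> p))"
      using assms by (subst sum.swap) simp
    then show ?thesis
      using assms by (simp add: sum.distrib sum_subtractf)
  qed
  finally show ?thesis
    by simp
qed

fun F :: "symbol \<Rightarrow> symbol \<Rightarrow> 'r" where
  "F (Virt \<alpha>) (Virt \<beta>) = vv \<alpha> \<beta>"
| "F (Virt \<alpha>) (Proper i) = a \<alpha> i"
| "F (Proper i) (Virt \<alpha>) = pv i \<alpha>"
| "F (Proper i) (Proper j) = pp i j"

lemma F_super_commute:
  assumes "x \<in> symbols m n" "y \<in> symbols m n" "z \<in> symbols m n" "w \<in> symbols m n"
  shows "F x y * F z w = (- 1) ^ ((parity x + parity y) * (parity z + parity w)) * (F z w * F x y)
        + (if y = z then F x w else 0)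
        - (- 1) ^ ((parity x + parity y) * (parity z + parity w)) * (if x = w then F z y else 0)"
proof -
  have sym: "Virt \<alpha> \<in> symbols m n \<longleftrightarrow> \<alpha> \<in> {1..m}" "Proper i \<in> symbols m n \<longleftrightarrow> i \<in> {1..n}" for \<alpha> i
    by (auto simp: symbols_def)
  have c: "u * v = v * u + w" if "comm u v = w" for u v w
    using that by (auto simp: comm_def)
  have c': "v * u = u * v - w" if "comm u v = w" for u v w
    using that by (auto simp: comm_def)
  have s: "u * v = - (v * u) + w" if "u * v + v * u = w" for u v w :: 'r
    using that by (auto simp: algebra_simps)
  have s': "u * v = - (v * u) + w" if "v * u + u * v = w" for u v w :: 'r
    using that by (auto simp: algebra_simps)
  note sym [simp]
  show ?thesis
    using assms
    apply (cases x; cases y; cases z; cases w)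
    subgoal premises prems for A B C D
      using c[OF comm_vv_vv[of A B C D]] prems by (simp add: add.commute)
    subgoal premises prems for A B C D
      using c[OF comm_vv_a[of D A B C]] prems by (simp add: add.commute)
    subgoal premises prems for A B C D
      using c[OF comm_vv_pv[of A B C D]] prems by (simp add: add.commute)
    subgoal premises prems for A B C D
      using c[OF comm_vv_pp[of A B C D]] prems by (simp add: add.commute)
    subgoal premises prems for A B C D
      using c'[OF comm_vv_a[of B C D A]] prems by (simp add: add.commute)
    subgoal premises prems for A B C D
      using a_a[of A B C D] prems by (simp add: add.commute)
    subgoal premises prems for A B C D
      using s'[OF pv_a[of D A C B]] prems by (simp add: algebra_simps)
    subgoal premises prems for A B C D
      using c'[OF comm_pp_a[of A C D B]] prems by (simp add: add.commute)
    subgoal premises prems for A B C D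
      using c'[OF comm_vv_pv[of C D A B]] prems by (simp add: add.commute)
    subgoal premises prems for A B C D
      using s[OF pv_a[of B C A D]] prems by (simp add: algebra_simps)
    subgoal premises prems for A B C D
      using s[OF pv_pv[of B D A C]] prems by (simp add: add.commute)
    subgoal premises prems for A B C D
      using c'[OF comm_pp_pv[of B A C D]] prems by (simp add: add.commute)
    subgoal premises prems for A B C D
      using c'[OF comm_vv_pp[of C D A B]] prems by (simp add: add.commute)
    subgoal premises prems for A B C D
      using c[OF comm_pp_a[of C A B D]] prems by (simp add: add.commute)
    subgoal premises prems for A B C D
      using c[OF comm_pp_pv[of D C A B]] prems by (simp add: add.commute)
    subgoal premises prems for A B C D
      using c[OF comm_pp_pp[of A B C D]] prems by (simp add: add.commute)
    done
qed

end

section \<open>Evaluating noncommutative polynomials\<close>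

lemma free_algebra_induct [case_names zero single add]:
  assumes "P 0" "\<And>w c. P (Poly_Mapping.single w c)" "\<And>f g. P f \<Longrightarrow> P g \<Longrightarrow> P (f + g)"
  shows "P (f :: 'x free_algebra)"
proof (induction f rule: update_induct)
  case (update f w c)
  have "Poly_Mapping.update w c f = f + Poly_Mapping.single w c"
    using update(1) by (intro poly_mapping_eqI) (auto simp: lookup_update lookup_add lookup_single in_keys_iff)
  with update(3) assms(2,3) show ?case by simp
qed (rule assms(1))

definition eval :: "(complex \<Rightarrow> 'r::ring_1) \<Rightarrow> ('x \<Rightarrow> 'r) \<Rightarrow> 'x free_algebra \<Rightarrow> 'r"
  where "eval \<kappa> \<phi> f = (\<Sum>w\<in>Poly_Mapping.keys f. \<kappa> (Poly_Mapping.lookup f w) * prod_list (map \<phi> (letters w)))"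

lemma letters_zero: "letters 0 = []"
  by (simp add: zero_fword_def)

text \<open>The universal property of the free algebra, for a target ring whose scalars \<open>\<kappa>\<close> need to commute with the
images of the generators only.\<close>

locale evaluation =
  fixes \<kappa> :: "complex \<Rightarrow> 'r::ring_1" and \<phi> :: "'x \<Rightarrow> 'r"
  assumes scalar_add: "\<kappa> (c + d) = \<kappa> c + \<kappa> d"
    and scalar_mult: "\<kappa> (c * d) = \<kappa> c * \<kappa> d"
    and scalar_one: "\<kappa> 1 = 1"
    and scalar_commute: "\<kappa> c * \<phi> x = \<phi> x * \<kappa> c"
begin

lemma scalar_zero: "\<kappa> 0 = 0"
  using scalar_add[of 0 0] by simp

lemma eval_superset:
  assumes "finite A" "Poly_Mapping.keys f \<subseteq> A"
  shows "eval \<kappa> \<phi> f = (\<Sum>w\<in>A. \<kappa> (Poly_Mapping.lookup f w) * prod_list (map \<phi> (letters w)))"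
  unfolding eval_def using assms
  by (intro sum.mono_neutral_left) (auto simp: in_keys_iff scalar_zero)

lemma eval_add: "eval \<kappa> \<phi> (f + g) = eval \<kappa> \<phi> f + eval \<kappa> \<phi> g"
proof -
  let ?A = "Poly_Mapping.keys f \<union> Poly_Mapping.keys g"
  have "finite ?A" "Poly_Mapping.keys (f + g) \<subseteq> ?A"
    using keys_add[of f g] by auto
  then show ?thesis
    by (simp add: eval_superset[of ?A] lookup_add scalar_add distrib_right sum.distrib)
qed

lemma eval_zero: "eval \<kappa> \<phi> 0 = 0"
  by (simp add: eval_def)

lemma eval_uminus: "eval \<kappa> \<phi> (- f) = - eval \<kappa> \<phi> f"
  using eval_add[of f "- f"] by (simp add: eval_zero eq_neg_iff_add_eq_0 add.commute)

lemma eval_diff: "eval \<kappa> \<phi> (f - g) = eval \<kappa> \<phi> f - eval \<kappa> \<phi> g"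
  using eval_add[of f "- g"] by (simp add: eval_uminus)

lemma eval_single: "eval \<kappa> \<phi> (Poly_Mapping.single w c) = \<kappa> c * prod_list (map \<phi> (letters w))"
  by (simp add: eval_def scalar_zero)

lemma eval_const: "eval \<kappa> \<phi> (const c) = \<kappa> c"
  by (simp add: const_def eval_single letters_zero)

lemma eval_one: "eval \<kappa> \<phi> 1 = 1"
  using eval_single[of 0 1] by (simp add: scalar_one letters_zero)

lemma eval_gen: "eval \<kappa> \<phi> (gen x) = \<phi> x"
  by (simp add: gen_def eval_single scalar_one)

lemma scalar_prod_list_commute: "\<kappa> c * prod_list (map \<phi> xs) = prod_list (map \<phi> xs) * \<kappa> c"
proof (induction xs)
  case (Cons x xs)
  have "\<kappa> c * prod_list (map \<phi> (x # xs)) = (\<kappa> c * \<phi> x) * prod_list (map \<phi> xs)"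
    by (simp add: mult.assoc)
  also have "\<dots> = \<phi> x * (\<kappa> c * prod_list (map \<phi> xs))"
    by (simp only: scalar_commute mult.assoc)
  finally show ?case
    by (simp add: Cons.IH mult.assoc)
qed simp

lemma eval_mult: "eval \<kappa> \<phi> (f * g) = eval \<kappa> \<phi> f * eval \<kappa> \<phi> g"
proof (induction f rule: free_algebra_induct)
  case (single v c)
  show ?case
  proof (induction g rule: free_algebra_induct)
    case (single w d)
    have "\<kappa> d * prod_list (map \<phi> (letters v)) = prod_list (map \<phi> (letters v)) * \<kappa> d"
      by (rule scalar_prod_list_commute)
    then have "\<kappa> c * (\<kappa> d * prod_list (map \<phi> (letters v)) * prod_list (map \<phi> (letters w)))
        = \<kappa> c * (prod_list (map \<phi> (letters v)) * \<kappa> d * prod_list (map \<phi> (letters w)))"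
      by simp
    then show ?case
      by (simp add: mult_single eval_single scalar_mult plus_fword_def mult.assoc)
  qed (simp_all add: eval_zero eval_add distrib_left)
qed (simp_all add: eval_zero eval_add distrib_right)

lemma eval_prod_gen: "eval \<kappa> \<phi> (prod_list (map gen xs)) = prod_list (map \<phi> xs)"
  by (induction xs) (simp_all add: eval_one eval_mult eval_gen)

end

lemma prod_list_gen: "prod_list (map gen xs) = Poly_Mapping.single (FWord xs) 1"
  by (induction xs) (simp_all add: gen_def mult_single plus_fword_def zero_fword_def[symmetric])

lemma single_eq_const_mult: "Poly_Mapping.single w c = const c * prod_list (map gen (letters w))"
  by (simp add: prod_list_gen const_def mult_single)

lemma const_mult_commute: "const c * f = f * const c"
  by (induction f rule: free_algebra_induct)
    (simp_all add: const_def mult_single distrib_left distrib_right mult.commute)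

lemma const_simps: "const (c + d) = const c + const d" "const (c * d) = const c * const d" "const 1 = 1"
    "const (- c) = - const c"
  by (simp_all add: const_def single_add mult_single single_uminus)

section \<open>The enveloping algebras as one ring\<close>

abbreviation fa :: "nat \<Rightarrow> nat \<Rightarrow> (symbol \<times> symbol) free_algebra ring"
  where "fa m n \<equiv> free_alg (symbols m n \<times> symbols m n)"

interpretation fa: ring "fa m n" for m n
  by (rule ring_free_alg)

lemma fa_simps [simp]:
  "f \<oplus>\<^bsub>fa m n\<^esub> g = f + g" "f \<otimes>\<^bsub>fa m n\<^esub> g = f * g" "\<zero>\<^bsub>fa m n\<^esub> = 0" "\<one>\<^bsub>fa m n\<^esub> = 1"
  by (simp_all add: free_alg_def)

lemma fa_closed [simp]:
  "f \<in> carrier (fa m n) \<Longrightarrow> g \<in> carrier (fa m n) \<Longrightarrow> f + g \<in> carrier (fa m n)"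
  "f \<in> carrier (fa m n) \<Longrightarrow> g \<in> carrier (fa m n) \<Longrightarrow> f * g \<in> carrier (fa m n)"
  "f \<in> carrier (fa m n) \<Longrightarrow> - f \<in> carrier (fa m n)"
  "0 \<in> carrier (fa m n)" "1 \<in> carrier (fa m n)" "const c \<in> carrier (fa m n)"
proof -
  show "f \<in> carrier (fa m n) \<Longrightarrow> g \<in> carrier (fa m n) \<Longrightarrow> f + g \<in> carrier (fa m n)"
    using fa.a_closed[of f m n g] by simp
  show "f \<in> carrier (fa m n) \<Longrightarrow> g \<in> carrier (fa m n) \<Longrightarrow> f * g \<in> carrier (fa m n)"
    using fa.m_closed[of f m n g] by simp
  show "f \<in> carrier (fa m n) \<Longrightarrow> - f \<in> carrier (fa m n)"
    by (simp add: free_alg_def)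
  show "0 \<in> carrier (fa m n)" "1 \<in> carrier (fa m n)"
    using fa.zero_closed[of m n] fa.one_closed[of m n] by simp_all
  show "const c \<in> carrier (fa m n)"
    by (simp add: free_alg_def const_def letters_zero)
qed

lemma fa_closed_diff [simp]:
  "f \<in> carrier (fa m n) \<Longrightarrow> g \<in> carrier (fa m n) \<Longrightarrow> f - g \<in> carrier (fa m n)"
  using fa_closed(1)[of f m n "- g"] by simp

lemma fa_closed_gen [simp]: "gen x \<in> carrier (fa m n) \<longleftrightarrow> x \<in> symbols m n \<times> symbols m n"
  by (auto simp: free_alg_def gen_def)

lemma fa_closed_prod_gen: "set xs \<subseteq> symbols m n \<times> symbols m n \<Longrightarrow> prod_list (map gen xs) \<in> carrier (fa m n)"
  by (induction xs) (simp_all del: mem_Times_iff)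

lemma fa_minus [simp]: "f \<in> carrier (fa m n) \<Longrightarrow> \<ominus>\<^bsub>fa m n\<^esub> f = - f"
  by (rule fa.minus_equality) simp_all

definition relators :: "nat \<Rightarrow> nat \<Rightarrow> (symbol \<times> symbol) free_algebra set"
  where "relators m n = {gen x * gen y - const (koszul x y) * gen y * gen x - superbracket x y | x y.
         x \<in> symbols m n \<times> symbols m n \<and> y \<in> symbols m n \<times> symbols m n}"

lemma relators_closed: "relators m n \<subseteq> carrier (fa m n)"
  by (auto simp: relators_def superbracket_def)

lemma env_ideal_eq: "env_ideal m n = genideal (fa m n) (relators m n)"
  by (simp add: env_ideal_def relators_def)

lemma ideal_env_ideal: "ideal (env_ideal m n) (fa m n)"
  unfolding env_ideal_eq by (rule fa.genideal_ideal[OF relators_closed])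

lemma zero_in_env_ideal: "0 \<in> env_ideal m n"
  using additive_subgroup.zero_closed[OF ideal.axioms(1)[OF ideal_env_ideal[of m n]]] by simp

interpretation env: ring "env m n" for m n
  unfolding env_def by (rule ideal.quotient_is_ring[OF ideal_env_ideal])

interpretation env_class: ring_hom_ring "fa m n" "env m n" "env_class m n" for m n
  using ideal.rcos_ring_hom_ring[OF ideal_env_ideal[of m n]] unfolding env_def env_class_def[abs_def] .

lemma carrier_env: "carrier (env m n) = env_class m n ` carrier (fa m n)"
  unfolding env_def env_class_def[abs_def] FactRing_def A_RCOSETS_def' by auto

lemma env_class_simps:
  "f \<in> carrier (fa m n) \<Longrightarrow> g \<in> carrier (fa m n) \<Longrightarrow> env_class m n (f + g) = env_class m n f \<oplus>\<^bsub>env m n\<^esub> env_class m n g"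
  "f \<in> carrier (fa m n) \<Longrightarrow> g \<in> carrier (fa m n) \<Longrightarrow> env_class m n (f * g) = env_class m n f \<otimes>\<^bsub>env m n\<^esub> env_class m n g"
  "env_class m n 1 = \<one>\<^bsub>env m n\<^esub>" "env_class m n 0 = \<zero>\<^bsub>env m n\<^esub>"
  "f \<in> carrier (fa m n) \<Longrightarrow> env_class m n (- f) = \<ominus>\<^bsub>env m n\<^esub> env_class m n f"
  using env_class.hom_add[of f m n g] env_class.hom_mult[of f m n g] env_class.hom_one[of m n]
    env_class.hom_zero[of m n] env_class.hom_a_inv[of f m n] by simp_all

lemma env_class_eq_iff:
  assumes "f \<in> carrier (fa m n)" "g \<in> carrier (fa m n)"
  shows "env_class m n f = env_class m n g \<longleftrightarrow> f - g \<in> env_ideal m n"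
proof -
  have "f \<ominus>\<^bsub>fa m n\<^esub> g = f - g"
    using assms by (simp add: a_minus_def)
  then show ?thesis
    using fa.quotient_eq_iff_same_a_r_cos[OF ideal_env_ideal assms] by (simp add: env_class_def)
qed

lemma env_class_eq_zero_iff: "f \<in> carrier (fa m n) \<Longrightarrow> env_class m n f = \<zero>\<^bsub>env m n\<^esub> \<longleftrightarrow> f \<in> env_ideal m n"
  using env_class_eq_iff[of f m n 0] by (simp add: env_class_simps)

text \<open>The factor without any symbols is the field of complex numbers, which shows that the product is not the
zero ring.\<close>

lemma env_ideal_00: "env_ideal 0 0 = {0}"
proof -
  have "relators 0 0 = {}"
    by (auto simp: relators_def symbols_def)
  moreover have "genideal (fa 0 0) {} \<subseteq> {\<zero>\<^bsub>fa 0 0\<^esub>}"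
    by (rule fa.genideal_minimal[OF fa.zeroideal]) simp
  ultimately show ?thesis
    using zero_in_env_ideal[of 0 0] by (auto simp: env_ideal_eq)
qed

lemma env_00_nontrivial: "\<zero>\<^bsub>env 0 0\<^esub> \<noteq> \<one>\<^bsub>env 0 0\<^esub>"
  using env_class_eq_zero_iff[of 1 0 0] by (auto simp: env_class_simps env_ideal_00)

text \<open>The rings \<open>env m n\<close> live on sets that depend on \<open>m\<close> and \<open>n\<close>. Their product over all \<open>m\<close> and \<open>n\<close> is a type,
which makes the preceding results about rings of a type class applicable; \<open>component\<close> is the projection
to a factor and \<open>only_at\<close> the inclusion of a factor.\<close>

typedef uea = "{h. \<forall>m n. h m n \<in> carrier (env m n)}"
  morphisms component Uea
  by (rule exI[of _ "\<lambda>m n. \<zero>\<^bsub>env m n\<^esub>"]) simp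

setup_lifting type_definition_uea

lemma component_closed [simp]: "component x m n \<in> carrier (env m n)"
  using component[of x] by simp

lemma uea_eqI: "(\<And>m n. component x m n = component y m n) \<Longrightarrow> x = y"
  by (simp add: component_inject[symmetric] fun_eq_iff)

instantiation uea :: ring_1
begin

lift_definition zero_uea :: uea is "\<lambda>m n. \<zero>\<^bsub>env m n\<^esub>" by simp
lift_definition one_uea :: uea is "\<lambda>m n. \<one>\<^bsub>env m n\<^esub>" by simp
lift_definition plus_uea :: "uea \<Rightarrow> uea \<Rightarrow> uea" is "\<lambda>x y m n. x m n \<oplus>\<^bsub>env m n\<^esub> y m n" by simp
lift_definition times_uea :: "uea \<Rightarrow> uea \<Rightarrow> uea" is "\<lambda>x y m n. x m n \<otimes>\<^bsub>env m n\<^esub> y m n" by simp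
lift_definition uminus_uea :: "uea \<Rightarrow> uea" is "\<lambda>x m n. \<ominus>\<^bsub>env m n\<^esub> x m n" by simp
lift_definition minus_uea :: "uea \<Rightarrow> uea \<Rightarrow> uea" is "\<lambda>x y m n. x m n \<ominus>\<^bsub>env m n\<^esub> y m n" by simp

instance
proof
  fix x y z :: uea
  show "0 \<noteq> (1 :: uea)"
    by transfer (metis env_00_nontrivial)
  show "x + y + z = x + (y + z)"
    by transfer (simp add: env.a_assoc)
  show "x + y = y + x"
    by transfer (simp add: env.a_comm)
  show "(x + y) * z = x * z + y * z"
    by transfer (simp add: env.l_distr)
  show "x * (y + z) = x * y + x * z"
    by transfer (simp add: env.r_distr)
  show "- x + x = 0"
    by transfer (simp add: env.l_neg)
  show "x - y = x + - y"
    by transfer (simp add: a_minus_def)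
  show "x * y * z = x * (y * z)"
    by transfer (simp add: env.m_assoc)
qed (transfer; simp; fail)+

end

lemma component_simps [simp]:
  "component 0 m n = \<zero>\<^bsub>env m n\<^esub>" "component 1 m n = \<one>\<^bsub>env m n\<^esub>"
  "component (x + y) m n = component x m n \<oplus>\<^bsub>env m n\<^esub> component y m n"
  "component (x * y) m n = component x m n \<otimes>\<^bsub>env m n\<^esub> component y m n"
  "component (- x) m n = \<ominus>\<^bsub>env m n\<^esub> component x m n"
  "component (x - y) m n = component x m n \<ominus>\<^bsub>env m n\<^esub> component y m n"
  by (transfer; simp)+

lemma component_sum: "component (sum f A) m n = (\<Oplus>\<^bsub>env m n\<^esub>a\<in>A. component (f a) m n)"
  by (induction A rule: infinite_finite_induct) simp_all

lemma component_prod_list: "component (prod_list xs) m n = lprod (env m n) (map (\<lambda>x. component x m n) xs)"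
  by (induction xs) (simp_all add: lprod_def)

lemma component_of_nat_mult: "component (of_nat k * x) m n = [k] \<cdot>\<^bsub>env m n\<^esub> component x m n"
proof (induction k)
  case (Suc k)
  have "component (of_nat (Suc k) * x) m n = component x m n \<oplus>\<^bsub>env m n\<^esub> component (of_nat k * x) m n"
    by (simp only: of_nat_Suc distrib_right mult_1_left component_simps)
  also have "\<dots> = [Suc k] \<cdot>\<^bsub>env m n\<^esub> component x m n"
    unfolding Suc.IH by (simp add: env.a_comm)
  finally show ?case .
qed simp

lemma component_of_int_mult: "component (of_int k * x) m n = [k] \<cdot>\<^bsub>env m n\<^esub> component x m n"
proof (cases "0 \<le> k")
  case True
  then show ?thesis
    using component_of_nat_mult[of "nat k" x m n] by (simp add: add_pow_int_ge)
next
  case False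
  then have "of_int k * x = - (of_nat (nat (- k)) * x)"
    by simp
  with False show ?thesis
    by (simp only: component_simps(5) component_of_nat_mult add_pow_int_lt not_le)
qed

lift_definition scalar :: "complex \<Rightarrow> uea" is "\<lambda>c m n. env_class m n (const c)"
  by (simp add: carrier_env)

lift_definition only_at :: "nat \<Rightarrow> nat \<Rightarrow> (symbol \<times> symbol) free_algebra set \<Rightarrow> uea"
  is "\<lambda>m n z m' n'. if m' = m \<and> n' = n \<and> z \<in> carrier (env m n) then z else \<zero>\<^bsub>env m' n'\<^esub>"
  by simp

lemma component_scalar: "component (scalar c) m n = env_class m n (const c)"
  by transfer simp

lemma component_only_at: "component (only_at m n z) m' n'
    = (if m' = m \<and> n' = n \<and> z \<in> carrier (env m n) then z else \<zero>\<^bsub>env m' n'\<^esub>)"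
  by transfer simp

lemma component_only_at_same: "z \<in> carrier (env m n) \<Longrightarrow> component (only_at m n z) m n = z"
  by (simp add: component_only_at)

lemma only_at_simps:
  "only_at m n \<zero>\<^bsub>env m n\<^esub> = 0"
  "z \<in> carrier (env m n) \<Longrightarrow> w \<in> carrier (env m n) \<Longrightarrow> only_at m n (z \<oplus>\<^bsub>env m n\<^esub> w) = only_at m n z + only_at m n w"
  "z \<in> carrier (env m n) \<Longrightarrow> w \<in> carrier (env m n) \<Longrightarrow> only_at m n (z \<otimes>\<^bsub>env m n\<^esub> w) = only_at m n z * only_at m n w"
  "z \<in> carrier (env m n) \<Longrightarrow> only_at m n (\<ominus>\<^bsub>env m n\<^esub> z) = - only_at m n z"
  by (rule uea_eqI; simp add: component_only_at)+

lemma env_class_closed [simp]: "f \<in> carrier (fa m n) \<Longrightarrow> env_class m n f \<in> carrier (env m n)"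
  by (simp add: carrier_env)

lemma scalar_simps: "scalar (c + d) = scalar c + scalar d" "scalar (c * d) = scalar c * scalar d" "scalar 1 = 1"
  by (rule uea_eqI; simp add: component_scalar const_simps env_class_simps)+

lemma scalar_central: "scalar c * x = x * scalar c"
proof (rule uea_eqI)
  fix m n
  obtain f where f: "f \<in> carrier (fa m n)" "component x m n = env_class m n f"
    using component_closed[of x m n] by (auto simp: carrier_env)
  have "env_class m n (const c) \<otimes>\<^bsub>env m n\<^esub> env_class m n f = env_class m n f \<otimes>\<^bsub>env m n\<^esub> env_class m n (const c)"
    using f(1) const_mult_commute[of c f] by (simp add: env_class_simps(2)[symmetric])
  then show "component (scalar c * x) m n = component (x * scalar c) m n"
    by (simp add: component_scalar f(2))
qed

text \<open>All factors contain the scalar \<open>1 / 2\<close>.\<close>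

lemma uea_torsion_free: "x + x = 0 \<Longrightarrow> x = 0" for x :: uea
proof -
  assume "x + x = 0"
  moreover have "scalar (1 / 2) + scalar (1 / 2) = 1"
    by (simp add: scalar_simps(1,3)[symmetric])
  then have "x = scalar (1 / 2) * (x + x)"
    by (metis distrib_left distrib_right mult_1)
  ultimately show "x = 0" by simp
qed

definition egen :: "nat \<Rightarrow> nat \<Rightarrow> symbol \<Rightarrow> symbol \<Rightarrow> uea"
  where "egen m n a b = only_at m n (env_class m n (gen (a, b)))"

lemma component_egen:
  "a \<in> symbols m n \<Longrightarrow> b \<in> symbols m n \<Longrightarrow> component (egen m n a b) m n = e m n a b"
  by (simp add: egen_def component_only_at e_def carrier_env)

lemma egen_super_commute:
  assumes "a \<in> symbols m n" "b \<in> symbols m n" "c \<in> symbols m n" "d \<in> symbols m n"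
  shows "egen m n a b * egen m n c d
    = (- 1) ^ ((parity a + parity b) * (parity c + parity d)) * (egen m n c d * egen m n a b)
        + (if b = c then egen m n a d else 0)
        - (- 1) ^ ((parity a + parity b) * (parity c + parity d)) * (if a = d then egen m n c b else 0)"
    (is "?lhs = ?rhs")
proof -
  define k where "k = (parity a + parity b) * (parity c + parity d)"
  define L where "L f = only_at m n (env_class m n f)" for f
  have L_add: "L (f + g) = L f + L g" and L_mult: "L (f * g) = L f * L g"
    if "f \<in> carrier (fa m n)" "g \<in> carrier (fa m n)" for f g
    using that by (simp_all add: L_def env_class_simps only_at_simps)
  have L_minus: "L (- f) = - L f" if "f \<in> carrier (fa m n)" for f
    using that by (simp add: L_def env_class_simps only_at_simps)
  have L_zero: "L f = 0" if "f \<in> env_ideal m n" for f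
    using that env_class_eq_zero_iff[of f m n] ideal.Icarr[OF ideal_env_ideal, of f m n]
    by (simp add: L_def only_at_simps)
  have L_diff: "L (f - g) = L f - L g" if "f \<in> carrier (fa m n)" "g \<in> carrier (fa m n)" for f g
    using L_add[of f "- g"] L_minus[of g] that by simp
  have L0: "L 0 = 0"
    by (rule L_zero) (use zero_in_env_ideal[of m n] in simp)
  have sign: "const (koszul (a, b) (c, d)) = (- 1) ^ k"
    by (cases "even k") (simp_all add: koszul_def k_def[symmetric] const_simps)
  have "gen (a, b) * gen (c, d) - const (koszul (a, b) (c, d)) * gen (c, d) * gen (a, b) - superbracket (a, b) (c, d) \<in> env_ideal m n"
    unfolding env_ideal_eq using assms relators_closed[of m n]
    by (intro subsetD[OF fa.genideal_self]) (auto simp: relators_def)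
  then have "L (gen (a, b) * gen (c, d) - (- 1) ^ k * gen (c, d) * gen (a, b)
      - ((if b = c then gen (a, d) else 0) - (- 1) ^ k * (if a = d then gen (c, b) else 0))) = 0"
    unfolding superbracket_def sign fst_conv snd_conv by (rule L_zero)
  then have "L (gen (a, b)) * L (gen (c, d)) - ((- 1) ^ k * (L (gen (c, d)) * L (gen (a, b)))
      + ((if b = c then L (gen (a, d)) else 0) - (- 1) ^ k * (if a = d then L (gen (c, b)) else 0))) = 0"
    using assms
    by (cases "even k"; cases "b = c"; cases "a = d")
      (simp_all add: L_diff L_add L_minus L_mult L0 algebra_simps)
  then show ?thesis
    unfolding k_def[symmetric] egen_def L_def[symmetric] by (simp only: right_minus_eq add_diff_eq)
qed

section \<open>The left ideal of irregular words\<close>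

lemma genleftideal_least:
  assumes "ring R" "J \<subseteq> carrier R" "\<zero>\<^bsub>R\<^esub> \<in> J" "\<And>x y. x \<in> J \<Longrightarrow> y \<in> J \<Longrightarrow> x \<oplus>\<^bsub>R\<^esub> y \<in> J"
    and "\<And>r x. r \<in> carrier R \<Longrightarrow> x \<in> J \<Longrightarrow> r \<otimes>\<^bsub>R\<^esub> x \<in> J" "S \<subseteq> J"
  shows "genleftideal R S \<subseteq> J"
proof -
  interpret ring R by fact
  have "\<ominus>\<^bsub>R\<^esub> x \<in> J" if "x \<in> J" for x
  proof -
    have "x \<in> carrier R"
      using that assms(2) by blast
    then have "\<ominus>\<^bsub>R\<^esub> x = (\<ominus>\<^bsub>R\<^esub> \<one>\<^bsub>R\<^esub>) \<otimes>\<^bsub>R\<^esub> x"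
      by (simp add: l_minus)
    also have "\<dots> \<in> J"
      using that by (intro assms(5)) simp_all
    finally show ?thesis .
  qed
  moreover have "inv\<^bsub>add_monoid R\<^esub> x = \<ominus>\<^bsub>R\<^esub> x" for x
    by (simp add: a_inv_def)
  ultimately have "subgroup J (add_monoid R)"
    using assms(2-4) by (intro subgroup.intro) simp_all
  then have "additive_subgroup J R"
    by (rule additive_subgroup.intro)
  then show ?thesis
    using assms(5,6) unfolding genleftideal_def by blast
qed

lemma genleftideal_closed:
  "\<zero>\<^bsub>R\<^esub> \<in> genleftideal R S"
  "x \<in> genleftideal R S \<Longrightarrow> y \<in> genleftideal R S \<Longrightarrow> x \<oplus>\<^bsub>R\<^esub> y \<in> genleftideal R S"
  "r \<in> carrier R \<Longrightarrow> x \<in> genleftideal R S \<Longrightarrow> r \<otimes>\<^bsub>R\<^esub> x \<in> genleftideal R S"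
  "S \<subseteq> genleftideal R S"
  unfolding genleftideal_def
  using additive_subgroup.zero_closed[of _ R] additive_subgroup.a_closed[of _ R x y] by blast+

interpretation gl: gl_super m n "egen m n" for m n
  by (rule gl_super.intro[OF egen_super_commute uea_torsion_free])

lemma mon_eq_env_class:
  "set ws \<subseteq> symbols m n \<times> symbols m n \<Longrightarrow> mon m n ws = env_class m n (prod_list (map gen ws))"
proof (induction ws)
  case (Cons w ws)
  then have "prod_list (map gen ws) \<in> carrier (fa m n)"
    by (intro fa_closed_prod_gen) simp
  moreover have "mon m n ws = env_class m n (prod_list (map gen ws))"
    using Cons by simp
  ultimately show ?case
    using Cons.prems by (cases w) (simp add: mon_def lprod_def e_def env_class_simps)
qed (simp add: mon_def lprod_def env_class_simps)

lemma mon_closed: "set ws \<subseteq> symbols m n \<times> symbols m n \<Longrightarrow> mon m n ws \<in> carrier (env m n)"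
  by (simp add: mon_eq_env_class fa_closed_prod_gen)

lemma component_word:
  "set ws \<subseteq> symbols m n \<times> symbols m n \<Longrightarrow> component (gl.word m n ws) m n = mon m n ws"
proof (induction ws)
  case (Cons w ws)
  then show ?case
    by (cases w) (simp add: mon_def lprod_def component_egen)
qed (simp add: mon_def lprod_def)

lemma Irr_closed:
  "\<zero>\<^bsub>env m n\<^esub> \<in> Irr m n"
  "x \<in> Irr m n \<Longrightarrow> y \<in> Irr m n \<Longrightarrow> x \<oplus>\<^bsub>env m n\<^esub> y \<in> Irr m n"
  "r \<in> carrier (env m n) \<Longrightarrow> x \<in> Irr m n \<Longrightarrow> r \<otimes>\<^bsub>env m n\<^esub> x \<in> Irr m n"
  "set ws \<subseteq> symbols m n \<times> symbols m n \<Longrightarrow> irregular m ws \<Longrightarrow> mon m n ws \<in> Irr m n"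
  unfolding Irr_def by (fact genleftideal_closed, fact genleftideal_closed(2), fact genleftideal_closed(3),
    rule subsetD[OF genleftideal_closed(4)], blast)

lemma Irr_least:
  assumes "J \<subseteq> carrier (env m n)" "\<zero>\<^bsub>env m n\<^esub> \<in> J" "\<And>x y. x \<in> J \<Longrightarrow> y \<in> J \<Longrightarrow> x \<oplus>\<^bsub>env m n\<^esub> y \<in> J"
    and "\<And>r x. r \<in> carrier (env m n) \<Longrightarrow> x \<in> J \<Longrightarrow> r \<otimes>\<^bsub>env m n\<^esub> x \<in> J"
    and "\<And>ws. set ws \<subseteq> symbols m n \<times> symbols m n \<Longrightarrow> irregular m ws \<Longrightarrow> mon m n ws \<in> J"
  shows "Irr m n \<subseteq> J"
  unfolding Irr_def
proof (rule genleftideal_least[OF env.ring_axioms assms(1-4)])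
  show "{mon m n ws |ws. set ws \<subseteq> symbols m n \<times> symbols m n \<and> irregular m ws} \<subseteq> J"
    using assms(5) by blast
qed

lemma Irr_subset_carrier: "Irr m n \<subseteq> carrier (env m n)"
  by (rule Irr_least) (auto simp: mon_closed)

text \<open>The elements \<open>x\<close> with \<open>x e\<^sub>i\<^sub>j \<in> Irr\<close> form a left ideal. It contains the irregular words, because appending
\<open>(i, j)\<close> on the right changes no count of virtual symbols.\<close>

lemma Irr_times_gl:
  assumes "i \<in> {1..n}" "j \<in> {1..n}"
  shows "x \<in> Irr m n \<Longrightarrow> x \<otimes>\<^bsub>env m n\<^esub> e m n (Proper i) (Proper j) \<in> Irr m n"
proof -
  let ?e = "e m n (Proper i) (Proper j)"
  let ?J = "{x \<in> carrier (env m n). x \<otimes>\<^bsub>env m n\<^esub> ?e \<in> Irr m n}"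
  have sym: "(Proper i, Proper j) \<in> symbols m n \<times> symbols m n"
    using assms by (simp add: gl.symbols_simps)
  then have e: "?e \<in> carrier (env m n)"
    by (simp add: e_def)
  have "Irr m n \<subseteq> ?J"
  proof (rule Irr_least)
    fix ws assume ws: "set ws \<subseteq> symbols m n \<times> symbols m n" "irregular m ws"
    have "mon m n ws \<otimes>\<^bsub>env m n\<^esub> ?e = mon m n (ws @ [(Proper i, Proper j)])"
      using ws sym by (simp add: mon_eq_env_class fa_closed_prod_gen e_def env_class_simps)
    moreover have "irregular m (ws @ [(Proper i, Proper j)])"
    proof -
      obtain us a g vs where "ws = us @ (a, Virt g) # vs" "g \<in> {1..m}"
        "length (filter (\<lambda>p. fst p = Virt g) vs) \<le> length (filter (\<lambda>p. snd p = Virt g) vs)"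
        using ws(2) unfolding irregular_iff by blast
      then show ?thesis
        unfolding irregular_iff
        by (intro exI[of _ us] exI[of _ a] exI[of _ g] exI[of _ "vs @ [(Proper i, Proper j)]"]) simp
    qed
    ultimately show "mon m n ws \<in> ?J"
      using ws sym by (auto simp: mon_closed intro!: Irr_closed(4))
  qed (use e in \<open>auto simp: Irr_closed env.l_distr env.m_assoc\<close>)
  then show "x \<in> Irr m n \<Longrightarrow> x \<otimes>\<^bsub>env m n\<^esub> ?e \<in> Irr m n"
    by blast
qed

definition irr :: "nat \<Rightarrow> nat \<Rightarrow> uea set"
  where "irr m n = {x. component x m n \<in> Irr m n}"

interpretation gl: gl_super_ideal m n "egen m n" "irr m n" for m n
proof
  fix x i j assume "x \<in> irr m n" "i \<in> {1..n}" "j \<in> {1..n}"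
  then show "x * egen m n (Proper i) (Proper j) \<in> irr m n"
    using Irr_times_gl[of i n j "component x m n" m]
    by (simp add: irr_def component_egen gl.symbols_simps)
qed (auto simp: irr_def Irr_closed component_word)

section \<open>Irregular words kill the vacuum\<close>

text \<open>The coefficients are taken from \<open>env 0 n\<close>. Without virtual symbols this is the enveloping algebra of
\<open>gl(n)\<close>, presented by its own relations.\<close>

interpretation fk: fock_rep m n "\<lambda>\<alpha> i. cre (prod_encode (\<alpha>, i))" "\<lambda>\<alpha> i. ann (prod_encode (\<alpha>, i))"
  "\<lambda>i j. lmul (egen 0 n (Proper i) (Proper j))" for m n
proof
  fix i j k p assume "i \<in> {1..n}" "j \<in> {1..n}" "k \<in> {1..n}" "p \<in> {1..n}"
  then show "lmul (egen 0 n (Proper i) (Proper j)) * lmul (egen 0 n (Proper k) (Proper p))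
      - lmul (egen 0 n (Proper k) (Proper p)) * lmul (egen 0 n (Proper i) (Proper j))
    = (if j = k then lmul (egen 0 n (Proper i) (Proper p)) else 0)
      - (if i = p then lmul (egen 0 n (Proper k) (Proper j)) else 0)"
    using egen_super_commute[of "Proper i" 0 n "Proper j" "Proper k" "Proper p"]
    by (simp add: lmul_simps[symmetric] symbols_def if_distrib[of lmul, symmetric])
qed (rule cre_cre ann_ann lmul_cre lmul_ann | simp add: ann_cre prod_encode_eq)+


abbreviation fock_gen :: "nat \<Rightarrow> nat \<Rightarrow> symbol \<times> symbol \<Rightarrow> uea fock endo"
  where "fock_gen m n p \<equiv> fk.F m n (fst p) (snd p)"

abbreviation fock_eval :: "nat \<Rightarrow> nat \<Rightarrow> (symbol \<times> symbol) free_algebra \<Rightarrow> uea fock endo"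
  where "fock_eval m n \<equiv> eval (\<lambda>c. lmul (scalar c)) (fock_gen m n)"

lemma lmul_scalar_commute:
  "lmul (scalar c) * cre x = cre x * lmul (scalar c)" "lmul (scalar c) * ann x = ann x * lmul (scalar c)"
  "lmul (scalar c) * lmul u = lmul u * lmul (scalar c)"
  by (rule lmul_cre, rule lmul_ann) (simp add: lmul_simps(3)[symmetric] scalar_central[of c u])

lemma scalar_minus_one: "scalar (- 1) = - 1"
  by (rule uea_eqI) (simp add: component_scalar const_simps env_class_simps)

lemma commute_mult: "k * x = x * k \<Longrightarrow> k * y = y * k \<Longrightarrow> k * (x * y) = x * y * (k :: 'a::semigroup_mult)"
  by (metis mult.assoc)

lemma lmul_scalar_fock_gen: "lmul (scalar c) * fock_gen m n p = fock_gen m n p * lmul (scalar c)"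
proof -
  have pp: "lmul (scalar c) * fk.pp m n i j = fk.pp m n i j * lmul (scalar c)" for i j
    unfolding fk.pp_def right_diff_distrib left_diff_distrib sum_distrib_left sum_distrib_right
    by (intro arg_cong2[where f = minus] sum.cong refl commute_mult lmul_scalar_commute)
  have pv: "lmul (scalar c) * fk.pv m n i \<alpha> = fk.pv m n i \<alpha> * lmul (scalar c)" for i \<alpha>
    unfolding fk.pv_def sum_distrib_left sum_distrib_right
    by (intro sum.cong refl commute_mult lmul_scalar_commute pp)
  have vv: "lmul (scalar c) * fk.vv n \<alpha> \<beta> = fk.vv n \<alpha> \<beta> * lmul (scalar c)" for \<alpha> \<beta>
    unfolding fk.vv_def sum_distrib_left sum_distrib_right
    by (intro sum.cong refl commute_mult lmul_scalar_commute)
  show ?thesis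
    by (cases "fst p"; cases "snd p") (simp_all add: pp pv vv lmul_scalar_commute)
qed

interpretation fr: evaluation "\<lambda>c. lmul (scalar c)" "fock_gen m n" for m n
  by unfold_locales (simp_all only: scalar_simps lmul_simps lmul_scalar_fock_gen)

lemma fock_eval_relators:
  assumes "f \<in> relators m n"
  shows "fock_eval m n f = 0"
proof -
  obtain x y where xy: "x \<in> symbols m n \<times> symbols m n" "y \<in> symbols m n \<times> symbols m n"
    and f: "f = gen x * gen y - const (koszul x y) * gen y * gen x - superbracket x y"
    using assms by (auto simp: relators_def)
  define k where "k = (parity (fst x) + parity (snd x)) * (parity (fst y) + parity (snd y))"
  have sign: "lmul (scalar (koszul x y)) = (- 1) ^ k"
  proof -
    have "koszul x y = (- 1) ^ k"
      by (simp add: koszul_def k_def)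
    moreover have "lmul (scalar (- 1)) = (- 1 :: uea fock endo)"
      using lmul_simps(2)[of 0 1] by (simp add: scalar_minus_one lmul_simps)
    moreover have "lmul (scalar 1) = (1 :: uea fock endo)"
      by (simp add: scalar_simps lmul_simps)
    ultimately show ?thesis
      by (cases "even k") simp_all
  qed
  have br: "fock_eval m n (superbracket x y) = (if snd x = fst y then fock_gen m n (fst x, snd y) else 0)
      - (- 1) ^ k * (if fst x = snd y then fock_gen m n (fst y, snd x) else 0)"
    by (simp add: superbracket_def fr.eval_diff fr.eval_mult fr.eval_const fr.eval_gen fr.eval_zero sign)
  have "fock_gen m n x * fock_gen m n y = (- 1) ^ k * (fock_gen m n y * fock_gen m n x)
      + (if snd x = fst y then fock_gen m n (fst x, snd y) else 0)
      - (- 1) ^ k * (if fst x = snd y then fock_gen m n (fst y, snd x) else 0)"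
    using fk.F_super_commute[of "fst x" m n "snd x" "fst y" "snd y"] xy unfolding k_def by (auto simp: mem_Times_iff)
  then show ?thesis
    unfolding f fr.eval_diff br fr.eval_mult fr.eval_gen fr.eval_const sign mult.assoc
    by (simp only: diff_diff_eq2 add_diff_eq) (simp add: algebra_simps)
qed

lemma fock_eval_env_ideal:
  assumes "f \<in> env_ideal m n"
  shows "fock_eval m n f = 0"
proof -
  let ?K = "{f \<in> carrier (fa m n). fock_eval m n f = 0}"
  have "inv\<^bsub>add_monoid (fa m n)\<^esub> f = - f" if "f \<in> carrier (fa m n)" for f
    using that fa_minus[OF that] by (simp add: a_inv_def)
  then have "subgroup ?K (add_monoid (fa m n))"
    by (intro subgroup.intro) (auto simp: fr.eval_add fr.eval_zero fr.eval_uminus)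
  then have "ideal ?K (fa m n)"
    by (intro idealI fa.ring_axioms) (auto simp: fr.eval_mult)
  moreover have "relators m n \<subseteq> ?K"
    using relators_closed fock_eval_relators by blast
  ultimately have "env_ideal m n \<subseteq> ?K"
    unfolding env_ideal_eq by (rule fa.genideal_minimal)
  with assms show ?thesis by blast
qed

definition vac :: "'b::ring_1 \<Rightarrow> 'b fock"
  where "vac u S = (if S = {} then u else 0)"

lemma ann_vac [simp]: "app (ann x) (vac u) = 0"
  by (rule ext) (simp add: app_ann vac_def)

text \<open>Every basis vector in the support of \<open>f\<close> contains exactly \<open>c\<close> generators with the virtual symbol \<open>\<gamma>\<close>. The
number is an integer so that a negative value can express \<open>f = 0\<close>.\<close>

definition content :: "nat \<Rightarrow> int \<Rightarrow> 'b::ring_1 fock \<Rightarrow> bool"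
  where "content \<gamma> c f \<longleftrightarrow> (\<forall>S. f S \<noteq> 0 \<longrightarrow>
    finite {i. prod_encode (\<gamma>, i) \<in> S} \<and> int (card {i. prod_encode (\<gamma>, i) \<in> S}) = c)"

lemma contentD:
  "content \<gamma> c f \<Longrightarrow> f S \<noteq> 0 \<Longrightarrow>
    finite {i. prod_encode (\<gamma>, i) \<in> S} \<and> int (card {i. prod_encode (\<gamma>, i) \<in> S}) = c"
  by (simp add: content_def)

lemma content_vac: "content \<gamma> 0 (vac u)"
  by (auto simp: content_def vac_def)

lemma content_zero: "content \<gamma> c 0"
  by (simp add: content_def)

lemma content_add: "content \<gamma> c f \<Longrightarrow> content \<gamma> c g \<Longrightarrow> content \<gamma> c (f + g)"
  unfolding content_def by (metis add_0_left plus_fun_apply)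

lemma content_diff: "content \<gamma> c f \<Longrightarrow> content \<gamma> c g \<Longrightarrow> content \<gamma> c (f - g)"
  unfolding content_def by (metis diff_0_right minus_apply)

lemma content_sum: "(\<And>a. a \<in> A \<Longrightarrow> content \<gamma> c (f a)) \<Longrightarrow> content \<gamma> c (sum f A)"
  by (induction A rule: infinite_finite_induct) (auto simp: content_zero content_add)

lemma content_lmul: "content \<gamma> c f \<Longrightarrow> content \<gamma> c (app (lmul u) f)"
  unfolding content_def app_lmul by (metis mult_zero_right)

lemma content_cre:
  assumes "content \<gamma> c f"
  shows "content \<gamma> (c + (if \<alpha> = \<gamma> then 1 else 0)) (app (cre (prod_encode (\<alpha>, i))) f)"
  unfolding content_def
proof (intro allI impI)
  fix S assume "app (cre (prod_encode (\<alpha>, i))) f S \<noteq> 0"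
  then have S: "prod_encode (\<alpha>, i) \<in> S" and f: "f (S - {prod_encode (\<alpha>, i)}) \<noteq> 0"
    by (auto simp: app_cre split: if_splits)
  let ?T = "{j. prod_encode (\<gamma>, j) \<in> S - {prod_encode (\<alpha>, i)}}"
  have T: "finite ?T" "int (card ?T) = c"
    using contentD[OF assms f] by blast+
  have "{j. prod_encode (\<gamma>, j) \<in> S} = (if \<alpha> = \<gamma> then insert i ?T else ?T)"
    using S by (auto simp: prod_encode_eq)
  moreover have "\<alpha> = \<gamma> \<Longrightarrow> i \<notin> ?T"
    by auto
  ultimately show "finite {j. prod_encode (\<gamma>, j) \<in> S} \<and>
      int (card {j. prod_encode (\<gamma>, j) \<in> S}) = c + (if \<alpha> = \<gamma> then 1 else 0)"
    using T by (cases "\<alpha> = \<gamma>") (simp_all only: if_True if_False finite_insert card_insert_disjoint, auto)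
qed

lemma content_ann:
  assumes "content \<gamma> c f"
  shows "content \<gamma> (c - (if \<alpha> = \<gamma> then 1 else 0)) (app (ann (prod_encode (\<alpha>, i))) f)"
  unfolding content_def
proof (intro allI impI)
  fix S assume "app (ann (prod_encode (\<alpha>, i))) f S \<noteq> 0"
  then have S: "prod_encode (\<alpha>, i) \<notin> S" and f: "f (insert (prod_encode (\<alpha>, i)) S) \<noteq> 0"
    by (auto simp: app_ann split: if_splits)
  let ?T = "{j. prod_encode (\<gamma>, j) \<in> insert (prod_encode (\<alpha>, i)) S}" and ?U = "{j. prod_encode (\<gamma>, j) \<in> S}"
  have T: "finite ?T" "int (card ?T) = c"
    using contentD[OF assms f] by blast+
  have eq: "?T = (if \<alpha> = \<gamma> then insert i ?U else ?U)"
    by (auto simp: prod_encode_eq)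
  show "finite ?U \<and> int (card ?U) = c - (if \<alpha> = \<gamma> then 1 else 0)"
  proof (cases "\<alpha> = \<gamma>")
    case True
    then have "i \<notin> ?U" using S by auto
    then show ?thesis
      using T True unfolding eq by (auto simp: card_insert_if)
  next
    case False
    then show ?thesis
      using T unfolding eq by auto
  qed
qed

lemma content_fock_gen:
  assumes "content \<gamma> c f"
  shows "content \<gamma> (c + (if fst p = Virt \<gamma> then 1 else 0) - (if snd p = Virt \<gamma> then 1 else 0)) (app (fock_gen m n p) f)"
proof -
  have pp: "content \<gamma> c' (app (fk.pp m n i j) g)" if "content \<gamma> c' g" for i j c' g
  proof -
    have "content \<gamma> c' (app (cre (prod_encode (\<beta>, j))) (app (ann (prod_encode (\<beta>, i))) g))" for \<beta>
      using content_cre[OF content_ann[OF that, of \<beta> i], of \<beta> j] by (simp split: if_splits)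
    then show ?thesis
      unfolding fk.pp_def app_simps app_sum
      by (intro content_diff content_sum content_lmul that)
  qed
  show ?thesis
  proof (cases "fst p"; cases "snd p")
    fix \<alpha> \<beta> assume "fst p = Virt \<alpha>" "snd p = Virt \<beta>"
    moreover have "content \<gamma> (c + (if \<alpha> = \<gamma> then 1 else 0) - (if \<beta> = \<gamma> then 1 else 0))
        (app (cre (prod_encode (\<alpha>, k))) (app (ann (prod_encode (\<beta>, k))) f))" for k
      using content_cre[OF content_ann[OF assms, of \<beta> k], of \<alpha> k] by (simp add: algebra_simps)
    ultimately show ?thesis
      by (simp add: fk.vv_def app_sum content_sum)
  next
    fix \<alpha> i assume "fst p = Virt \<alpha>" "snd p = Proper i"
    then show ?thesis
      using content_cre[OF assms] by simp
  next
    fix i \<alpha> assume "fst p = Proper i" "snd p = Virt \<alpha>"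
    then show ?thesis
      using content_ann[OF assms] by (simp add: fk.pv_def app_sum content_sum pp)
  next
    fix i j assume "fst p = Proper i" "snd p = Proper j"
    then show ?thesis
      using pp[OF assms] by simp
  qed
qed

text \<open>An operator \<open>e\<^sub>x\<^sub>\<gamma>\<close> ends with the removal of a generator with symbol \<open>\<gamma>\<close>.\<close>

lemma fock_gen_kills:
  assumes "content \<gamma> c f" "c \<le> 0"
  shows "app (fock_gen m n (x, Virt \<gamma>)) f = 0"
proof -
  have "app (ann (prod_encode (\<gamma>, i))) f = 0" for i
  proof (rule ext)
    fix S
    have "f (insert (prod_encode (\<gamma>, i)) S) = 0"
    proof (rule ccontr)
      let ?T = "{j. prod_encode (\<gamma>, j) \<in> insert (prod_encode (\<gamma>, i)) S}"
      assume "f (insert (prod_encode (\<gamma>, i)) S) \<noteq> 0"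
      then have "finite ?T" "int (card ?T) = c"
        using contentD[OF assms(1)] by blast+
      moreover have "i \<in> ?T" by simp
      ultimately have "0 < card ?T"
        using card_gt_0_iff by blast
      with \<open>int (card ?T) = c\<close> assms(2) show False by simp
    qed
    then show "app (ann (prod_encode (\<gamma>, i))) f S = 0 S"
      by (simp add: app_ann)
  qed
  then show ?thesis
    by (cases x) (simp_all add: fk.vv_def fk.pv_def app_sum)
qed

lemma content_word:
  "content \<gamma> (int (length (filter (\<lambda>p. fst p = Virt \<gamma>) ws)) - int (length (filter (\<lambda>p. snd p = Virt \<gamma>) ws)))
    (app (prod_list (map (fock_gen m n) ws)) (vac u))"
proof (induction ws)
  case Nil
  show ?case by (simp add: content_vac)
next
  case (Cons p ws)
  show ?case
    using content_fock_gen[OF Cons.IH, of p m n] by (simp add: algebra_simps split: if_splits)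
qed

text \<open>Just before the offending factor, the content of \<open>\<gamma>\<close> is the number of creations minus the number of
annihilations in the tail of the word, which is at most zero.\<close>

lemma irregular_kills_vac:
  assumes "irregular m ws"
  shows "app (prod_list (map (fock_gen m n) ws)) (vac u) = 0"
proof -
  obtain us a g vs where ws: "ws = us @ (a, Virt g) # vs"
    and le: "length (filter (\<lambda>p. fst p = Virt g) vs) \<le> length (filter (\<lambda>p. snd p = Virt g) vs)"
    using assms unfolding irregular_iff by blast
  have "app (fock_gen m n (a, Virt g)) (app (prod_list (map (fock_gen m n) vs)) (vac u)) = 0"
    by (rule fock_gen_kills[OF content_word]) (use le in simp)
  then show ?thesis
    by (simp add: ws)
qed

text \<open>The classes with a representative that kills the vacuum form a left ideal, and the choice of the
representative does not matter by \<open>fock_eval_env_ideal\<close>.\<close>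

lemma Irr_kills_vac:
  assumes "env_class m n f \<in> Irr m n" "f \<in> carrier (fa m n)"
  shows "app (fock_eval m n f) (vac u) = 0"
proof -
  let ?J = "{z. \<exists>g \<in> carrier (fa m n). z = env_class m n g \<and> app (fock_eval m n g) (vac u) = 0}"
  have "Irr m n \<subseteq> ?J"
  proof (rule Irr_least)
    show "?J \<subseteq> carrier (env m n)"
      by auto
    show "\<zero>\<^bsub>env m n\<^esub> \<in> ?J"
      by (auto intro!: bexI[of _ 0] simp: env_class_simps fr.eval_zero)
  next
    fix x y assume "x \<in> ?J" "y \<in> ?J"
    then obtain g h where "g \<in> carrier (fa m n)" "x = env_class m n g" "app (fock_eval m n g) (vac u) = 0"
      "h \<in> carrier (fa m n)" "y = env_class m n h" "app (fock_eval m n h) (vac u) = 0"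
      by blast
    then show "x \<oplus>\<^bsub>env m n\<^esub> y \<in> ?J"
      by (auto intro!: bexI[of _ "g + h"] simp: env_class_simps fr.eval_add)
  next
    fix r x assume "r \<in> carrier (env m n)" "x \<in> ?J"
    then obtain g h where "g \<in> carrier (fa m n)" "r = env_class m n g"
      "h \<in> carrier (fa m n)" "x = env_class m n h" "app (fock_eval m n h) (vac u) = 0"
      by (auto simp: carrier_env)
    then show "r \<otimes>\<^bsub>env m n\<^esub> x \<in> ?J"
      by (auto intro!: bexI[of _ "g * h"] simp: env_class_simps fr.eval_mult)
  next
    fix ws assume "set ws \<subseteq> symbols m n \<times> symbols m n" "irregular m ws"
    then show "mon m n ws \<in> ?J"
      by (auto intro!: bexI[of _ "prod_list (map gen ws)"]
          simp: mon_eq_env_class fa_closed_prod_gen fr.eval_prod_gen irregular_kills_vac)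
  qed
  with assms(1) obtain g where g: "g \<in> carrier (fa m n)" "env_class m n f = env_class m n g"
    "app (fock_eval m n g) (vac u) = 0"
    by blast
  then have "fock_eval m n (f - g) = 0"
    using assms(2) by (intro fock_eval_env_ideal) (simp add: env_class_eq_iff)
  then show ?thesis
    using g(3) by (simp add: fr.eval_diff)
qed

section \<open>The enveloping algebra of gl(n) meets the irregular ideal trivially\<close>

text \<open>Distinct creators turn the vacuum with coefficient \<open>u\<close> into a basis vector with coefficient \<open>\<plusminus> u\<close>, from
which \<open>u\<close> can be recovered.\<close>

lemma app_creations:
  assumes "distinct xs"
  shows "app (prod_list (map cre xs)) (vac u) (set xs) \<in> {u, - u :: 'b::ring_1}"
  using assms
proof (induction xs)
  case Nil
  show ?case by (simp add: vac_def)
next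
  case (Cons x xs)
  then have "app (prod_list (map cre (x # xs))) (vac u) (set (x # xs))
    = sign_below x (set (x # xs)) * app (prod_list (map cre xs)) (vac u) (set xs)"
    by (simp add: app_cre)
  then show ?case
    using Cons sign_below_cases[of x "set (x # xs)", where ?'b = 'b] by auto
qed

lemma creat_rows_fock:
  "\<exists>xs. distinct xs \<and> set xs \<subseteq> {prod_encode (i, t) |i t. i \<le> q} \<and>
    map (fock_gen m n) (gl.creat_rows n q) = map cre xs"
proof (induction q)
  case 0
  show ?case by (intro exI[of _ "[]"]) (simp add: gl.creat_rows_def)
next
  case (Suc q)
  then obtain xs where xs: "distinct xs" "set xs \<subseteq> {prod_encode (i, t) |i t. i \<le> q}"
    "map (fock_gen m n) (gl.creat_rows n q) = map cre xs"
    by blast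
  let ?ys = "map (\<lambda>t. prod_encode (Suc q, t)) [1..<Suc n]"
  have "distinct ?ys"
    by (simp add: distinct_map inj_on_def prod_encode_eq del: upt_Suc)
  moreover have "set xs \<inter> set ?ys = {}"
    using xs(2) by (auto simp: prod_encode_eq)
  moreover have "set ?ys \<subseteq> {prod_encode (i, t) |i t. i \<le> Suc q}"
    by auto
  moreover have "set xs \<subseteq> {prod_encode (i, t) |i t. i \<le> Suc q}"
    using xs(2) le_SucI by blast
  moreover have "map (fock_gen m n) (gl.creat_rows n (Suc q)) = map cre (xs @ ?ys)"
    by (simp add: gl.rows_Suc xs(3) comp_def del: upt_Suc)
  ultimately show ?case
    using xs(1) by (intro exI[of _ "xs @ ?ys"]) (simp del: upt_Suc)
qed

interpretation ident: evaluation const gen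
  by unfold_locales (rule const_simps const_mult_commute)+

lemma eval_const_gen: "eval const gen f = f"
  by (induction f rule: free_algebra_induct)
    (simp_all add: ident.eval_zero ident.eval_add ident.eval_single single_eq_const_mult[symmetric])

abbreviation gl_eval :: "nat \<Rightarrow> nat \<Rightarrow> (symbol \<times> symbol) free_algebra \<Rightarrow> uea"
  where "gl_eval m n \<equiv> eval scalar (\<lambda>p. egen m n (fst p) (snd p))"

lemma component_gl_eval:
  assumes "f \<in> carrier (fa m n)"
  shows "component (gl_eval m n f) m n = env_class m n f"
proof -
  let ?c = "Poly_Mapping.lookup f"
  have gens: "component (prod_list (map (\<lambda>p. egen m n (fst p) (snd p)) xs)) m n = env_class m n (prod_list (map gen xs))"
    if "set xs \<subseteq> symbols m n \<times> symbols m n" for xs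
    using component_word[OF that] mon_eq_env_class[OF that] by (simp add: gl.word_def case_prod_unfold)
  have "component (\<Sum>w\<in>A. scalar (?c w) * prod_list (map (\<lambda>p. egen m n (fst p) (snd p)) (letters w))) m n
      = env_class m n (\<Sum>w\<in>A. const (?c w) * prod_list (map gen (letters w)))
    \<and> (\<Sum>w\<in>A. const (?c w) * prod_list (map gen (letters w))) \<in> carrier (fa m n)"
    if "finite A" "A \<subseteq> Poly_Mapping.keys f" for A
    using that
  proof (induction A)
    case (insert w A)
    have w: "set (letters w) \<subseteq> symbols m n \<times> symbols m n"
      using insert.prems assms by (auto simp: free_alg_def)
    then have "prod_list (map gen (letters w)) \<in> carrier (fa m n)"
      by (rule fa_closed_prod_gen)
    then show ?case
      using insert gens[OF w] by (simp add: env_class_simps component_scalar)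
  qed (simp add: env_class_simps)
  then have "component (gl_eval m n f) m n = env_class m n (eval const gen f)"
    by (simp add: eval_def)
  then show ?thesis
    by (simp add: eval_const_gen)
qed

lemma vac_simps: "vac (u + v) = vac u + vac v" "vac 0 = 0"
  by (simp_all add: vac_def fun_eq_iff)

lemma vac_sum: "vac (sum f A) = (\<Sum>a\<in>A. vac (f a))"
  by (induction A rule: infinite_finite_induct) (simp_all add: vac_simps)

lemma app_lmul_vac: "app (lmul v) (vac u) = vac (v * u)"
  by (simp add: app_lmul vac_def fun_eq_iff)

text \<open>On the vacuum the contractions in \<open>e\<^sub>i\<^sub>j\<close> vanish, and left multiplication remains.\<close>

lemma fock_eval_vac:
  assumes "f \<in> carrier (fa 0 n)"
  shows "app (fock_eval m n f) (vac u) = vac (gl_eval 0 n f * u)"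
proof -
  have word: "app (prod_list (map (fock_gen m n) ws)) (vac u) = vac (prod_list (map (\<lambda>p. egen 0 n (fst p) (snd p)) ws) * u)"
    if "set ws \<subseteq> symbols 0 n \<times> symbols 0 n" for ws
    using that
  proof (induction ws)
    case (Cons p ws)
    obtain i j where p: "p = (Proper i, Proper j)"
      using Cons.prems by (cases p) (auto simp: symbols_def)
    have "app (fk.pp m n i j) (vac v) = vac (egen 0 n (Proper i) (Proper j) * v)" for v
      by (simp add: fk.pp_def app_sum app_lmul_vac)
    then show ?case
      using Cons by (simp add: p mult.assoc)
  qed simp
  have "app (fock_eval m n f) (vac u) = (\<Sum>w\<in>Poly_Mapping.keys f. vac (scalar (Poly_Mapping.lookup f w)
      * (prod_list (map (\<lambda>p. egen 0 n (fst p) (snd p)) (letters w)) * u)))"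
    unfolding eval_def app_sum
  proof (intro sum.cong refl)
    fix w assume "w \<in> Poly_Mapping.keys f"
    then have "set (letters w) \<subseteq> symbols 0 n \<times> symbols 0 n"
      using assms by (auto simp: free_alg_def)
    then show "app (lmul (scalar (Poly_Mapping.lookup f w)) * prod_list (map (fock_gen m n) (letters w))) (vac u)
      = vac (scalar (Poly_Mapping.lookup f w) * (prod_list (map (\<lambda>p. egen 0 n (fst p) (snd p)) (letters w)) * u))"
      by (simp add: word app_lmul_vac)
  qed
  then show ?thesis
    by (simp add: eval_def vac_sum sum_distrib_right mult.assoc)
qed

lemma fa_0_subset: "carrier (fa 0 n) \<subseteq> carrier (fa m n)"
  by (auto simp: free_alg_def symbols_def)

lemma env_ideal_0_subset: "env_ideal 0 n \<subseteq> env_ideal m n"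
proof -
  let ?K = "env_ideal m n \<inter> carrier (fa 0 n)"
  have "subgroup ?K (add_monoid (fa 0 n))"
  proof (rule subgroup.intro)
    show "?K \<subseteq> carrier (add_monoid (fa 0 n))"
      by simp
    show "x \<otimes>\<^bsub>add_monoid (fa 0 n)\<^esub> y \<in> ?K" if "x \<in> ?K" "y \<in> ?K" for x y
      using that additive_subgroup.a_closed[OF ideal.axioms(1)[OF ideal_env_ideal], of x m n y] by simp
    show "\<one>\<^bsub>add_monoid (fa 0 n)\<^esub> \<in> ?K"
      by (simp add: zero_in_env_ideal)
    show "inv\<^bsub>add_monoid (fa 0 n)\<^esub> x \<in> ?K" if "x \<in> ?K" for x
    proof -
      have "inv\<^bsub>add_monoid (fa 0 n)\<^esub> x = - x"
        using that fa_minus[of x 0 n] by (simp add: a_inv_def)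
      moreover have "x \<in> carrier (fa m n)"
        using that fa_0_subset by blast
      then have "- x \<in> env_ideal m n"
        using that additive_subgroup.a_inv_closed[OF ideal.axioms(1)[OF ideal_env_ideal[of m n]], of x] by simp
      ultimately show ?thesis
        using that by simp
    qed
  qed
  then have "ideal ?K (fa 0 n)"
  proof (rule idealI[OF fa.ring_axioms])
    fix f g assume f: "f \<in> ?K" and g: "g \<in> carrier (fa 0 n)"
    then have "g \<in> carrier (fa m n)"
      using fa_0_subset by blast
    then show "g \<otimes>\<^bsub>fa 0 n\<^esub> f \<in> ?K" "f \<otimes>\<^bsub>fa 0 n\<^esub> g \<in> ?K"
      using f g ideal.I_l_closed[OF ideal_env_ideal[of m n], of f g] ideal.I_r_closed[OF ideal_env_ideal[of m n], of f g]
      by simp_all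
  qed
  moreover have "symbols 0 n \<subseteq> symbols m n"
    by (auto simp: symbols_def)
  then have "relators 0 n \<subseteq> relators m n"
    unfolding relators_def by blast
  then have "relators 0 n \<subseteq> ?K"
    using relators_closed[of 0 n] fa.genideal_self[OF relators_closed[of m n]] unfolding env_ideal_eq by blast
  ultimately have "env_ideal 0 n \<subseteq> ?K"
    unfolding env_ideal_eq[of 0 n] by (rule fa.genideal_minimal)
  then show ?thesis by blast
qed

lemma env_gl_generators_closed:
  "range (\<lambda>c. env_class m n (const c))
       \<union> {e m n (Proper i) (Proper j) | i j. i \<in> {1..n} \<and> j \<in> {1..n}} \<subseteq> carrier (env m n)"
  by (auto simp: e_def gl.symbols_simps)

lemma env_gl_closed:
  "env_gl m n \<subseteq> carrier (env m n)"
  "\<one>\<^bsub>env m n\<^esub> \<in> env_gl m n"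
  "x \<in> env_gl m n \<Longrightarrow> y \<in> env_gl m n \<Longrightarrow> x \<oplus>\<^bsub>env m n\<^esub> y \<in> env_gl m n"
  "x \<in> env_gl m n \<Longrightarrow> y \<in> env_gl m n \<Longrightarrow> x \<otimes>\<^bsub>env m n\<^esub> y \<in> env_gl m n"
  "x \<in> env_gl m n \<Longrightarrow> \<ominus>\<^bsub>env m n\<^esub> x \<in> env_gl m n"
  "i \<in> {1..n} \<Longrightarrow> j \<in> {1..n} \<Longrightarrow> e m n (Proper i) (Proper j) \<in> env_gl m n"
  using env.generate_ring_incl[OF env_gl_generators_closed[of m n]]
  unfolding env_gl_def
  by (simp_all add: generate_ring.intros) (rule generate_ring.incl, blast)

lemma env_gl_induct [consumes 1, case_names scalar gen one uminus add mult]: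
  assumes "x \<in> env_gl m n"
    and "\<And>c. P (env_class m n (const c))"
    and "\<And>i j. i \<in> {1..n} \<Longrightarrow> j \<in> {1..n} \<Longrightarrow> P (e m n (Proper i) (Proper j))"
    and "P \<one>\<^bsub>env m n\<^esub>"
    and "\<And>x. x \<in> env_gl m n \<Longrightarrow> P x \<Longrightarrow> P (\<ominus>\<^bsub>env m n\<^esub> x)"
    and "\<And>x y. x \<in> env_gl m n \<Longrightarrow> P x \<Longrightarrow> y \<in> env_gl m n \<Longrightarrow> P y \<Longrightarrow> P (x \<oplus>\<^bsub>env m n\<^esub> y)"
    and "\<And>x y. x \<in> env_gl m n \<Longrightarrow> P x \<Longrightarrow> y \<in> env_gl m n \<Longrightarrow> P y \<Longrightarrow> P (x \<otimes>\<^bsub>env m n\<^esub> y)"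
  shows "P x"
  using assms(1) unfolding env_gl_def
proof (induction rule: generate_ring.induct)
  case (incl h)
  then show ?case using assms(2,3) by blast
qed (use assms(4-7) in \<open>simp_all add: env_gl_def\<close>)

lemma env_gl_lift:
  assumes "y \<in> env_gl m n"
  shows "\<exists>g \<in> carrier (fa 0 n). y = env_class m n g"
  using assms
proof (induction rule: env_gl_induct)
  case (scalar c)
  show ?case by (intro bexI[of _ "const c"]) simp_all
next
  case (gen i j)
  then show ?case
    by (intro bexI[of _ "gen (Proper i, Proper j)"]) (simp_all add: e_def gl.symbols_simps)
next
  case one
  show ?case by (intro bexI[of _ 1]) (simp_all add: env_class_simps)
next
  case (uminus x)
  then obtain g where "g \<in> carrier (fa 0 n)" "x = env_class m n g" by blast
  then show ?case
    using fa_0_subset[of n m] by (intro bexI[of _ "- g"]) (auto simp: env_class_simps)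
next
  case (add x y)
  then obtain g h where "g \<in> carrier (fa 0 n)" "x = env_class m n g" "h \<in> carrier (fa 0 n)" "y = env_class m n h"
    by blast
  moreover from this have "g \<in> carrier (fa m n)" "h \<in> carrier (fa m n)"
    using fa_0_subset by blast+
  ultimately show ?case
    by (intro bexI[of _ "g + h"]) (simp_all add: env_class_simps)
next
  case (mult x y)
  then obtain g h where "g \<in> carrier (fa 0 n)" "x = env_class m n g" "h \<in> carrier (fa 0 n)" "y = env_class m n h"
    by blast
  moreover from this have "g \<in> carrier (fa m n)" "h \<in> carrier (fa m n)"
    using fa_0_subset by blast+
  ultimately show ?case
    by (intro bexI[of _ "g * h"]) (simp_all add: env_class_simps)
qed

lemma creat_rows_symbols:
  "q \<le> m \<Longrightarrow> set (gl.creat_rows n q) \<subseteq> symbols m n \<times> symbols m n"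
  "q \<le> m \<Longrightarrow> set (gl.annih_rows n q) \<subseteq> symbols m n \<times> symbols m n"
  by (auto simp: gl.creat_rows_def gl.annih_rows_def gl.symbols_simps simp del: upt_Suc)

text \<open>If \<open>W y \<in> Irr\<close>, then \<open>W y\<close> kills the vacuum, but it sends the vacuum to a basis vector with coefficient
\<open>\<plusminus> y\<close>, where \<open>y\<close> is read in \<open>env 0 n\<close>. So a polynomial that represents \<open>y\<close> follows from the
relations of \<open>gl(n)\<close> alone. The empty \<open>W\<close> gives the directness of the sum of \<open>U(gl(n))\<close> and \<open>Irr\<close>.\<close>

lemma creat_rows_faithful:
  assumes "y \<in> env_gl m n" "q \<le> m" "mon m n (gl.creat_rows n q) \<otimes>\<^bsub>env m n\<^esub> y \<in> Irr m n"
  shows "y = \<zero>\<^bsub>env m n\<^esub>"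
proof -
  obtain g where g: "g \<in> carrier (fa 0 n)" "y = env_class m n g"
    using env_gl_lift[OF assms(1)] by blast
  then have g': "g \<in> carrier (fa m n)"
    using fa_0_subset by blast
  let ?w = "prod_list (map gen (gl.creat_rows n q))"
  have w: "?w \<in> carrier (fa m n)"
    using creat_rows_symbols(1)[OF assms(2)] by (rule fa_closed_prod_gen)
  have "env_class m n (?w * g) \<in> Irr m n"
    using assms(3) creat_rows_symbols(1)[OF assms(2)] w g' g(2) by (simp add: mon_eq_env_class env_class_simps)
  then have "app (fock_eval m n (?w * g)) (vac 1) = 0"
    using w g' by (intro Irr_kills_vac) simp_all
  then have "app (prod_list (map (fock_gen m n) (gl.creat_rows n q))) (vac (gl_eval 0 n g)) = 0"
    by (simp add: fr.eval_mult fr.eval_prod_gen fock_eval_vac[OF g(1)])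
  moreover obtain xs where "distinct xs" "map (fock_gen m n) (gl.creat_rows n q) = map cre xs"
    using creat_rows_fock by blast
  ultimately have "gl_eval 0 n g = 0"
    using app_creations[of xs "gl_eval 0 n g"] by auto
  then have "env_class 0 n g = \<zero>\<^bsub>env 0 n\<^esub>"
    using component_gl_eval[OF g(1)] by simp
  then have "g \<in> env_ideal m n"
    using env_class_eq_zero_iff[OF g(1)] env_ideal_0_subset by blast
  then show ?thesis
    using env_class_eq_zero_iff[OF g'] g(2) by simp
qed

lemma env_gl_Irr_zero:
  assumes "y \<in> env_gl m n" "y \<in> Irr m n"
  shows "y = \<zero>\<^bsub>env m n\<^esub>"
proof (rule creat_rows_faithful[OF assms(1), of 0])
  have "y \<in> carrier (env m n)"
    using assms(1) env_gl_closed(1) by blast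
  then show "mon m n (gl.creat_rows n 0) \<otimes>\<^bsub>env m n\<^esub> y \<in> Irr m n"
    using assms(2) by (simp add: gl.creat_rows_def mon_def lprod_def)
qed simp

lemma Irr_times_env_gl:
  assumes "y \<in> env_gl m n"
  shows "x \<in> Irr m n \<Longrightarrow> x \<otimes>\<^bsub>env m n\<^esub> y \<in> Irr m n"
  using assms
proof (induction arbitrary: x rule: env_gl_induct)
  case (scalar c)
  then obtain f where f: "f \<in> carrier (fa m n)" "x = env_class m n f"
    using Irr_subset_carrier carrier_env by blast
  then have "x \<otimes>\<^bsub>env m n\<^esub> env_class m n (const c) = env_class m n (const c) \<otimes>\<^bsub>env m n\<^esub> x"
    by (simp add: env_class_simps(2)[symmetric] const_mult_commute)
  then show ?case
    using scalar by (simp add: Irr_closed)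
next
  case (gen i j)
  then show ?case by (intro Irr_times_gl)
next
  case one
  then have "x \<in> carrier (env m n)"
    using Irr_subset_carrier by blast
  then show ?case
    using one by simp
next
  case (uminus y)
  have "x \<in> carrier (env m n)" "y \<in> carrier (env m n)"
    using uminus Irr_subset_carrier env_gl_closed(1) by blast+
  then have "x \<otimes>\<^bsub>env m n\<^esub> (\<ominus>\<^bsub>env m n\<^esub> y) = (\<ominus>\<^bsub>env m n\<^esub> \<one>\<^bsub>env m n\<^esub>) \<otimes>\<^bsub>env m n\<^esub> (x \<otimes>\<^bsub>env m n\<^esub> y)"
    by (simp add: env.l_minus env.r_minus)
  then show ?case
    using uminus by (simp add: Irr_closed)
next
  case (add y z)
  have "x \<in> carrier (env m n)" "y \<in> carrier (env m n)" "z \<in> carrier (env m n)"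
    using add Irr_subset_carrier env_gl_closed(1) by blast+
  then show ?case
    using add by (simp add: env.r_distr Irr_closed)
next
  case (mult y z)
  have "x \<in> carrier (env m n)" "y \<in> carrier (env m n)" "z \<in> carrier (env m n)"
    using mult Irr_subset_carrier env_gl_closed(1) by blast+
  then show ?case
    using mult by (simp add: env.m_assoc[symmetric])
qed

lemma devirt_eqI:
  assumes "y \<in> env_gl m n" "x \<in> carrier (env m n)" "x \<ominus>\<^bsub>env m n\<^esub> y \<in> Irr m n"
  shows "devirt m n x = y"
  unfolding devirt_def
proof (rule the_equality)
  fix z assume z: "z \<in> env_gl m n \<and> x \<ominus>\<^bsub>env m n\<^esub> z \<in> Irr m n"
  have c: "y \<in> carrier (env m n)" "z \<in> carrier (env m n)"
    using assms(1) z env_gl_closed(1) by blast+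
  have "z \<ominus>\<^bsub>env m n\<^esub> y = (x \<ominus>\<^bsub>env m n\<^esub> y) \<oplus>\<^bsub>env m n\<^esub> (\<ominus>\<^bsub>env m n\<^esub> \<one>\<^bsub>env m n\<^esub>) \<otimes>\<^bsub>env m n\<^esub> (x \<ominus>\<^bsub>env m n\<^esub> z)"
  proof -
    have "only_at m n z - only_at m n y = (only_at m n x - only_at m n y) + (- 1) * (only_at m n x - only_at m n z)"
      by simp
    then have "component (only_at m n z - only_at m n y) m n
      = component ((only_at m n x - only_at m n y) + (- 1) * (only_at m n x - only_at m n z)) m n"
      by (rule arg_cong)
    then show ?thesis
      using c assms(2) by (simp only: component_simps component_only_at_same)
  qed
  also have "\<dots> \<in> Irr m n"
    using assms(3) z by (intro Irr_closed) simp_all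
  finally have "z \<ominus>\<^bsub>env m n\<^esub> y = \<zero>\<^bsub>env m n\<^esub>"
    using z assms(1) by (intro env_gl_Irr_zero) (simp_all add: a_minus_def env_gl_closed)
  then show "z = y"
    using c by simp
qed (use assms in simp)

section \<open>Capelli elements as sums of determinants\<close>

lemma map_permutation_bij:
  assumes "bij_betw f A B" "finite A"
  shows "bij_betw (map_permutation A f) {\<sigma>. \<sigma> permutes A} {\<sigma>. \<sigma> permutes B}"
proof (rule bij_betw_byWitness[where f' = "map_permutation B (inv_into A f)"])
  have inj: "inj_on f A" and img: "f ` A = B"
    using assms(1) by (auto simp: bij_betw_def)
  have g: "bij_betw (inv_into A f) B A"
    by (rule bij_betw_inv_into[OF assms(1)])
  show "map_permutation A f ` {\<sigma>. \<sigma> permutes A} \<subseteq> {\<sigma>. \<sigma> permutes B}"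
    using map_permutation_permutes[OF assms(1)] by blast
  show "map_permutation B (inv_into A f) ` {\<sigma>. \<sigma> permutes B} \<subseteq> {\<sigma>. \<sigma> permutes A}"
    using map_permutation_permutes[OF g] by blast
  show "\<forall>\<sigma>\<in>{\<sigma>. \<sigma> permutes A}. map_permutation B (inv_into A f) (map_permutation A f \<sigma>) = \<sigma>"
    using map_permutation_compose_inv[OF assms(1), of _ "inv_into A f"] inj by simp
  show "\<forall>\<sigma>\<in>{\<sigma>. \<sigma> permutes B}. map_permutation A f (map_permutation B (inv_into A f) \<sigma>) = \<sigma>"
    using map_permutation_compose_inv[OF g, of _ f] img by (simp add: f_inv_into_f)
qed

text \<open>Conjugation with the enumeration \<open>r \<mapsto> is ! (r - 1)\<close> of the index set turns permutations of positions into
permutations of indices and keeps the sign.\<close>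

lemma capelli_det_list:
  fixes z :: "nat \<Rightarrow> nat \<Rightarrow> 'a::ring_1"
  assumes "sorted_wrt (<) is" "length is = k"
  shows "capelli_det z 0 (set is) = (\<Sum>\<sigma> | \<sigma> permutes {1..k}. of_int (sign \<sigma>) *
    prod_list (map (\<lambda>s. z (is ! (\<sigma> s - 1)) (is ! (s - 1)) + (if \<sigma> s = s then of_nat (k - \<sigma> s) else 0)) [1..<Suc k]))"
proof -
  define f where "f r = is ! (r - 1)" for r
  have f_less: "f r < f s \<longleftrightarrow> r < s" if "r \<in> {1..k}" "s \<in> {1..k}" for r s
  proof -
    have less: "f r < f s" if "r < s" "1 \<le> r" "s \<le> k" for r s
      using that assms by (auto simp: f_def sorted_wrt_iff_nth_less)
    show ?thesis
      using less[of r s] less[of s r] that by (cases r s rule: linorder_cases) auto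
  qed
  have "inj_on f {1..k}"
  proof (rule inj_onI)
    fix r s assume "r \<in> {1..k}" "s \<in> {1..k}" "f r = f s"
    then show "r = s"
      using f_less[of r s] f_less[of s r] by (cases r s rule: linorder_cases) auto
  qed
  moreover have map_f: "map f [1..<Suc k] = is"
    using assms(2) by (intro nth_equalityI) (auto simp: f_def simp del: upt_Suc)
  then have "f ` {1..k} = set is"
    by (metis atLeastLessThanSuc_atLeastAtMost list.set_map set_upt)
  ultimately have bij: "bij_betw f {1..k} (set is)"
    by (simp add: bij_betw_def)
  have sorted: "sorted_list_of_set (set is) = is"
    using assms(1) by (simp add: sorted_list_of_set.idem_if_sorted_distinct strict_sorted_iff)
  have card: "card {t \<in> set is. f s < t} = k - s" if "s \<in> {1..k}" for s
  proof -
    have "{t \<in> set is. f s < t} = f ` {r \<in> {1..k}. s < r}"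
      unfolding \<open>f ` {1..k} = set is\<close>[symmetric] using f_less[OF that] by blast
    also have "{r \<in> {1..k}. s < r} = {Suc s..k}"
      by auto
    finally have "{t \<in> set is. f s < t} = f ` {Suc s..k}" .
    moreover have "inj_on f {Suc s..k}"
      using \<open>inj_on f {1..k}\<close> by (rule inj_on_subset) (use that in auto)
    ultimately show ?thesis
      by (simp add: card_image)
  qed
  let ?g = "\<lambda>\<sigma> t. z (map_permutation {1..k} f \<sigma> t) t
    + (if map_permutation {1..k} f \<sigma> t = t then of_int (0 + int (card {t' \<in> set is. t < t'})) else 0)"
  let ?h = "\<lambda>\<sigma> s. z (is ! (\<sigma> s - 1)) (is ! (s - 1)) + (if \<sigma> s = s then of_nat (k - \<sigma> s) else 0)"
  have "capelli_det z 0 (set is) = (\<Sum>\<sigma> | \<sigma> permutes {1..k}. of_int (sign (map_permutation {1..k} f \<sigma>)) *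
      prod_list (map (?g \<sigma>) is))"
    unfolding capelli_det_def sorted
    by (rule sum.reindex_bij_betw[OF map_permutation_bij[OF bij], symmetric]) simp
  also have "\<dots> = (\<Sum>\<sigma> | \<sigma> permutes {1..k}. of_int (sign \<sigma>) *
    prod_list (map (?h \<sigma>) [1..<Suc k]))"
  proof (intro sum.cong refl arg_cong2[where f = times])
    fix \<sigma> assume "\<sigma> \<in> {\<sigma>. \<sigma> permutes {1..k}}"
    then have \<sigma>: "\<sigma> permutes {1..k}" by simp
    then show "of_int (sign (map_permutation {1..k} f \<sigma>)) = (of_int (sign \<sigma>) :: 'a)"
      by (simp only: sign_map_permutation[OF \<open>inj_on f {1..k}\<close>] finite_atLeastAtMost)
    have "map (?g \<sigma>) (map f [1..<Suc k])
      = map (?h \<sigma>) [1..<Suc k]"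
      unfolding map_map
    proof (intro map_cong refl)
      fix s assume "s \<in> set [1..<Suc k]"
      then have s: "s \<in> {1..k}" by auto
      have \<sigma>s: "\<sigma> s \<in> {1..k}"
        using permutes_in_image[OF \<sigma>] s by simp
      have "f (\<sigma> s) = f s \<longleftrightarrow> \<sigma> s = s"
        using \<open>inj_on f {1..k}\<close> s \<sigma>s by (auto dest: inj_onD)
      moreover have "map_permutation {1..k} f \<sigma> (f s) = f (\<sigma> s)"
        by (rule map_permutation_apply[OF \<open>inj_on f {1..k}\<close> s])
      ultimately show "((?g \<sigma>) \<circ> f) s
        = ?h \<sigma> s"
        unfolding o_apply by (simp only: card[OF s]) (simp add: f_def)
    qed
    then show "prod_list (map (?g \<sigma>) is)
      = prod_list (map (?h \<sigma>) [1..<Suc k])"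
      unfolding map_f by simp
  qed
  finally show ?thesis .
qed

abbreviation gl_det :: "nat \<Rightarrow> nat \<Rightarrow> int \<Rightarrow> nat set \<Rightarrow> uea"
  where "gl_det m n \<equiv> capelli_det (\<lambda>i j. egen m n (Proper i) (Proper j))"

lemma lprod_cong: "(\<And>x. x \<in> set xs \<Longrightarrow> f x = g x) \<Longrightarrow> lprod R (map f xs) = lprod R (map g xs)"
  by (metis map_cong)

lemma strict_lists_bij:
  "bij_betw set {is. length is = k \<and> sorted_wrt (<) is \<and> set is \<subseteq> {1..n :: nat}} {J. J \<subseteq> {1..n} \<and> card J = k}"
proof (rule bij_betw_byWitness[where f' = sorted_list_of_set])
  show "\<forall>is\<in>{is. length is = k \<and> sorted_wrt (<) is \<and> set is \<subseteq> {1..n}}. sorted_list_of_set (set is) = is"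
    by (simp add: sorted_list_of_set.idem_if_sorted_distinct strict_sorted_iff)
  have fin: "finite J" if "J \<subseteq> {1..n}" for J
    using that finite_subset by blast
  then show "\<forall>J\<in>{J. J \<subseteq> {1..n} \<and> card J = k}. set (sorted_list_of_set J) = J"
    by simp
  show "sorted_list_of_set ` {J. J \<subseteq> {1..n} \<and> card J = k} \<subseteq> {is. length is = k \<and> sorted_wrt (<) is \<and> set is \<subseteq> {1..n}}"
  proof (intro image_subsetI CollectI)
    fix J assume "J \<in> {J. J \<subseteq> {1..n} \<and> card J = k}"
    then show "length (sorted_list_of_set J) = k \<and> sorted_wrt (<) (sorted_list_of_set J) \<and> set (sorted_list_of_set J) \<subseteq> {1..n}"
      using fin[of J] by simp
  qed
  show "set ` {is. length is = k \<and> sorted_wrt (<) is \<and> set is \<subseteq> {1..n}} \<subseteq> {J. J \<subseteq> {1..n} \<and> card J = k}"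
    by (auto simp: strict_sorted_iff distinct_card)
qed

lemma component_cdet:
  assumes "length is = k" "sorted_wrt (<) is" "set is \<subseteq> {1..n}"
  shows "component (gl_det m n 0 (set is)) m n = cdet (env m n) k (\<lambda>r s.
         e m n (Proper (is ! (r - 1))) (Proper (is ! (s - 1)))
         \<oplus>\<^bsub>env m n\<^esub> (if r = s then [(k - r)] \<cdot>\<^bsub>env m n\<^esub> \<one>\<^bsub>env m n\<^esub> else \<zero>\<^bsub>env m n\<^esub>))"
    (is "_ = cdet _ _ ?a")
proof -
  let ?b = "\<lambda>\<sigma> s. egen m n (Proper (is ! (\<sigma> s - 1))) (Proper (is ! (s - 1))) + (if \<sigma> s = s then of_nat (k - \<sigma> s) else 0)"
  have entry: "component (?b \<sigma> s) m n = ?a (\<sigma> s) s" if \<sigma>: "\<sigma> permutes {1..k}" and s: "s \<in> set [1..<Suc k]" for \<sigma> s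
  proof -
    have s: "s \<in> {1..k}" using s by auto
    then have \<sigma>s: "\<sigma> s \<in> {1..k}"
      using permutes_in_image[OF \<sigma>] by simp
    have "is ! (s - 1) \<in> {1..n}" "is ! (\<sigma> s - 1) \<in> {1..n}"
      using s \<sigma>s assms(1) by (intro subsetD[OF assms(3)] nth_mem; simp; linarith)+
    then have "component (egen m n (Proper (is ! (\<sigma> s - 1))) (Proper (is ! (s - 1)))) m n
        = e m n (Proper (is ! (\<sigma> s - 1))) (Proper (is ! (s - 1)))"
      by (intro component_egen) (simp_all add: gl.symbols_simps)
    moreover have "component (of_nat j) m n = [j] \<cdot>\<^bsub>env m n\<^esub> \<one>\<^bsub>env m n\<^esub>" for j
      using component_of_nat_mult[of j 1 m n] by simp
    ultimately show ?thesis
      by simp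
  qed
  have "component (gl_det m n 0 (set is)) m n
    = (\<Oplus>\<^bsub>env m n\<^esub>\<sigma> \<in> {\<sigma>. \<sigma> permutes {1..k}}. component (of_int (sign \<sigma>) * prod_list (map (?b \<sigma>) [1..<Suc k])) m n)"
    unfolding capelli_det_list[OF assms(2,1)] component_sum ..
  also have "\<dots> = cdet (env m n) k ?a"
    unfolding cdet_def
  proof (rule env.finsum_cong'[symmetric])
    fix \<sigma> assume "\<sigma> \<in> {\<sigma>. \<sigma> permutes {1..k}}"
    then have "lprod (env m n) (map (\<lambda>s. component (?b \<sigma> s) m n) [1..<Suc k]) = lprod (env m n) (map (\<lambda>s. ?a (\<sigma> s) s) [1..<Suc k])"
      by (intro lprod_cong entry) simp_all
    then show "[sign \<sigma>] \<cdot>\<^bsub>env m n\<^esub> lprod (env m n) (map (\<lambda>s. ?a (\<sigma> s) s) [1..<Suc k])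
      = component (of_int (sign \<sigma>) * prod_list (map (?b \<sigma>) [1..<Suc k])) m n"
      unfolding component_of_int_mult component_prod_list map_map o_def by simp
  qed simp_all
  finally show ?thesis .
qed

lemma component_capelli_H:
  "component (\<Sum>J | J \<subseteq> {1..n} \<and> card J = k. gl_det m n 0 J) m n = capelli_H m n k"
proof (cases "k = 0")
  case True
  have "{J. J \<subseteq> {1..n} \<and> card J = 0} = {{}}"
    using finite_subset by (auto simp: card_eq_0_iff)
  moreover have "gl_det m n 0 {} = 1"
    by (simp add: capelli_det_def)
  ultimately show ?thesis
    using True by (simp add: capelli_H_def)
next
  case False
  have "component (\<Sum>J | J \<subseteq> {1..n} \<and> card J = k. gl_det m n 0 J) m n
    = component (\<Sum>is | length is = k \<and> sorted_wrt (<) is \<and> set is \<subseteq> {1..n}. gl_det m n 0 (set is)) m n"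
    by (simp only: sum.reindex_bij_betw[OF strict_lists_bij])
  also have "\<dots> = capelli_H m n k"
    unfolding component_sum capelli_H_def if_not_P[OF False]
    by (intro env.finsum_cong'[symmetric] component_cdet[symmetric]) simp_all
  finally show ?thesis .
qed

text \<open>Grouping the minors in \<open>capelli_det_neg\<close> by their size.\<close>

lemma component_capelli_C: "component (gl_det m n (- int q) {1..n}) m n = capelli_C m n q"
proof -
  let ?k = "\<lambda>d. (- 1) ^ d * falling_factorial (int q) d"
  have "gl_det m n (- int q) {1..n} = (\<Sum>J\<in>Pow {1..n}. of_int (?k (n - card J)) * gl_det m n 0 J)"
    using capelli_det_neg[of "{1..n}" "\<lambda>i j. egen m n (Proper i) (Proper j)" q] by simp
  also have "\<dots> = (\<Sum>j\<in>{0..n}. \<Sum>J | J \<in> Pow {1..n} \<and> card J = j. of_int (?k (n - card J)) * gl_det m n 0 J)"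
  proof (rule sum.group[symmetric])
    have "card J \<le> n" if "J \<subseteq> {1..n}" for J
      using that card_mono[of "{1..n}" J] by simp
    then show "card ` Pow {1..n} \<subseteq> {0..n}"
      by auto
  qed simp_all
  also have "\<dots> = (\<Sum>j\<in>{0..n}. of_int (?k (n - j)) * (\<Sum>J | J \<subseteq> {1..n} \<and> card J = j. gl_det m n 0 J))"
    unfolding sum_distrib_left by (intro sum.cong) auto
  finally have "gl_det m n (- int q) {1..n} = \<dots>" .
  then have "component (gl_det m n (- int q) {1..n}) m n
    = (\<Oplus>\<^bsub>env m n\<^esub>j\<in>{0..n}. component (of_int (?k (n - j)) * (\<Sum>J | J \<subseteq> {1..n} \<and> card J = j. gl_det m n 0 J)) m n)"
    by (simp only: component_sum)
  also have "\<dots> = capelli_C m n q"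
    unfolding capelli_C_def component_of_int_mult component_capelli_H ..
  finally show ?thesis .
qed

section \<open>Central elements and the recursion for rectangular bitableaux\<close>

definition gl_part :: "nat \<Rightarrow> nat \<Rightarrow> uea set"
  where "gl_part m n = {x. component x m n \<in> env_gl m n}"

lemma gl_part_closed:
  "0 \<in> gl_part m n" "1 \<in> gl_part m n"
  "x \<in> gl_part m n \<Longrightarrow> y \<in> gl_part m n \<Longrightarrow> x + y \<in> gl_part m n"
  "x \<in> gl_part m n \<Longrightarrow> y \<in> gl_part m n \<Longrightarrow> x - y \<in> gl_part m n"
  "x \<in> gl_part m n \<Longrightarrow> y \<in> gl_part m n \<Longrightarrow> x * y \<in> gl_part m n"
  "i \<in> {1..n} \<Longrightarrow> j \<in> {1..n} \<Longrightarrow> egen m n (Proper i) (Proper j) \<in> gl_part m n"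
proof -
  have "\<one>\<^bsub>env m n\<^esub> \<oplus>\<^bsub>env m n\<^esub> (\<ominus>\<^bsub>env m n\<^esub> \<one>\<^bsub>env m n\<^esub>) \<in> env_gl m n"
    by (intro env_gl_closed)
  then have "\<zero>\<^bsub>env m n\<^esub> \<in> env_gl m n"
    by (simp add: env.r_neg)
  then show "0 \<in> gl_part m n"
    by (simp add: gl_part_def)
qed (simp_all add: gl_part_def a_minus_def env_gl_closed component_egen gl.symbols_simps)

lemma gl_part_of_int: "of_int k \<in> gl_part m n"
  by (induction k rule: int_induct[of _ 0]) (simp_all add: gl_part_closed)

lemma gl_part_sum: "(\<And>a. a \<in> A \<Longrightarrow> f a \<in> gl_part m n) \<Longrightarrow> sum f A \<in> gl_part m n"
  by (induction A rule: infinite_finite_induct) (simp_all add: gl_part_closed)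

lemma gl_part_prod_list: "(\<And>x. x \<in> set xs \<Longrightarrow> x \<in> gl_part m n) \<Longrightarrow> prod_list xs \<in> gl_part m n"
  by (induction xs) (simp_all add: gl_part_closed)

lemma gl_det_gl_part:
  assumes "S \<subseteq> {1..n}"
  shows "gl_det m n u S \<in> gl_part m n"
  unfolding capelli_det_def
proof (intro gl_part_sum gl_part_closed gl_part_of_int gl_part_prod_list)
  fix \<sigma> x assume \<sigma>: "\<sigma> \<in> {\<sigma>. \<sigma> permutes S}" and "x \<in> set (map (\<lambda>s. egen m n (Proper (\<sigma> s)) (Proper s)
      + (if \<sigma> s = s then of_int (u + int (card {t \<in> S. s < t})) else 0)) (sorted_list_of_set S))"
  moreover have "finite S"
    using assms finite_subset by blast
  ultimately obtain s where s: "s \<in> S"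
    and x: "x = egen m n (Proper (\<sigma> s)) (Proper s) + (if \<sigma> s = s then of_int (u + int (card {t \<in> S. s < t})) else 0)"
    by auto
  have "\<sigma> s \<in> S"
    using \<sigma> s permutes_in_image by fastforce
  then show "x \<in> gl_part m n"
    unfolding x using s assms gl_part_of_int[of "u + int (card {t \<in> S. s < t})" m n]
    by (intro gl_part_closed) (auto simp: gl_part_closed)
qed

lemma env_gl_centerI:
  assumes "z \<in> env_gl m n"
    and "\<And>i j. i \<in> {1..n} \<Longrightarrow> j \<in> {1..n} \<Longrightarrow>
      z \<otimes>\<^bsub>env m n\<^esub> e m n (Proper i) (Proper j) = e m n (Proper i) (Proper j) \<otimes>\<^bsub>env m n\<^esub> z"
  shows "z \<in> env_gl_center m n"
proof -
  have z: "z \<in> carrier (env m n)"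
    using assms(1) env_gl_closed(1) by blast
  have "z \<otimes>\<^bsub>env m n\<^esub> x = x \<otimes>\<^bsub>env m n\<^esub> z" if "x \<in> env_gl m n" for x
    using that
  proof (induction rule: env_gl_induct)
    case (scalar c)
    obtain f where f: "f \<in> carrier (fa m n)" "z = env_class m n f"
      using z carrier_env by blast
    then show ?case
      by (simp add: env_class_simps(2)[symmetric] const_mult_commute)
  next
    case (uminus x)
    then have "x \<in> carrier (env m n)"
      using env_gl_closed(1) by blast
    with uminus z show ?case
      by (simp add: env.l_minus env.r_minus)
  next
    case (add x y)
    then have "x \<in> carrier (env m n)" "y \<in> carrier (env m n)"
      using env_gl_closed(1) by blast+
    with add z show ?case
      by (simp add: env.l_distr env.r_distr)
  next
    case (mult x y)
    then have xy: "x \<in> carrier (env m n)" "y \<in> carrier (env m n)"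
      using env_gl_closed(1) by blast+
    have "z \<otimes>\<^bsub>env m n\<^esub> (x \<otimes>\<^bsub>env m n\<^esub> y) = (z \<otimes>\<^bsub>env m n\<^esub> x) \<otimes>\<^bsub>env m n\<^esub> y"
      using xy z by (simp add: env.m_assoc)
    also have "\<dots> = x \<otimes>\<^bsub>env m n\<^esub> (z \<otimes>\<^bsub>env m n\<^esub> y)"
      using mult xy z by (simp add: env.m_assoc)
    also have "\<dots> = x \<otimes>\<^bsub>env m n\<^esub> y \<otimes>\<^bsub>env m n\<^esub> z"
      using mult xy z by (simp add: env.m_assoc)
    finally show ?case .
  qed (use z assms(2) in simp_all)
  with assms(1) show ?thesis
    by (simp add: env_gl_center_def)
qed

text \<open>Commuting with the generators suffices, and by \<open>creat_rows_faithful\<close> the commutators may be tested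
after multiplication by rows of creators and modulo \<open>Irr\<close>.\<close>

lemma gl_part_centerI:
  assumes "z \<in> gl_part m n" "q \<le> m"
    and "\<And>i j. i \<in> {1..n} \<Longrightarrow> j \<in> {1..n} \<Longrightarrow>
      gl.word m n (gl.creat_rows n q) * (egen m n (Proper i) (Proper j) * z - z * egen m n (Proper i) (Proper j)) \<in> irr m n"
  shows "component z m n \<in> env_gl_center m n"
proof (rule env_gl_centerI)
  show "component z m n \<in> env_gl m n"
    using assms(1) by (simp add: gl_part_def)
  fix i j assume ij: "i \<in> {1..n}" "j \<in> {1..n}"
  let ?c = "egen m n (Proper i) (Proper j) * z - z * egen m n (Proper i) (Proper j)"
  have "?c \<in> gl_part m n"
    using ij assms(1) by (intro gl_part_closed)
  moreover have "mon m n (gl.creat_rows n q) \<otimes>\<^bsub>env m n\<^esub> component ?c m n \<in> Irr m n"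
    using assms(3)[OF ij] component_word[OF creat_rows_symbols(1)[OF assms(2)]] by (simp add: irr_def)
  ultimately have "component ?c m n = \<zero>\<^bsub>env m n\<^esub>"
    using assms(2) by (intro creat_rows_faithful) (simp_all only: gl_part_def mem_Collect_eq)
  then show "component z m n \<otimes>\<^bsub>env m n\<^esub> e m n (Proper i) (Proper j) = e m n (Proper i) (Proper j) \<otimes>\<^bsub>env m n\<^esub> component z m n"
    using ij by (simp add: component_egen gl.symbols_simps)
qed

text \<open>The product that results from applying \<open>capelli_step\<close> repeatedly; by \<open>component_K_product\<close> it
is \<open>K\<^sub>n\<^sup>q\<close>.\<close>

primrec K_product :: "nat \<Rightarrow> nat \<Rightarrow> nat \<Rightarrow> uea" where
  "K_product m n 0 = 1"
| "K_product m n (Suc q) = (- 1) ^ (n * q) * (K_product m n q * gl_det m n (- int q) {1..n})"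

lemma K_product_gl_part: "K_product m n q \<in> gl_part m n"
proof (induction q)
  case (Suc q)
  have "(- 1) ^ (n * q) = (of_int ((- 1) ^ (n * q)) :: uea)"
    by simp
  then show ?case
    using Suc gl_part_of_int by (simp only: K_product.simps gl_part_closed gl_det_gl_part)
qed (simp add: gl_part_closed)

text \<open>Besides \<open>capelli_step\<close> this uses that \<open>Irr\<close> is stable under right multiplication by \<open>U(gl(n))\<close>, which
carries the congruence for \<open>q\<close> over to the product with \<open>C\<^sub>n(q)\<close>.\<close>

lemma K_product_mod_irr:
  "q \<le> m \<Longrightarrow> gl.word m n (gl.annih_rows n q) * gl.word m n (gl.creat_rows n q) - K_product m n q \<in> irr m n"
proof (induction q)
  case 0
  then show ?case
    by (simp add: gl.annih_rows_def gl.creat_rows_def gl.zero_mem)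
next
  case (Suc q)
  let ?x = "\<lambda>q. gl.word m n (gl.annih_rows n q) * gl.word m n (gl.creat_rows n q)"
  let ?C = "gl_det m n (- int q) {1..n}"
  have "(?x q - K_product m n q) * ?C \<in> irr m n"
    using Suc gl_det_gl_part[of "{1..n}" n m "- int q"] Irr_times_env_gl[of "component ?C m n" m n "component (?x q - K_product m n q) m n"]
    by (simp add: irr_def gl_part_def)
  then have "(- 1) ^ (n * q) * ((?x q - K_product m n q) * ?C) \<in> irr m n"
    by (rule gl.left_mem)
  moreover have "?x (Suc q) - (- 1) ^ (n * q) * (gl.word m n (gl.annih_rows n q) * (gl.word m n (gl.creat_rows n q) * ?C)) \<in> irr m n"
    using Suc.prems by (intro gl.capelli_step) simp
  ultimately have "?x (Suc q) - (- 1) ^ (n * q) * (gl.word m n (gl.annih_rows n q) * (gl.word m n (gl.creat_rows n q) * ?C))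
      + (- 1) ^ (n * q) * ((?x q - K_product m n q) * ?C) \<in> irr m n"
    by (intro gl.add_mem)
  then show ?case
    by (simp add: left_diff_distrib right_diff_distrib mult.assoc)
qed

lemma concat_replicate_rows:
  "concat (map (\<lambda>i. map (h i) (replicate p xs ! i)) [0..<length (replicate p xs)]) = concat (map (\<lambda>i. map (h i) xs) [0..<p])"
  by (intro arg_cong[where f = concat] map_cong) simp_all

lemma component_K_product:
  assumes "q \<le> m"
  shows "component (K_product m n q) m n = capelli_K m n q"
proof (cases "q = 0")
  case True
  then show ?thesis by (simp add: capelli_K_def)
next
  case False
  let ?x = "mon m n (gl.annih_rows n q) \<otimes>\<^bsub>env m n\<^esub> mon m n (gl.creat_rows n q)"
  have "devirt m n ?x = component (K_product m n q) m n"
  proof (rule devirt_eqI)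
    show "component (K_product m n q) m n \<in> env_gl m n"
      using K_product_gl_part by (simp add: gl_part_def)
    show "?x \<in> carrier (env m n)"
      using creat_rows_symbols[OF assms] by (simp add: mon_closed)
    show "?x \<ominus>\<^bsub>env m n\<^esub> component (K_product m n q) m n \<in> Irr m n"
      using K_product_mod_irr[OF assms, of n] component_word[OF creat_rows_symbols(1)[OF assms]]
        component_word[OF creat_rows_symbols(2)[OF assms]] by (simp add: irr_def)
  qed
  moreover have "capelli_K m n q = devirt m n ?x"
    using False by (simp only: capelli_K_def capelli_bitableau_def concat_replicate_rows gl.annih_rows_def gl.creat_rows_def if_False)
  ultimately show ?thesis by simp
qed

lemma capelli_K_center:
  assumes "q \<le> m"
  shows "capelli_K m n q \<in> env_gl_center m n"
  unfolding component_K_product[OF assms, symmetric]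
proof (rule gl_part_centerI[of _ m n 0])
  fix i j assume ij: "i \<in> {1..n}" "j \<in> {1..n}"
  let ?x = "gl.word m n (gl.annih_rows n q) * gl.word m n (gl.creat_rows n q)"
  let ?e = "egen m n (Proper i) (Proper j)"
  have x: "?x - K_product m n q \<in> irr m n"
    by (rule K_product_mod_irr[OF assms])
  have "(?x - K_product m n q) * ?e - ?e * (?x - K_product m n q) \<in> irr m n"
    by (rule gl.diff_mem[OF gl.right_mem[OF x ij] gl.left_mem[OF x]])
  moreover have "?e * ?x = ?x * ?e"
    by (rule gl.polar_rows_commute[OF ij assms])
  ultimately show "gl.word m n (gl.creat_rows n 0) * (?e * K_product m n q - K_product m n q * ?e) \<in> irr m n"
    by (simp add: gl.creat_rows_def left_diff_distrib right_diff_distrib)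
qed (simp_all add: K_product_gl_part)

lemma capelli_C_center:
  assumes "q < m"
  shows "capelli_C m n q \<in> env_gl_center m n"
  unfolding component_capelli_C[symmetric]
proof (rule gl_part_centerI[of _ m n q])
  show "gl_det m n (- int q) {1..n} \<in> gl_part m n"
    by (rule gl_det_gl_part) simp
qed (use assms gl.capelli_det_commutator in simp_all)

theorem corollary1:
  fixes m n p :: nat
  assumes "n \<ge> 1" and "p \<ge> 1" and "m \<ge> p"
  shows "capelli_K m n p \<in> env_gl_center m n
    \<and> capelli_C m n (p - 1) \<in> env_gl_center m n
    \<and> capelli_K m n (p - 1) \<in> env_gl_center m n
    \<and> capelli_K m n p =
        [((- 1 :: int) ^ (n * (p - 1)))] \<cdot>\<^bsub>env m n\<^esub>
          (capelli_C m n (p - 1) \<otimes>\<^bsub>env m n\<^esub> capelli_K m n (p - 1))"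
proof -
  obtain q where p: "p = Suc q"
    using assms(2) by (cases p) auto
  then have q: "q < m" "q \<le> m"
    using assms(3) by simp_all
  have C: "capelli_C m n q \<in> env_gl_center m n"
    using q by (intro capelli_C_center)
  have K: "capelli_K m n q \<in> env_gl_center m n"
    using q by (intro capelli_K_center)
  have "K_product m n (Suc q) = of_int ((- 1) ^ (n * q)) * (K_product m n q * gl_det m n (- int q) {1..n})"
    by simp
  then have "component (K_product m n (Suc q)) m n
      = [((- 1 :: int) ^ (n * q))] \<cdot>\<^bsub>env m n\<^esub> (component (K_product m n q) m n \<otimes>\<^bsub>env m n\<^esub> component (gl_det m n (- int q) {1..n}) m n)"
    by (simp only: component_of_int_mult component_simps(4)[of "K_product m n q"])
  then have "capelli_K m n (Suc q)
      = [((- 1 :: int) ^ (n * q))] \<cdot>\<^bsub>env m n\<^esub> (capelli_K m n q \<otimes>\<^bsub>env m n\<^esub> capelli_C m n q)"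
    using q assms(3) p by (simp only: component_K_product component_capelli_C)
  moreover have "capelli_K m n q \<otimes>\<^bsub>env m n\<^esub> capelli_C m n q = capelli_C m n q \<otimes>\<^bsub>env m n\<^esub> capelli_K m n q"
    using C K unfolding env_gl_center_def by blast
  moreover have "capelli_K m n p \<in> env_gl_center m n"
    using assms(3) by (rule capelli_K_center)
  ultimately show ?thesis
    using C K unfolding p diff_Suc_1 by simp
qed

end
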